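(* Let $SW=\langle s,w \mid s^2=1,\ w^2=0,\ sw=-ws\rangle$ be the four-dimensional complex Sweedler algebra, equipped with any ribbon Hopf algebra structure (with the given underlying algebra). Then the universal invariant $\mathfrak{Z}_{SW}$ of oriented, framed, long knots produced by this ribbon Hopf algebra depends only on the framing: if $\mathrm{fr}(K)=\mathrm{fr}(K')$ then $\mathfrak{Z}_{SW}(K)=\mathfrak{Z}_{SW}(K')$. Likewise, for every finite-dimensional representation $V$ of $SW$ equipped with any ribbon Hopf algebra structure, the Reshetikhin–Turaev invariant of framed knots coloured by $V$ depends only on the framing of the knot.
   Context: A ribbon Hopf algebra $(H,\mathcal{R},v)$, with universal $R$-matrix $\mathcal{R}=\sum_i\alpha_i\otimes\beta_i$, antipode $S$, Drinfeld element $u=\sum_iS(\beta_i)\alpha_i$ and ribbon element $v$, has the balancing element $\kappa=uv^{-1}$; the pair $(R,\kappa)=(\mathcal{R},uv^{-1})$ is used to define its universal invariant $\mathfrak{Z}_H$ as follows. Rotational diagrams. A long knot is an arc properly embedded in a cube running from the bottom face to the top face, oriented upwards at both ends; knots are oriented and framed, and diagrams carry the blackboard framing, so $\mathrm{fr}(K)\in\mathbb{Z}$ equals the writhe (number of positive minus number of negative crossings) of any diagram of $K$. A rotational diagram is a planar diagram that is assembled by joining copies of the following pieces: $I$, an arc going upwards; $X$, a positive crossing with both strands oriented upwards (the overstrand runs from bottom left to top right); $X^-$, a negative crossing with both strands oriented upwards (the overstrand runs from bottom right to top left); $C$, an embedded arc performing one full counterclockwise rotation (starts upwards, turns left over a maximum,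 goes down, turns right through a minimum, ends upwards); $C^-$, an embedded arc performing one full clockwise rotation (the mirror image of $C$ in a vertical line). Every long knot has a rotational diagram. Universal invariant. Given a rotational diagram $D$ of $K$, place beads on $D$: for each $X$ a copy of $R=\sum\alpha_i\otimes\beta_i$, with $\alpha_i$ on the overstrand and $\beta_i$ on the understrand; for each $X^-$ a copy of $R^{-1}=\sum\bar\alpha_i\otimes\bar\beta_i$, with $\bar\alpha_i$ on the overstrand and $\bar\beta_i$ on the understrand; $\kappa^{-1}$ on each $C$; $\kappa$ on each $C^-$; $1$ on each $I$ (independent summation indices for different crossings). Then $\mathfrak{Z}_H(K)\in H$ is the sum over all indices of the product of the beads met while travelling along the knot following its orientation, written from right to left (the first bead met is the rightmost factor). This is an isotopy invariant of oriented, framed, long knots. Reshetikhin–Turaev invariant. For a finite-dimensional $H$-module $V$, it is the endomorphism of $V$ assigned to a framed, oriented long knot coloured by $V$ under the Reshetikhin–Turaev functor from the category of framed, oriented $V$-coloured tangles to the ribbon category of finite-dimensional $H$-modules. It equals the action $\rho_V(\mathfrak{Z}_H(K))$ of the universal invariant on $V$, where $\rho_V:H\to\mathrm{End}(V)$ is the representation. *)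

theory Defs
  imports
    "HOL-Analysis.Cartesian_Space"
    "Jordan_Normal_Form.Matrix"
begin

hide_type (open) Matrix.vec
no_notation vec_index (infixl \<open>$\<close> 100)
no_notation scalar_prod (infix \<open>\<bullet>\<close> 70)

section \<open>Tensor products of coordinate spaces\<close>

text \<open>
  A finite-dimensional complex vector space with basis indexed by the finite type 'b is
  complex^'b, and its tensor product with complex^'c is complex^('b \<times> 'c).
\<close>

abbreviation basis :: "'b::finite \<Rightarrow> complex^'b" where
  "basis i \<equiv> axis i 1"

definition tensor :: "complex^'b::finite \<Rightarrow> complex^'c::finite \<Rightarrow> complex^('b \<times> 'c)"
    (infixr \<open>\<otimes>\<^sub>c\<close> 75) where
  "x \<otimes>\<^sub>c y = (\<chi> p. x $ fst p * y $ snd p)"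

text \<open>
  The linear map on a tensor product induced by a bilinear map f. In Sweedler-style notation,
  if t is the sum of the x_i \<otimes> y_i, then tlift f t is the sum of the f x_i y_i.
\<close>

definition tlift ::
    "(complex^'b::finite \<Rightarrow> complex^'c::finite \<Rightarrow> complex^'d::finite) \<Rightarrow>
     complex^('b \<times> 'c) \<Rightarrow> complex^'d" where
  "tlift f t = (\<Sum>p\<in>UNIV. (t $ p) *s f (basis (fst p)) (basis (snd p)))"

definition tflip :: "complex^('b::finite \<times> 'c::finite) \<Rightarrow> complex^('c \<times> 'b)" where
  "tflip = tlift (\<lambda>x y. y \<otimes>\<^sub>c x)"

definition tassoc ::
    "complex^(('b::finite \<times> 'c::finite) \<times> 'd::finite) \<Rightarrow> complex^('b \<times> 'c \<times> 'd)" where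
  "tassoc = tlift (\<lambda>t z. tlift (\<lambda>x y. x \<otimes>\<^sub>c y \<otimes>\<^sub>c z) t)"

text \<open>The product (x \<otimes> y)(x' \<otimes> y') = xx' \<otimes> yy' of two algebras.\<close>

definition tmul ::
    "(complex^'b::finite \<Rightarrow> complex^'b \<Rightarrow> complex^'b) \<Rightarrow>
     (complex^'c::finite \<Rightarrow> complex^'c \<Rightarrow> complex^'c) \<Rightarrow>
     complex^('b \<times> 'c) \<Rightarrow> complex^('b \<times> 'c) \<Rightarrow> complex^('b \<times> 'c)" where
  "tmul m1 m2 s t = tlift (\<lambda>x y. tlift (\<lambda>x' y'. m1 x x' \<otimes>\<^sub>c m2 y y') t) s"

definition clinear_map :: "(complex^'b::finite \<Rightarrow> complex^'c::finite) \<Rightarrow> bool" where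
  "clinear_map f \<longleftrightarrow> Vector_Spaces.linear (*s) (*s) f"

definition clinear_form :: "(complex^'b::finite \<Rightarrow> complex) \<Rightarrow> bool" where
  "clinear_form f \<longleftrightarrow> Vector_Spaces.linear (*s) (*) f"


section \<open>Ribbon Hopf algebras\<close>

record 'b ribbon_data =
  alg_mul :: "complex^'b \<Rightarrow> complex^'b \<Rightarrow> complex^'b"
  alg_unit :: "complex^'b"
  comul :: "complex^'b \<Rightarrow> complex^('b \<times> 'b)"
  counit :: "complex^'b \<Rightarrow> complex"
  antipode :: "complex^'b \<Rightarrow> complex^'b"
  rmatrix :: "complex^('b \<times> 'b)"
  ribbon :: "complex^'b"

definition alg_inverse :: "('a \<Rightarrow> 'a \<Rightarrow> 'a) \<Rightarrow> 'a \<Rightarrow> 'a \<Rightarrow> 'a" where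
  "alg_inverse m e x = (THE y. m x y = e \<and> m y x = e)"

definition alg_invertible :: "('a \<Rightarrow> 'a \<Rightarrow> 'a) \<Rightarrow> 'a \<Rightarrow> 'a \<Rightarrow> bool" where
  "alg_invertible m e x \<longleftrightarrow> (\<exists>y. m x y = e \<and> m y x = e)"

definition mul2 ::
    "('b::finite) ribbon_data \<Rightarrow> complex^('b \<times> 'b) \<Rightarrow> complex^('b \<times> 'b) \<Rightarrow> complex^('b \<times> 'b)" where
  "mul2 H = tmul (alg_mul H) (alg_mul H)"

definition mul3 ::
    "('b::finite) ribbon_data \<Rightarrow> complex^('b \<times> 'b \<times> 'b) \<Rightarrow> complex^('b \<times> 'b \<times> 'b) \<Rightarrow>
     complex^('b \<times> 'b \<times> 'b)" where
  "mul3 H = tmul (alg_mul H) (mul2 H)"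

definition unital_algebra :: "('b::finite) ribbon_data \<Rightarrow> bool" where
  "unital_algebra H \<longleftrightarrow>
     (\<forall>x. clinear_map (alg_mul H x)) \<and> (\<forall>y. clinear_map (\<lambda>x. alg_mul H x y)) \<and>
     (\<forall>x y z. alg_mul H (alg_mul H x y) z = alg_mul H x (alg_mul H y z)) \<and>
     (\<forall>x. alg_mul H (alg_unit H) x = x \<and> alg_mul H x (alg_unit H) = x)"

definition coalgebra :: "('b::finite) ribbon_data \<Rightarrow> bool" where
  "coalgebra H \<longleftrightarrow>
     clinear_map (comul H) \<and> clinear_form (counit H) \<and>
     (\<forall>h. tlift (\<lambda>x y. tassoc (comul H x \<otimes>\<^sub>c y)) (comul H h) =
          tlift (\<lambda>x y. x \<otimes>\<^sub>c comul H y) (comul H h)) \<and>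
     (\<forall>h. tlift (\<lambda>x y. counit H x *s y) (comul H h) = h) \<and>
     (\<forall>h. tlift (\<lambda>x y. counit H y *s x) (comul H h) = h)"

definition bialgebra :: "('b::finite) ribbon_data \<Rightarrow> bool" where
  "bialgebra H \<longleftrightarrow>
     unital_algebra H \<and> coalgebra H \<and>
     (\<forall>x y. comul H (alg_mul H x y) = mul2 H (comul H x) (comul H y)) \<and>
     comul H (alg_unit H) = alg_unit H \<otimes>\<^sub>c alg_unit H \<and>
     (\<forall>x y. counit H (alg_mul H x y) = counit H x * counit H y) \<and>
     counit H (alg_unit H) = 1"

definition hopf_algebra :: "('b::finite) ribbon_data \<Rightarrow> bool" where
  "hopf_algebra H \<longleftrightarrow>
     bialgebra H \<and> clinear_map (antipode H) \<and>
     (\<forall>h. tlift (\<lambda>x y. alg_mul H (antipode H x) y) (comul H h) = counit H h *s alg_unit H) \<and>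
     (\<forall>h. tlift (\<lambda>x y. alg_mul H x (antipode H y)) (comul H h) = counit H h *s alg_unit H)"

definition R12 :: "('b::finite) ribbon_data \<Rightarrow> complex^('b \<times> 'b \<times> 'b)" where
  "R12 H = tlift (\<lambda>a b. a \<otimes>\<^sub>c b \<otimes>\<^sub>c alg_unit H) (rmatrix H)"

definition R13 :: "('b::finite) ribbon_data \<Rightarrow> complex^('b \<times> 'b \<times> 'b)" where
  "R13 H = tlift (\<lambda>a b. a \<otimes>\<^sub>c alg_unit H \<otimes>\<^sub>c b) (rmatrix H)"

definition R23 :: "('b::finite) ribbon_data \<Rightarrow> complex^('b \<times> 'b \<times> 'b)" where
  "R23 H = tlift (\<lambda>a b. alg_unit H \<otimes>\<^sub>c a \<otimes>\<^sub>c b) (rmatrix H)"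

definition quasitriangular :: "('b::finite) ribbon_data \<Rightarrow> bool" where
  "quasitriangular H \<longleftrightarrow>
     hopf_algebra H \<and>
     alg_invertible (mul2 H) (alg_unit H \<otimes>\<^sub>c alg_unit H) (rmatrix H) \<and>
     (\<forall>h. mul2 H (rmatrix H) (comul H h) = mul2 H (tflip (comul H h)) (rmatrix H)) \<and>
     tlift (\<lambda>a b. tassoc (comul H a \<otimes>\<^sub>c b)) (rmatrix H) = mul3 H (R13 H) (R23 H) \<and>
     tlift (\<lambda>a b. a \<otimes>\<^sub>c comul H b) (rmatrix H) = mul3 H (R13 H) (R12 H)"

definition rmatrix_inv :: "('b::finite) ribbon_data \<Rightarrow> complex^('b \<times> 'b)" where
  "rmatrix_inv H = alg_inverse (mul2 H) (alg_unit H \<otimes>\<^sub>c alg_unit H) (rmatrix H)"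

definition drinfeld :: "('b::finite) ribbon_data \<Rightarrow> complex^'b" where
  "drinfeld H = tlift (\<lambda>a b. alg_mul H (antipode H b) a) (rmatrix H)"

definition ribbon_hopf_algebra :: "('b::finite) ribbon_data \<Rightarrow> bool" where
  "ribbon_hopf_algebra H \<longleftrightarrow>
     quasitriangular H \<and>
     alg_invertible (alg_mul H) (alg_unit H) (ribbon H) \<and>
     (\<forall>h. alg_mul H (ribbon H) h = alg_mul H h (ribbon H)) \<and>
     alg_mul H (ribbon H) (ribbon H) = alg_mul H (drinfeld H) (antipode H (drinfeld H)) \<and>
     antipode H (ribbon H) = ribbon H \<and>
     counit H (ribbon H) = 1 \<and>
     comul H (ribbon H) =
       mul2 H (alg_inverse (mul2 H) (alg_unit H \<otimes>\<^sub>c alg_unit H) (mul2 H (tflip (rmatrix H)) (rmatrix H)))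
              (ribbon H \<otimes>\<^sub>c ribbon H)"

definition balancing :: "('b::finite) ribbon_data \<Rightarrow> complex^'b" where
  "balancing H = alg_mul H (drinfeld H) (alg_inverse (alg_mul H) (alg_unit H) (ribbon H))"

definition balancing_inv :: "('b::finite) ribbon_data \<Rightarrow> complex^'b" where
  "balancing_inv H = alg_inverse (alg_mul H) (alg_unit H) (balancing H)"


section \<open>The Sweedler algebra\<close>

text \<open>
  The basis vector indexed by (a, b) is s^a w^b, exponents being read as 0 (False) and 1 (True).
  The relations give s^a w^b s^c w^d = (-1)^(bc) s^(a+c) w^(b+d), and w^2 = 0.
\<close>

type_synonym sw_index = "bool \<times> bool"

fun sw_basis_mul :: "sw_index \<Rightarrow> sw_index \<Rightarrow> complex^sw_index" where
  "sw_basis_mul (a, b) (c, d) =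
     (if b \<and> d then 0 else (if b \<and> c then - 1 else 1) *s basis (a \<noteq> c, b \<or> d))"

definition sw_mul :: "complex^sw_index \<Rightarrow> complex^sw_index \<Rightarrow> complex^sw_index" where
  "sw_mul x y = (\<Sum>p\<in>UNIV. \<Sum>q\<in>UNIV. (x $ p * y $ q) *s sw_basis_mul p q)"

definition sw_unit :: "complex^sw_index" where "sw_unit = basis (False, False)"
definition sw_s :: "complex^sw_index" where "sw_s = basis (True, False)"
definition sw_w :: "complex^sw_index" where "sw_w = basis (False, True)"

lemma sw_mul_basis: "sw_mul (basis p) (basis q) = sw_basis_mul p q"
proof -
  have "sw_mul (basis p) (basis q) =
      (\<Sum>p'\<in>UNIV. \<Sum>q'\<in>UNIV. if p' = p then (if q' = q then sw_basis_mul p' q' else 0) else 0)"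
    unfolding sw_mul_def by (intro sum.cong refl) (auto simp: axis_def)
  also have "\<dots> = (\<Sum>p'\<in>UNIV. if p' = p then \<Sum>q'\<in>UNIV. if q' = q then sw_basis_mul p' q' else 0 else 0)"
    by (intro sum.cong refl) auto
  finally show ?thesis by simp
qed

lemma sw_relations:
  "sw_mul sw_s sw_s = sw_unit"
  "sw_mul sw_w sw_w = 0"
  "sw_mul sw_s sw_w = - sw_mul sw_w sw_s"
  "sw_mul sw_s sw_w = basis (True, True)"
  by (simp_all add: sw_s_def sw_w_def sw_unit_def sw_mul_basis vec_eq_iff)


section \<open>Diagrams of long knots\<close>

text \<open>
  A planar diagram in general position with respect to height is cut into horizontal layers,
  read from bottom to top, each of which contains one crossing or one extremum between vertical
  strands. The suffixes CCW and CW say in which sense the strand turns at a maximum or minimum.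
  For both crossings the two strands are oriented upwards; at a positive crossing the
  overstrand starts at the bottom left, at a negative one it starts at the bottom right.
\<close>

datatype dir = Up | Down

datatype piece = PosX | NegX | MaxCCW | MaxCW | MinCCW | MinCW

fun source :: "piece \<Rightarrow> dir list" where
  "source PosX = [Up, Up]"
| "source NegX = [Up, Up]"
| "source MaxCCW = [Down, Up]"
| "source MaxCW = [Up, Down]"
| "source MinCCW = []"
| "source MinCW = []"

fun target :: "piece \<Rightarrow> dir list" where
  "target PosX = [Up, Up]"
| "target NegX = [Up, Up]"
| "target MaxCCW = []"
| "target MaxCW = []"
| "target MinCCW = [Down, Up]"
| "target MinCW = [Up, Down]"

text \<open>A layer consists of the strands left of the piece, the piece, and the strands right of it.\<close>

type_synonym layer = "dir list \<times> piece \<times> dir list"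
type_synonym diagram = "layer list"

fun lower :: "layer \<Rightarrow> dir list" where "lower (l, P, r) = l @ source P @ r"
fun upper :: "layer \<Rightarrow> dir list" where "upper (l, P, r) = l @ target P @ r"

fun tangle_diagram :: "dir list \<Rightarrow> diagram \<Rightarrow> dir list \<Rightarrow> bool" where
  "tangle_diagram a [] b \<longleftrightarrow> a = b"
| "tangle_diagram a (L # D) b \<longleftrightarrow> a = lower L \<and> tangle_diagram (upper L) D b"

text \<open>
  The point (k, j) of a diagram is the j-th point, from the left, in which the horizontal line
  just below layer k meets the diagram; the line of index length D is the one above all layers.
\<close>

type_synonym point = "nat \<times> nat"

definition line :: "diagram \<Rightarrow> nat \<Rightarrow> dir list" where
  "line D k = (if k < length D then lower (D ! k) else [Up])"

definition points :: "diagram \<Rightarrow> point list" where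
  "points D = [(k, j). k \<leftarrow> [0..<Suc (length D)], j \<leftarrow> [0..<length (line D k)]]"

text \<open>
  Following the orientation from one point to the next. A strand that meets the piece of the
  layer leaves it at the other of the two positions involved; the endpoint at the top is fixed.
\<close>

fun pass_up :: "layer \<Rightarrow> nat \<Rightarrow> point \<Rightarrow> point" where
  "pass_up (l, P, r) k (_, j) =
     (if j < length l then (k + 1, j)
      else if j < length l + length (source P) then
        (if target P = [] then k else k + 1, 2 * length l + 1 - j)
      else (k + 1, j - length (source P) + length (target P)))"

fun pass_down :: "layer \<Rightarrow> nat \<Rightarrow> point \<Rightarrow> point" where
  "pass_down (l, P, r) k (_, j) =
     (if j < length l then (k, j)
      else if j < length l + length (target P) then
        (if source P = [] then k + 1 else k, 2 * length l + 1 - j)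
      else (k, j - length (target P) + length (source P)))"

definition next_point :: "diagram \<Rightarrow> point \<Rightarrow> point" where
  "next_point D p =
     (case p of (k, j) \<Rightarrow>
        if line D k ! j = Up
        then (if k < length D then pass_up (D ! k) k p else p)
        else pass_down (D ! (k - 1)) (k - 1) p)"

definition walk :: "diagram \<Rightarrow> point list" where
  "walk D = map (\<lambda>t. (next_point D ^^ t) (0, 0)) [0..<length (points D)]"

text \<open>
  The diagram represents a long knot if it has one strand below and above, oriented upwards,
  and no closed components, that is, if all points lie on the component of the lowest point.
\<close>

definition long_knot_diagram :: "diagram \<Rightarrow> bool" where
  "long_knot_diagram D \<longleftrightarrow>
     tangle_diagram [Up] D [Up] \<and> set (walk D) = set (points D)"

text \<open>
  What is met on the way from a point to the next one: a crossing, given by the index of its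
  layer, from above or from below, or an extremum.
\<close>

datatype event = Over nat | Under nat | Turn piece

fun events_up :: "layer \<Rightarrow> nat \<Rightarrow> nat \<Rightarrow> event list" where
  "events_up (l, P, r) k j =
     (if j < length l \<or> length l + length (source P) \<le> j then []
      else case P of
        PosX \<Rightarrow> [if j = length l then Over k else Under k]
      | NegX \<Rightarrow> [if j = length l then Under k else Over k]
      | _ \<Rightarrow> [Turn P])"

fun events_down :: "layer \<Rightarrow> nat \<Rightarrow> event list" where
  "events_down (l, P, r) j =
     (if j < length l \<or> length l + length (target P) \<le> j then [] else [Turn P])"

definition events_at :: "diagram \<Rightarrow> point \<Rightarrow> event list" where
  "events_at D p =
     (case p of (k, j) \<Rightarrow>
        if line D k ! j = Up
        then (if k < length D then events_up (D ! k) k j else [])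
        else events_down (D ! (k - 1)) j)"

definition events :: "diagram \<Rightarrow> event list" where
  "events D = concat (map (events_at D) (walk D))"

text \<open>
  In a rotational diagram the extrema occur along the knot only in the combinations C (one
  counterclockwise maximum followed by one counterclockwise minimum) and its mirror image.
  As strands are directed upwards at crossings, no crossing lies between the two extrema.
\<close>

fun full_rotations :: "piece list \<Rightarrow> bool" where
  "full_rotations [] \<longleftrightarrow> True"
| "full_rotations (P # Q # Ps) \<longleftrightarrow>
     (P = MaxCCW \<and> Q = MinCCW \<or> P = MaxCW \<and> Q = MinCW) \<and> full_rotations Ps"
| "full_rotations [P] \<longleftrightarrow> False"

definition turns :: "event list \<Rightarrow> piece list" where
  "turns es = [P. Turn P \<leftarrow> es]"

definition rotational_diagram :: "diagram \<Rightarrow> bool" where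
  "rotational_diagram D \<longleftrightarrow> long_knot_diagram D \<and> full_rotations (turns (events D))"

text \<open>The framing of the represented knot is the blackboard framing, i.e. the writhe.\<close>

definition pieces :: "diagram \<Rightarrow> piece list" where
  "pieces D = map (\<lambda>(l, P, r). P) D"

definition framing :: "diagram \<Rightarrow> int" where
  "framing D = int (count_list (pieces D) PosX) - int (count_list (pieces D) NegX)"


section \<open>The universal invariant\<close>

text \<open>
  Expanding the R-matrix and its inverse in the basis, the summation index at a crossing is a
  pair (a, b), with the coefficient of basis a \<otimes> basis b as weight and the beads
  basis a on the overstrand and basis b on the understrand. The single bead of C or of its
  mirror image is placed at its maximum.
\<close>

definition crossings :: "diagram \<Rightarrow> nat set" where
  "crossings D = {k. k < length D \<and> (pieces D ! k = PosX \<or> pieces D ! k = NegX)}"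

definition crossing_weight ::
    "('b::finite) ribbon_data \<Rightarrow> diagram \<Rightarrow> (nat \<Rightarrow> 'b \<times> 'b) \<Rightarrow> nat \<Rightarrow> complex" where
  "crossing_weight H D c k =
     (if pieces D ! k = PosX then rmatrix H $ c k else rmatrix_inv H $ c k)"

fun bead :: "('b::finite) ribbon_data \<Rightarrow> (nat \<Rightarrow> 'b \<times> 'b) \<Rightarrow> event \<Rightarrow> complex^'b" where
  "bead H c (Over k) = basis (fst (c k))"
| "bead H c (Under k) = basis (snd (c k))"
| "bead H c (Turn P) =
     (if P = MaxCCW then balancing_inv H else if P = MaxCW then balancing H else alg_unit H)"

text \<open>The fold multiplies each new bead from the left.\<close>

definition universal_invariant :: "('b::finite) ribbon_data \<Rightarrow> diagram \<Rightarrow> complex^'b" where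
  "universal_invariant H D =
     (\<Sum>c \<in> crossings D \<rightarrow>\<^sub>E UNIV.
        (\<Prod>k\<in>crossings D. crossing_weight H D c k) *s
        fold (alg_mul H) (map (bead H c) (events D)) (alg_unit H))"


section \<open>The Reshetikhin--Turaev invariant\<close>

text \<open>A module structure on the space of column vectors of length n.\<close>

definition hopf_module ::
    "('b::finite) ribbon_data \<Rightarrow> nat \<Rightarrow> (complex^'b \<Rightarrow> complex mat) \<Rightarrow> bool" where
  "hopf_module H n \<rho> \<longleftrightarrow>
     (\<forall>x. \<rho> x \<in> carrier_mat n n) \<and>
     (\<forall>x y. \<rho> (x + y) = \<rho> x + \<rho> y) \<and>
     (\<forall>c x. \<rho> (c *s x) = c \<cdot>\<^sub>m \<rho> x) \<and>
     (\<forall>x y. \<rho> (alg_mul H x y) = \<rho> x * \<rho> y) \<and>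
     \<rho> (alg_unit H) = 1\<^sub>m n"

text \<open>
  The structure morphisms of the ribbon category of H-modules for the module V given by \<rho> and
  its dual V*, where upward strands carry V and downward strands V*. They are written as
  matrices for the basis e_i of V and the dual basis of V*; rt_piece H \<rho> P ys xs is the
  coefficient of the basis tensor with indices ys in the image of the one with indices xs:

  PosX is the braiding V \<otimes> V \<rightarrow> V \<otimes> V, mapping x \<otimes> y to the sum of the \<beta>_i y \<otimes> \<alpha>_i x;
  NegX is its inverse, the flip followed by the action of the inverse R-matrix;
  MaxCCW is the evaluation V* \<otimes> V \<rightarrow> \<complex>, mapping f \<otimes> x to f(x);
  MinCW is the coevaluation \<complex> \<rightarrow> V \<otimes> V*;
  MaxCW is the map V \<otimes> V* \<rightarrow> \<complex>, x \<otimes> f to f(\<kappa> x), and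
  MinCCW is the map \<complex> \<rightarrow> V* \<otimes> V, 1 to the sum of the e^i \<otimes> \<kappa>^(-1) e_i,
  that the balancing element \<kappa> provides for the right duality.
\<close>

fun rt_piece ::
    "('b::finite) ribbon_data \<Rightarrow> (complex^'b \<Rightarrow> complex mat) \<Rightarrow> piece \<Rightarrow>
     nat list \<Rightarrow> nat list \<Rightarrow> complex" where
  "rt_piece H \<rho> PosX [k, l] [i, j] =
     (\<Sum>(a, b)\<in>UNIV. rmatrix H $ (a, b) * (\<rho> (basis b) $$ (k, j) * \<rho> (basis a) $$ (l, i)))"
| "rt_piece H \<rho> NegX [k, l] [i, j] =
     (\<Sum>(a, b)\<in>UNIV. rmatrix_inv H $ (a, b) * (\<rho> (basis a) $$ (k, j) * \<rho> (basis b) $$ (l, i)))"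
| "rt_piece H \<rho> MaxCCW [] [i, j] = (if i = j then 1 else 0)"
| "rt_piece H \<rho> MaxCW [] [i, j] = \<rho> (balancing H) $$ (j, i)"
| "rt_piece H \<rho> MinCW [i, j] [] = (if i = j then 1 else 0)"
| "rt_piece H \<rho> MinCCW [i, j] [] = \<rho> (balancing_inv H) $$ (j, i)"
| "rt_piece H \<rho> _ _ _ = 0"

text \<open>The tensor product of the map of the piece with the identities of the other strands.\<close>

fun rt_layer ::
    "('b::finite) ribbon_data \<Rightarrow> (complex^'b \<Rightarrow> complex mat) \<Rightarrow> layer \<Rightarrow>
     nat list \<Rightarrow> nat list \<Rightarrow> complex" where
  "rt_layer H \<rho> (l, P, r) ys xs =
     (if take (length l) ys = take (length l) xs \<and>
         drop (length l + length (target P)) ys = drop (length l + length (source P)) xs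
      then rt_piece H \<rho> P (take (length (target P)) (drop (length l) ys))
                          (take (length (source P)) (drop (length l) xs))
      else 0)"

text \<open>The composition of the layers of a diagram.\<close>

fun rt_diagram ::
    "('b::finite) ribbon_data \<Rightarrow> nat \<Rightarrow> (complex^'b \<Rightarrow> complex mat) \<Rightarrow> diagram \<Rightarrow>
     nat list \<Rightarrow> nat list \<Rightarrow> complex" where
  "rt_diagram H n \<rho> [] ys xs = (if ys = xs then 1 else 0)"
| "rt_diagram H n \<rho> (L # D) ys xs =
     (\<Sum>zs | length zs = length (upper L) \<and> set zs \<subseteq> {..<n}.
        rt_diagram H n \<rho> D ys zs * rt_layer H \<rho> L zs xs)"

definition rt_invariant ::
    "('b::finite) ribbon_data \<Rightarrow> nat \<Rightarrow> (complex^'b \<Rightarrow> complex mat) \<Rightarrow> diagram \<Rightarrow> complex mat" where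
  "rt_invariant H n \<rho> D = Matrix.mat n n (\<lambda>(i, j). rt_diagram H n \<rho> D [i] [j])"

end

theory Submission
  imports Defs
begin

text \<open>
  The radical J of the Sweedler algebra is spanned by w and sw and has square zero. The algebra has
  two characters, the counit and one more, whose convolution square is the counit. By the hexagon
  identities, contracting the R-matrix or its inverse with these characters yields 1 and an
  involution g, so both equal (1 \<otimes> 1 + g \<otimes> 1 + 1 \<otimes> g - g \<otimes> g) / 2 up to J \<otimes> J. As the center is
  trivial, v = 1, whence the R-matrix is triangular and \<kappa> = u = g. On a single strand the part in
  J \<otimes> J of a crossing contributes nothing, since J B J = 0 for all B, so the invariant is a power
  of g. Its exponent is even: order the points of a horizontal line by the time at which the knot
  passes them; the parity of the number of inversions changes exactly at crossings,
  counterclockwise maxima and clockwise minima. So the invariant is 1 for every framing. The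
  Reshetikhin--Turaev invariant is a state sum over colourings of the points; reordered along the
  knot, it becomes the matrix of the same word in the beads.
\<close>

section \<open>Calculus of tensors\<close>

text \<open>Only the algebra is prescribed: comultiplication, antipode, R-matrix and v are
  arbitrary, and the comultiplication does not even determine R, since Sweedler's Hopf algebra
  carries a one-parameter family of R-matrices. So nothing is classified. The characters are known
  from the relations alone and see exactly the quotient by J; the part of R in J \<otimes> J, where
  the family varies, is never computed. The tensor (1 \<otimes> 1 + g \<otimes> 1 + 1 \<otimes> g -
  g \<otimes> g) / 2 is the R-matrix familiar from the group algebra of order two: with q = (1 - g)
  / 2 it is 1 \<otimes> 1 - 2 q \<otimes> q. Multiplying its two legs gives (1 + g + g - g g) / 2 =
  g, which is why a crossing counts as one g wherever its beads sit on the strand. The evenness of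
  the exponent is a mod 2 form of Whitney's relation between the self-crossings and the rotation
  number of a plane curve; counting inversions proves it one layer at a time.\<close>

lemma clinear_map_iff:
  "clinear_map f \<longleftrightarrow> (\<forall>x y. f (x + y) = f x + f y) \<and> (\<forall>c x. f (c *s x) = c *s f x)"
  unfolding clinear_map_def
  by (auto simp: Vector_Spaces.linear_iff vec.vector_space_axioms)

lemma clinear_form_iff:
  "clinear_form f \<longleftrightarrow> (\<forall>x y. f (x + y) = f x + f y) \<and> (\<forall>c x. f (c *s x) = c * f x)"
  unfolding clinear_form_def
  by (auto simp: Vector_Spaces.linear_iff vec.vector_space_axioms
      vector_space_over_itself.vector_space_axioms)

lemma clinear_map_add: "clinear_map f \<Longrightarrow> f (x + y) = f x + f y"
  and clinear_map_scale: "clinear_map f \<Longrightarrow> f (c *s x) = c *s f x"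
  by (auto simp: clinear_map_iff)

lemma clinear_form_add: "clinear_form f \<Longrightarrow> f (x + y) = f x + f y"
  and clinear_form_scale: "clinear_form f \<Longrightarrow> f (c *s x) = c * f x"
  by (auto simp: clinear_form_iff)

lemma clinear_map_zero: "clinear_map f \<Longrightarrow> f 0 = 0"
  using clinear_map_scale[of f 0 0] by simp

lemma clinear_form_zero: "clinear_form f \<Longrightarrow> f 0 = 0"
  using clinear_form_scale[of f 0 0] by simp

lemma clinear_map_diff: "clinear_map f \<Longrightarrow> f (x - y) = f x - f y"
  by (metis add_diff_cancel clinear_map_add diff_add_cancel)

lemma clinear_map_sum: "clinear_map f \<Longrightarrow> f (sum g A) = (\<Sum>x\<in>A. f (g x))"
  by (induction A rule: infinite_finite_induct) (auto simp: clinear_map_zero clinear_map_add)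

lemma clinear_form_sum: "clinear_form f \<Longrightarrow> f (sum g A) = (\<Sum>x\<in>A. f (g x))"
  by (induction A rule: infinite_finite_induct) (auto simp: clinear_form_zero clinear_form_add)

lemma clinear_map_ident: "clinear_map (\<lambda>x. x)"
  by (simp add: clinear_map_iff)

lemma clinear_map_compose: "clinear_map f \<Longrightarrow> clinear_map g \<Longrightarrow> clinear_map (\<lambda>x. f (g x))"
  by (simp add: clinear_map_iff)

lemma clinear_form_compose: "clinear_form f \<Longrightarrow> clinear_map g \<Longrightarrow> clinear_form (\<lambda>x. f (g x))"
  by (simp add: clinear_map_iff clinear_form_iff)

lemma clinear_map_scaled: "clinear_map f \<Longrightarrow> clinear_map (\<lambda>x. c *s f x)"
  by (simp add: clinear_map_iff vec.scale_right_distrib mult.commute)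

lemma clinear_map_form_scale: "clinear_form f \<Longrightarrow> clinear_map (\<lambda>x. f x *s y)"
  by (simp add: clinear_map_iff clinear_form_iff vec.scale_left_distrib)

lemma clinear_map_eqI:
  assumes "clinear_map f" "clinear_map g" "\<And>i. f (basis i) = g (basis i)"
  shows "f x = g x"
proof -
  have "f (\<Sum>i\<in>UNIV. x $ i *s basis i) = g (\<Sum>i\<in>UNIV. x $ i *s basis i)"
    by (simp only: clinear_map_sum[OF assms(1)] clinear_map_sum[OF assms(2)]
        clinear_map_scale[OF assms(1)] clinear_map_scale[OF assms(2)] assms(3))
  then show ?thesis by (simp add: basis_expansion)
qed

definition bilin :: "(complex^'b::finite \<Rightarrow> complex^'c::finite \<Rightarrow> complex^'d::finite) \<Rightarrow> bool" where
  "bilin f \<longleftrightarrow> (\<forall>x. clinear_map (f x)) \<and> (\<forall>y. clinear_map (\<lambda>x. f x y))"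

lemma bilinI:
  "(\<And>x. clinear_map (f x)) \<Longrightarrow> (\<And>y. clinear_map (\<lambda>x. f x y)) \<Longrightarrow> bilin f"
  by (simp add: bilin_def)

lemma bilin_right: "bilin f \<Longrightarrow> clinear_map (f x)"
  and bilin_left: "bilin f \<Longrightarrow> clinear_map (\<lambda>x. f x y)"
  by (simp_all add: bilin_def)

lemma bilin_tensor: "bilin (\<otimes>\<^sub>c)"
  by (simp add: bilin_def clinear_map_iff tensor_def Finite_Cartesian_Product.vec_eq_iff distrib_left distrib_right mult_ac)

lemma clinear_map_tensor_right: "clinear_map g \<Longrightarrow> clinear_map (\<lambda>z. x \<otimes>\<^sub>c g z)"
  by (rule clinear_map_compose[OF bilin_right[OF bilin_tensor]])

lemma clinear_map_tensor_left: "clinear_map g \<Longrightarrow> clinear_map (\<lambda>z. g z \<otimes>\<^sub>c x)"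
  by (rule clinear_map_compose[OF bilin_left[OF bilin_tensor]])

lemma basis_pair: "basis (i, j) = basis i \<otimes>\<^sub>c basis j"
  by (auto simp: tensor_def Finite_Cartesian_Product.vec_eq_iff axis_def)

text \<open>\<open>tlift\<close> evaluates \<open>f\<close> on basis vectors and extends linearly,
  whatever \<open>f\<close> is; bilinearity enters in \<open>tlift_tensor\<close>, where arbitrary
  pure tensors are evaluated.\<close>

lemma clinear_tlift: "clinear_map (tlift f)"
  by (simp add: clinear_map_iff tlift_def sum.distrib vec.scale_sum_right vec.scale_left_distrib)

lemma clinear_map_tliftI: "clinear_map g \<Longrightarrow> clinear_map (\<lambda>x. tlift f (g x))"
  by (rule clinear_map_compose[OF clinear_tlift])

lemmas clinear_intros = clinear_map_ident clinear_map_tensor_right clinear_map_tensor_left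
  clinear_map_tliftI clinear_map_scaled clinear_map_form_scale

lemma tlift_basis: "tlift f (basis p) = f (basis (fst p)) (basis (snd p))"
proof -
  have "tlift f (basis p) = (\<Sum>q\<in>UNIV. if q = p then f (basis (fst q)) (basis (snd q)) else 0)"
    unfolding tlift_def by (intro sum.cong) (auto simp: axis_def)
  then show ?thesis by simp
qed

lemma tlift_tensor:
  assumes "bilin f"
  shows "tlift f (x \<otimes>\<^sub>c y) = f x y"
proof -
  have lin1: "clinear_map (\<lambda>x. tlift f (x \<otimes>\<^sub>c y))" for y
    by (intro clinear_intros)
  have lin2: "clinear_map (\<lambda>y. tlift f (x \<otimes>\<^sub>c y))" for x
    by (intro clinear_intros)
  have "tlift f (basis i \<otimes>\<^sub>c y) = f (basis i) y" for i y
    by (rule clinear_map_eqI[OF lin2 bilin_right[OF assms]])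
      (simp add: tlift_basis flip: basis_pair)
  then show ?thesis
    by (intro clinear_map_eqI[OF lin1 bilin_left[OF assms], where x = x])
qed

text \<open>Basis vectors of a tensor product are pure tensors. This is the route from computations
  on pure tensors to identities for all tensors.\<close>

lemma tensor_eqI:
  assumes "clinear_map f" "clinear_map g" "\<And>x y. f (x \<otimes>\<^sub>c y) = g (x \<otimes>\<^sub>c y)"
  shows "f t = g t"
  by (rule clinear_map_eqI[OF assms(1,2)]) (metis assms(3) basis_pair surj_pair)

lemma form_eqI:
  assumes "clinear_form f" "clinear_form g" "\<And>x y. f (x \<otimes>\<^sub>c y) = g (x \<otimes>\<^sub>c y)"
  shows "f t = g t"
proof -
  \<comment> \<open>Scalars become vectors of the one-dimensional space \<open>complex^unit\<close>,
    so that the criterion for linear maps also covers forms.\<close>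
  have "f t *s (1 :: complex^unit) = g t *s 1"
    by (rule tensor_eqI[where f = "\<lambda>t. f t *s (1 :: complex^unit)"])
      (simp_all add: clinear_map_form_scale assms)
  then show ?thesis by (simp add: Finite_Cartesian_Product.vec_eq_iff)
qed

lemma tlift_compose: "clinear_map h \<Longrightarrow> h (tlift f t) = tlift (\<lambda>x y. h (f x y)) t"
  by (simp only: tlift_def clinear_map_sum[of h] clinear_map_scale[of h])

lemma tlift_add: "tlift (\<lambda>x y. f x y + g x y) t = tlift f t + tlift g t"
  by (simp add: tlift_def vec.scale_right_distrib sum.distrib)

lemma tlift_diff: "tlift (\<lambda>x y. f x y - g x y) t = tlift f t - tlift g t"
  by (simp add: tlift_def vec.scale_right_diff_distrib sum_subtractf)

lemma bilin_tlift:
  assumes "\<And>z. bilin (\<lambda>x y. f x y z)" "\<And>x y. clinear_map (f x y)"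
  shows "bilin (\<lambda>t z. tlift (\<lambda>x y. f x y z) t)"
proof (rule bilinI)
  show "clinear_map (\<lambda>t. tlift (\<lambda>x y. f x y z) t)" for z by (rule clinear_tlift)
  show "clinear_map (\<lambda>z. tlift (\<lambda>x y. f x y z) t)" for t
    using assms(2) by (simp add: clinear_map_iff tlift_def sum.distrib vec.scale_sum_right
        vec.scale_right_distrib mult.commute)
qed

lemma tflip_tensor: "tflip (x \<otimes>\<^sub>c y) = y \<otimes>\<^sub>c x"
  unfolding tflip_def
  by (rule tlift_tensor) (intro bilinI clinear_intros)

lemma clinear_tflip: "clinear_map tflip"
  unfolding tflip_def by (rule clinear_tlift)

lemma tassoc_tensor: "tassoc ((x \<otimes>\<^sub>c y) \<otimes>\<^sub>c z) = x \<otimes>\<^sub>c y \<otimes>\<^sub>c z"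
proof -
  have lin: "bilin (\<lambda>x y. x \<otimes>\<^sub>c y \<otimes>\<^sub>c z)" for z :: "complex^'z::finite"
    by (intro bilinI clinear_intros)
  have "bilin (\<lambda>(t::complex^('x::finite \<times> 'y::finite)) (z::complex^'z::finite).
          tlift (\<lambda>x y. x \<otimes>\<^sub>c y \<otimes>\<^sub>c z) t)"
    by (intro bilin_tlift lin clinear_intros)
  from trans[OF tlift_tensor[OF this] tlift_tensor[OF lin]] show ?thesis
    unfolding tassoc_def .
qed

lemma clinear_tassoc: "clinear_map tassoc"
  unfolding tassoc_def by (rule clinear_tlift)

lemma
  assumes "bilin m1" "bilin m2"
  shows bilin_tmul: "bilin (tmul m1 m2)"
    and tmul_tensor: "tmul m1 m2 (x \<otimes>\<^sub>c y) (x' \<otimes>\<^sub>c y') = m1 x x' \<otimes>\<^sub>c m2 y y'"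
proof -
  have 1: "bilin (\<lambda>x' y'. m1 x x' \<otimes>\<^sub>c m2 y y')" for x y
    by (intro bilinI clinear_intros bilin_right[OF assms(1)] bilin_right[OF assms(2)])
  have 2: "bilin (\<lambda>x y. m1 x x' \<otimes>\<^sub>c m2 y y')" for x' y'
    by (intro bilinI clinear_intros bilin_left[OF assms(1)] bilin_left[OF assms(2)])
  have 3: "bilin (\<lambda>x y. tlift (\<lambda>x' y'. m1 x x' \<otimes>\<^sub>c m2 y y') t)" for t
    using 2 unfolding bilin_def clinear_map_iff
    by (auto simp: tlift_def sum.distrib vec.scale_right_distrib vec.scale_sum_right mult.commute)
  show "bilin (tmul m1 m2)"
    unfolding tmul_def by (intro bilin_tlift 3 clinear_tlift)
  show "tmul m1 m2 (x \<otimes>\<^sub>c y) (x' \<otimes>\<^sub>c y') = m1 x x' \<otimes>\<^sub>c m2 y y'"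
    unfolding tmul_def by (simp add: tlift_tensor[OF 1] tlift_tensor[OF 2])
qed

subsection \<open>Contraction with linear forms\<close>

definition lslice :: "(complex^'b::finite \<Rightarrow> complex) \<Rightarrow> complex^('b \<times> 'c::finite) \<Rightarrow> complex^'c" where
  "lslice \<phi> = tlift (\<lambda>x y. \<phi> x *s y)"

definition rslice :: "(complex^'c::finite \<Rightarrow> complex) \<Rightarrow> complex^('b::finite \<times> 'c) \<Rightarrow> complex^'b" where
  "rslice \<phi> = tlift (\<lambda>x y. \<phi> y *s x)"

lemma clinear_lslice: "clinear_map g \<Longrightarrow> clinear_map (\<lambda>x. lslice \<phi> (g x))"
  by (simp add: lslice_def clinear_map_tliftI)

lemma clinear_rslice: "clinear_map g \<Longrightarrow> clinear_map (\<lambda>x. rslice \<phi> (g x))"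
  by (simp add: rslice_def clinear_map_tliftI)

lemmas clinear_slice_intros = clinear_intros clinear_lslice clinear_rslice
  clinear_map_compose[OF clinear_tflip]

lemma lslice_tensor: "clinear_form \<phi> \<Longrightarrow> lslice \<phi> (x \<otimes>\<^sub>c y) = \<phi> x *s y"
  unfolding lslice_def by (intro tlift_tensor bilinI clinear_intros)

lemma rslice_tensor: "clinear_form \<phi> \<Longrightarrow> rslice \<phi> (x \<otimes>\<^sub>c y) = \<phi> y *s x"
  unfolding rslice_def by (intro tlift_tensor bilinI clinear_intros)

text \<open>Both sides are (\<phi> \<otimes> \<psi>)(t), contracted in the two possible
  orders.\<close>

lemma form_slices:
  assumes "clinear_form \<phi>" "clinear_form \<psi>"
  shows "\<phi> (rslice \<psi> t) = \<psi> (lslice \<phi> t)"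
proof (rule form_eqI)
  show "clinear_form (\<lambda>t. \<phi> (rslice \<psi> t))"
    by (intro clinear_form_compose[OF assms(1)] clinear_slice_intros)
  show "clinear_form (\<lambda>t. \<psi> (lslice \<phi> t))"
    by (intro clinear_form_compose[OF assms(2)] clinear_slice_intros)
qed (simp add: rslice_tensor lslice_tensor assms clinear_form_scale[OF assms(1)]
       clinear_form_scale[OF assms(2)])

lemma rslice_tflip: "clinear_form \<phi> \<Longrightarrow> rslice \<phi> (tflip t) = lslice \<phi> t"
  by (rule tensor_eqI[where t = t], (intro clinear_slice_intros)+)
    (simp add: tflip_tensor rslice_tensor lslice_tensor)

text \<open>For multiplicative \<phi> the map id \<otimes> \<phi> is a homomorphism of algebras.
  This turns identities between tensors, such as the hexagon identities, into identities in the
  algebra.\<close>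

lemma rslice_tmul:
  assumes m: "bilin m1" "bilin m2" and \<phi>: "clinear_form \<phi>" "\<And>x y. \<phi> (m2 x y) = \<phi> x * \<phi> y"
  shows "rslice \<phi> (tmul m1 m2 s t) = m1 (rslice \<phi> s) (rslice \<phi> t)"
proof -
  note T = bilin_tmul[OF m]
  have 1: "rslice \<phi> (tmul m1 m2 (x \<otimes>\<^sub>c y) t) = m1 (rslice \<phi> (x \<otimes>\<^sub>c y)) (rslice \<phi> t)" for x y t
  proof (rule tensor_eqI[where t = t])
    show "clinear_map (\<lambda>t. rslice \<phi> (tmul m1 m2 (x \<otimes>\<^sub>c y) t))"
      by (intro clinear_rslice bilin_right[OF T])
    show "clinear_map (\<lambda>t. m1 (rslice \<phi> (x \<otimes>\<^sub>c y)) (rslice \<phi> t))"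
      by (intro clinear_map_compose[OF bilin_right[OF m(1)]] clinear_slice_intros)
    show "rslice \<phi> (tmul m1 m2 (x \<otimes>\<^sub>c y) (x' \<otimes>\<^sub>c y')) =
        m1 (rslice \<phi> (x \<otimes>\<^sub>c y)) (rslice \<phi> (x' \<otimes>\<^sub>c y'))" for x' y'
      by (simp add: tmul_tensor[OF m] \<phi> rslice_tensor clinear_map_scale[OF bilin_right[OF m(1)]]
          clinear_map_scale[OF bilin_left[OF m(1)]] mult.commute)
  qed
  show ?thesis
    by (rule tensor_eqI[where t = s])
      (intro clinear_rslice bilin_left[OF T] clinear_map_ident
        clinear_map_compose[OF bilin_left[OF m(1)]] 1)+
qed

lemma lslice_tmul:
  assumes m: "bilin m1" "bilin m2" and \<phi>: "clinear_form \<phi>" "\<And>x y. \<phi> (m1 x y) = \<phi> x * \<phi> y"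
  shows "lslice \<phi> (tmul m1 m2 s t) = m2 (lslice \<phi> s) (lslice \<phi> t)"
proof -
  note T = bilin_tmul[OF m]
  have 1: "lslice \<phi> (tmul m1 m2 (x \<otimes>\<^sub>c y) t) = m2 (lslice \<phi> (x \<otimes>\<^sub>c y)) (lslice \<phi> t)" for x y t
  proof (rule tensor_eqI[where t = t])
    show "clinear_map (\<lambda>t. lslice \<phi> (tmul m1 m2 (x \<otimes>\<^sub>c y) t))"
      by (intro clinear_lslice bilin_right[OF T])
    show "clinear_map (\<lambda>t. m2 (lslice \<phi> (x \<otimes>\<^sub>c y)) (lslice \<phi> t))"
      by (intro clinear_map_compose[OF bilin_right[OF m(2)]] clinear_slice_intros)
    show "lslice \<phi> (tmul m1 m2 (x \<otimes>\<^sub>c y) (x' \<otimes>\<^sub>c y')) =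
        m2 (lslice \<phi> (x \<otimes>\<^sub>c y)) (lslice \<phi> (x' \<otimes>\<^sub>c y'))" for x' y'
      by (simp add: tmul_tensor[OF m] \<phi> lslice_tensor clinear_map_scale[OF bilin_right[OF m(2)]]
          clinear_map_scale[OF bilin_left[OF m(2)]] mult.commute)
  qed
  show ?thesis
    by (rule tensor_eqI[where t = s])
      (intro clinear_lslice bilin_left[OF T] clinear_map_ident
        clinear_map_compose[OF bilin_left[OF m(2)]] 1)+
qed

section \<open>Characters of a quasitriangular Hopf algebra\<close>

lemma tmul_assoc:
  assumes "bilin m1" "bilin m2"
    and "\<And>x y z. m1 (m1 x y) z = m1 x (m1 y z)" "\<And>x y z. m2 (m2 x y) z = m2 x (m2 y z)"
  shows "tmul m1 m2 (tmul m1 m2 r s) t = tmul m1 m2 r (tmul m1 m2 s t)"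
proof -
  note T = bilin_tmul[OF assms(1,2)]
  note R = clinear_map_compose[OF bilin_right[OF T]] and L = clinear_map_compose[OF bilin_left[OF T]]
  have 1: "tmul m1 m2 (tmul m1 m2 (a \<otimes>\<^sub>c b) (c \<otimes>\<^sub>c d)) t =
      tmul m1 m2 (a \<otimes>\<^sub>c b) (tmul m1 m2 (c \<otimes>\<^sub>c d) t)" for a b c d t
    by (rule tensor_eqI[where t = t]) (intro R clinear_map_ident | simp add: tmul_tensor assms)+
  have 2: "tmul m1 m2 (tmul m1 m2 (a \<otimes>\<^sub>c b) s) t = tmul m1 m2 (a \<otimes>\<^sub>c b) (tmul m1 m2 s t)" for a b s t
    by (rule tensor_eqI[where t = s]) (intro L R clinear_map_ident 1)+
  show ?thesis
    by (rule tensor_eqI[where t = r]) (intro L clinear_map_ident 2)+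
qed

lemma tmul_unit:
  assumes "bilin m1" "bilin m2" "\<And>x. m1 e1 x = x" "\<And>x. m1 x e1 = x" "\<And>x. m2 e2 x = x" "\<And>x. m2 x e2 = x"
  shows "tmul m1 m2 (e1 \<otimes>\<^sub>c e2) t = t" and "tmul m1 m2 t (e1 \<otimes>\<^sub>c e2) = t"
proof -
  note T = bilin_tmul[OF assms(1,2)]
  show "tmul m1 m2 (e1 \<otimes>\<^sub>c e2) t = t"
    by (rule tensor_eqI[where t = t])
      (intro bilin_right[OF T] clinear_map_ident | simp add: tmul_tensor assms)+
  show "tmul m1 m2 t (e1 \<otimes>\<^sub>c e2) = t"
    by (rule tensor_eqI[where t = t])
      (intro bilin_left[OF T] clinear_map_ident | simp add: tmul_tensor assms)+
qed

lemma alg_inverse_eqI: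
  assumes "\<And>x y z. m (m x y) z = m x (m y z)" "\<And>x. m e x = x" "\<And>x. m x e = x"
    and "m x y = e" "m y x = e"
  shows "alg_inverse m e x = y"
  unfolding alg_inverse_def by (rule the_equality) (use assms in metis)+

text \<open>Triple tensors nest to the right: contracting the first leg is just
  \<open>lslice\<close>, whereas the last leg needs this map id \<otimes> id \<otimes>
  \<phi>.\<close>

definition rslice3 :: "(complex^'d::finite \<Rightarrow> complex) \<Rightarrow> complex^('b::finite \<times> 'c::finite \<times> 'd) \<Rightarrow>
    complex^('b \<times> 'c)" where
  "rslice3 \<phi> = tlift (\<lambda>x q. x \<otimes>\<^sub>c rslice \<phi> q)"

lemma clinear_rslice3: "clinear_map g \<Longrightarrow> clinear_map (\<lambda>x. rslice3 \<phi> (g x))"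
  by (simp add: rslice3_def clinear_map_tliftI)

lemma rslice3_tensor: "rslice3 \<phi> (x \<otimes>\<^sub>c q) = x \<otimes>\<^sub>c rslice \<phi> q"
  unfolding rslice3_def by (intro tlift_tensor bilinI clinear_slice_intros)

lemma tensor_scale_right: "x \<otimes>\<^sub>c (c *s y) = c *s (x \<otimes>\<^sub>c y)"
  by (rule clinear_map_scale[OF bilin_right[OF bilin_tensor]])

lemma tensor_scale_left: "(c *s x) \<otimes>\<^sub>c y = c *s (x \<otimes>\<^sub>c y)"
  by (rule clinear_map_scale[OF bilin_left[OF bilin_tensor]])

lemma clinear_map_tassoc: "clinear_map g \<Longrightarrow> clinear_map (\<lambda>x. tassoc (g x))"
  by (rule clinear_map_compose[OF clinear_tassoc])

lemma rslice3_tassoc: "clinear_form \<phi> \<Longrightarrow> rslice3 \<phi> (tassoc (t \<otimes>\<^sub>c z)) = \<phi> z *s t"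
  by (rule tensor_eqI[where t = t])
    (intro clinear_rslice3 clinear_map_tassoc clinear_slice_intros
     | simp add: tassoc_tensor rslice3_tensor rslice_tensor tensor_scale_right)+

lemma lslice_tassoc: "clinear_form \<phi> \<Longrightarrow> lslice \<phi> (tassoc (t \<otimes>\<^sub>c z)) = lslice \<phi> t \<otimes>\<^sub>c z"
  by (rule tensor_eqI[where t = t])
    (intro clinear_map_tassoc clinear_slice_intros
     | simp add: tassoc_tensor lslice_tensor tensor_scale_left)+

lemma rslice3_tmul:
  assumes m: "bilin m1" "bilin m2" "bilin m3"
    and \<phi>: "clinear_form \<phi>" "\<And>x y. \<phi> (m3 x y) = \<phi> x * \<phi> y"
  shows "rslice3 \<phi> (tmul m1 (tmul m2 m3) s t) = tmul m1 m2 (rslice3 \<phi> s) (rslice3 \<phi> t)"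
proof -
  note T = bilin_tmul[OF m(1) bilin_tmul[OF m(2,3)]] and U = bilin_tmul[OF m(1,2)]
  note R = clinear_map_compose[OF bilin_right[OF U]] and L = clinear_map_compose[OF bilin_left[OF U]]
  have 1: "rslice3 \<phi> (tmul m1 (tmul m2 m3) (x \<otimes>\<^sub>c q) t) =
      tmul m1 m2 (rslice3 \<phi> (x \<otimes>\<^sub>c q)) (rslice3 \<phi> t)" for x q t
    by (rule tensor_eqI[where t = t])
      (intro clinear_rslice3 bilin_right[OF T] R clinear_map_ident
       | simp add: tmul_tensor[OF m(1) bilin_tmul[OF m(2,3)]] tmul_tensor[OF m(1,2)] rslice3_tensor
           rslice_tmul[OF m(2,3) \<phi>])+
  show ?thesis
    by (rule tensor_eqI[where t = s])
      (intro clinear_rslice3 bilin_left[OF T] L clinear_map_ident 1)+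
qed

section \<open>Characters under convolution\<close>

definition character :: "('b::finite) ribbon_data \<Rightarrow> (complex^'b \<Rightarrow> complex) \<Rightarrow> bool" where
  "character H \<phi> \<longleftrightarrow> clinear_form \<phi> \<and> (\<forall>x y. \<phi> (alg_mul H x y) = \<phi> x * \<phi> y) \<and> \<phi> (alg_unit H) = 1"

text \<open>The convolution product (\<phi> \<otimes> \<psi>) \<circ> \<Delta>, contracted one leg
  at a time so that the slice lemmas apply.\<close>

definition conv :: "('b::finite) ribbon_data \<Rightarrow> (complex^'b \<Rightarrow> complex) \<Rightarrow> (complex^'b \<Rightarrow> complex) \<Rightarrow>
    complex^'b \<Rightarrow> complex" where
  "conv H \<phi> \<psi> h = \<phi> (rslice \<psi> (comul H h))"

lemma bilin_alg_mul: "unital_algebra H \<Longrightarrow> bilin (alg_mul H)"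
  by (auto simp: unital_algebra_def bilin_def)

lemma clinear_conv: "coalgebra H \<Longrightarrow> clinear_form \<phi> \<Longrightarrow> clinear_form (conv H \<phi> \<psi>)"
  unfolding conv_def
  by (rule clinear_form_compose, assumption) (intro clinear_rslice, simp add: coalgebra_def)

lemma conv_assoc:
  assumes H: "coalgebra H" and "clinear_form \<phi>" "clinear_form \<psi>" "clinear_form \<omega>"
  shows "conv H (conv H \<phi> \<psi>) \<omega> = conv H \<phi> (conv H \<psi> \<omega>)"
proof
  fix h
  have D: "clinear_map (comul H)" using H by (simp add: coalgebra_def)
  have "tlift (\<lambda>x y. tassoc (comul H x \<otimes>\<^sub>c y)) (comul H h) =
      tlift (\<lambda>x y. x \<otimes>\<^sub>c comul H y) (comul H h)"
    using H by (simp add: coalgebra_def)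
  then have eq: "rslice3 \<omega> (tlift (\<lambda>x y. tassoc (comul H x \<otimes>\<^sub>c y)) (comul H h)) =
      rslice3 \<omega> (tlift (\<lambda>x y. x \<otimes>\<^sub>c comul H y) (comul H h))" by simp
  have L: "rslice3 \<omega> (tlift (\<lambda>x y. tassoc (comul H x \<otimes>\<^sub>c y)) (comul H h)) =
      comul H (rslice \<omega> (comul H h))"
    by (simp add: tlift_compose[OF clinear_rslice3[OF clinear_map_ident]] rslice3_tassoc assms
        rslice_def tlift_compose[OF D] clinear_map_scale[OF D])
  have R: "rslice \<psi> (rslice3 \<omega> (tlift (\<lambda>x y. x \<otimes>\<^sub>c comul H y) (comul H h))) =
      rslice (conv H \<psi> \<omega>) (comul H h)"
    by (simp add: tlift_compose[OF clinear_rslice3[OF clinear_map_ident]] rslice3_tensor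
        tlift_compose[OF clinear_rslice[OF clinear_map_ident]] rslice_tensor assms
        rslice_def[of "conv H \<psi> \<omega>"] conv_def)
  show "conv H (conv H \<phi> \<psi>) \<omega> h = conv H \<phi> (conv H \<psi> \<omega>) h"
    using eq R unfolding L by (simp add: conv_def)
qed

lemma conv_counit:
  assumes "coalgebra H" "clinear_form \<phi>"
  shows "conv H (counit H) \<phi> = \<phi>" and "conv H \<phi> (counit H) = \<phi>"
  using assms form_slices[of "counit H" \<phi>]
  by (auto simp: coalgebra_def conv_def rslice_def lslice_def)

lemma character_counit: "bialgebra H \<Longrightarrow> character H (counit H)"
  by (auto simp: character_def bialgebra_def coalgebra_def)

lemma character_conv:
  assumes "bialgebra H" "character H \<phi>" "character H \<psi>"
  shows "character H (conv H \<phi> \<psi>)"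
proof -
  have "bilin (alg_mul H)" using assms by (auto simp: bialgebra_def intro: bilin_alg_mul)
  then show ?thesis
    using assms clinear_conv[of H \<phi> \<psi>] clinear_form_scale[of \<phi>]
    by (auto simp: character_def conv_def bialgebra_def mul2_def rslice_tmul rslice_tensor)
qed

text \<open>Apply \<phi> to the left antipode axiom: \<phi> \<circ> S is a left convolution inverse
  of \<phi>.\<close>

lemma conv_antipode:
  assumes H: "hopf_algebra H" and "character H \<phi>"
  shows "conv H (\<lambda>x. \<phi> (antipode H x)) \<phi> = counit H"
proof
  fix h
  have f: "clinear_form \<phi>" "\<And>x y. \<phi> (alg_mul H x y) = \<phi> x * \<phi> y" "\<phi> (alg_unit H) = 1"
    using assms(2) by (auto simp: character_def)
  have S: "clinear_map (antipode H)" and m: "bilin (alg_mul H)"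
    using H by (auto simp: hopf_algebra_def bialgebra_def intro: bilin_alg_mul)
  have b: "bilin (\<lambda>x y. alg_mul H (antipode H x) y)"
    by (intro bilinI clinear_map_compose[OF bilin_left[OF m] S] bilin_right[OF m])
  have "\<phi> (tlift (\<lambda>x y. alg_mul H (antipode H x) y) t) = \<phi> (antipode H (rslice \<phi> t))" for t
    by (rule form_eqI[where t = t])
      (intro clinear_form_compose[OF f(1)] clinear_tlift clinear_map_compose[OF S] clinear_slice_intros
       | simp add: tlift_tensor[OF b] rslice_tensor f clinear_map_scale[OF S]
          clinear_form_scale[OF f(1)] mult.commute)+
  from this[of "comul H h"] show "conv H (\<lambda>x. \<phi> (antipode H x)) \<phi> h = counit H h"
    using H f by (simp add: conv_def hopf_algebra_def clinear_form_scale[OF f(1)])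
qed

lemma clinear_form_antipode:
  "hopf_algebra H \<Longrightarrow> character H \<phi> \<Longrightarrow> clinear_form (\<lambda>x. \<phi> (antipode H x))"
  by (rule clinear_form_compose) (auto simp: character_def hopf_algebra_def)

text \<open>Cancel one factor \<phi> with its left inverse. For the Sweedler algebra this prevents
  the character other than the counit from being its own square.\<close>

lemma conv_idempotent_character:
  assumes "hopf_algebra H" "character H \<phi>" "conv H \<phi> \<phi> = \<phi>"
  shows "\<phi> = counit H"
  using conv_antipode[OF assms(1,2)] conv_assoc[of H "\<lambda>x. \<phi> (antipode H x)" \<phi> \<phi>]
    clinear_form_antipode[OF assms(1,2)] conv_counit(1)[of H \<phi>] assms
  by (simp add: character_def hopf_algebra_def bialgebra_def)

text \<open>A left inverse equals a right inverse, and here \<phi> is a right inverse of itself.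
  This will show that the antipode fixes both characters and hence preserves the radical.\<close>

lemma conv_involutive_character_antipode:
  assumes "hopf_algebra H" "character H \<phi>" "conv H \<phi> \<phi> = counit H"
  shows "\<phi> (antipode H x) = \<phi> x"
proof -
  have "(\<lambda>x. \<phi> (antipode H x)) = \<phi>"
    using conv_antipode[OF assms(1,2)] conv_assoc[of H "\<lambda>x. \<phi> (antipode H x)" \<phi> \<phi>]
      clinear_form_antipode[OF assms(1,2)] conv_counit[of H] assms
    by (simp add: character_def hopf_algebra_def bialgebra_def)
  then show ?thesis by metis
qed

text \<open>These are contracted hexagon identities. Contracting the last leg of R13 R23 gives the
  grouplike property; contracting the last two legs of R13 R12, or the first two of R13 R23, gives
  multiplicativity. In R13 R12 the factor with the third leg stands first, whence the reversed order
  of the right contractions.\<close>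

lemma
  fixes H :: "('b::finite) ribbon_data"
  assumes H: "quasitriangular H" and \<psi>: "character H \<psi>"
  shows comul_rslice_rmatrix:
      "comul H (rslice \<psi> (rmatrix H)) = rslice \<psi> (rmatrix H) \<otimes>\<^sub>c rslice \<psi> (rmatrix H)"
    and rslice_conv_rmatrix: "character H \<phi> \<Longrightarrow>
      rslice (conv H \<phi> \<psi>) (rmatrix H) = alg_mul H (rslice \<psi> (rmatrix H)) (rslice \<phi> (rmatrix H))"
    and lslice_conv_rmatrix: "character H \<phi> \<Longrightarrow>
      lslice (conv H \<psi> \<phi>) (rmatrix H) = alg_mul H (lslice \<psi> (rmatrix H)) (lslice \<phi> (rmatrix H))"
proof -
  let ?R = "rmatrix H" and ?e = "alg_unit H"
  have m: "bilin (alg_mul H)" and D: "clinear_map (comul H)"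
    and u: "\<And>x. alg_mul H ?e x = x" "\<And>x. alg_mul H x ?e = x"
    and h1: "tlift (\<lambda>a b. tassoc (comul H a \<otimes>\<^sub>c b)) ?R = mul3 H (R13 H) (R23 H)"
    and h2: "tlift (\<lambda>a b. a \<otimes>\<^sub>c comul H b) ?R = mul3 H (R13 H) (R12 H)"
    using H by (auto simp: quasitriangular_def hopf_algebra_def bialgebra_def coalgebra_def
        unital_algebra_def bilin_def)
  have f: "clinear_form \<psi>" "\<And>x y. \<psi> (alg_mul H x y) = \<psi> x * \<psi> y" "\<psi> ?e = 1"
    using \<psi> by (auto simp: character_def)
  note c3 = tlift_compose[OF clinear_rslice3[OF clinear_map_ident]]
    and cr = tlift_compose[OF clinear_rslice[OF clinear_map_ident]]
    and cl = tlift_compose[OF clinear_lslice[OF clinear_map_ident]]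
  have tl: "tlift (\<lambda>a b. a \<otimes>\<^sub>c b) t = t" for t :: "complex^('b \<times> 'b)"
    by (rule tensor_eqI[where t = t]) (intro clinear_tlift clinear_map_ident tlift_tensor bilin_tensor)+
  have left: "tlift (\<lambda>a b. \<psi> b *s (a \<otimes>\<^sub>c ?e)) t = rslice \<psi> t \<otimes>\<^sub>c ?e" for t
    unfolding rslice_def
    by (simp add: tlift_compose[OF bilin_left[OF bilin_tensor]] tensor_scale_left)
  have right: "tlift (\<lambda>a b. \<psi> b *s (?e \<otimes>\<^sub>c a)) t = ?e \<otimes>\<^sub>c rslice \<psi> t" for t
    unfolding rslice_def
    by (simp add: tlift_compose[OF bilin_right[OF bilin_tensor]] tensor_scale_right)
  have left': "tlift (\<lambda>a b. \<psi> a *s (?e \<otimes>\<^sub>c b)) t = ?e \<otimes>\<^sub>c lslice \<psi> t" for t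
    unfolding lslice_def
    by (simp add: tlift_compose[OF bilin_right[OF bilin_tensor]] tensor_scale_right)
  have "comul H (rslice \<psi> ?R) = rslice3 \<psi> (tlift (\<lambda>a b. tassoc (comul H a \<otimes>\<^sub>c b)) ?R)"
    by (simp add: c3 rslice3_tassoc f rslice_def tlift_compose[OF D] clinear_map_scale[OF D])
  also have "\<dots> = mul2 H (rslice \<psi> ?R \<otimes>\<^sub>c ?e) (?e \<otimes>\<^sub>c rslice \<psi> ?R)"
    unfolding h1 mul3_def mul2_def
    by (simp add: rslice3_tmul m f R13_def R23_def c3 rslice3_tensor rslice_tensor
        tensor_scale_right left right tl)
  also have "\<dots> = rslice \<psi> ?R \<otimes>\<^sub>c rslice \<psi> ?R"
    by (simp add: mul2_def tmul_tensor m u)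
  finally show "comul H (rslice \<psi> ?R) = rslice \<psi> ?R \<otimes>\<^sub>c rslice \<psi> ?R" .
  assume "character H \<phi>"
  then have g: "clinear_form \<phi>" "\<And>x y. \<phi> (alg_mul H x y) = \<phi> x * \<phi> y" "\<phi> ?e = 1"
    by (auto simp: character_def)
  have "rslice (conv H \<phi> \<psi>) ?R = rslice \<phi> (rslice3 \<psi> (tlift (\<lambda>a b. a \<otimes>\<^sub>c comul H b) ?R))"
    by (simp add: c3 cr rslice3_tensor rslice_tensor g rslice_def[of "conv H \<phi> \<psi>"] conv_def)
  also have "\<dots> = rslice \<phi> (mul2 H (rslice \<psi> ?R \<otimes>\<^sub>c ?e) ?R)"
    unfolding h2 mul3_def mul2_def
    by (simp add: rslice3_tmul m f R13_def R12_def c3 rslice3_tensor rslice_tensor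
        tensor_scale_right left right tl)
  also have "\<dots> = alg_mul H (rslice \<psi> ?R) (rslice \<phi> ?R)"
    by (simp add: mul2_def rslice_tmul m g rslice_tensor)
  finally show "rslice (conv H \<phi> \<psi>) ?R = alg_mul H (rslice \<psi> ?R) (rslice \<phi> ?R)" .
  have "lslice (conv H \<psi> \<phi>) ?R = lslice \<phi> (lslice \<psi> (tlift (\<lambda>a b. tassoc (comul H a \<otimes>\<^sub>c b)) ?R))"
    by (simp add: cl lslice_tassoc lslice_tensor f g lslice_def[of "conv H \<psi> \<phi>"] conv_def form_slices)
  also have "\<dots> = lslice \<phi> (mul2 H (?e \<otimes>\<^sub>c lslice \<psi> ?R) ?R)"
    unfolding h1 mul3_def mul2_def
    by (simp add: lslice_tmul m bilin_tmul f R13_def R23_def cl lslice_tensor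
        tensor_scale_right left' tl)
  also have "\<dots> = alg_mul H (lslice \<psi> ?R) (lslice \<phi> ?R)"
    by (simp add: mul2_def lslice_tmul m g lslice_tensor)
  finally show "lslice (conv H \<psi> \<phi>) ?R = alg_mul H (lslice \<psi> ?R) (lslice \<phi> ?R)" .
qed

section \<open>Ribbon structures on the Sweedler algebra\<close>

lemma sum_sw_index: "(\<Sum>p\<in>(UNIV::sw_index set). f p) =
    f (False, False) + f (False, True) + f (True, False) + (f (True, True) :: 'a::comm_monoid_add)"
proof -
  have U: "(UNIV::sw_index set) = {(False, False), (False, True), (True, False), (True, True)}"
    by auto
  show ?thesis unfolding U by (simp add: add.assoc)
qed

lemma sw_eq_iff: "x = (y :: complex^sw_index) \<longleftrightarrow>
    x $ (False, False) = y $ (False, False) \<and> x $ (False, True) = y $ (False, True) \<and>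
    x $ (True, False) = y $ (True, False) \<and> x $ (True, True) = y $ (True, True)"
proof -
  have "(\<forall>p::sw_index. x $ p = y $ p) \<longleftrightarrow> x $ (False, False) = y $ (False, False) \<and>
      x $ (False, True) = y $ (False, True) \<and> x $ (True, False) = y $ (True, False) \<and>
      x $ (True, True) = y $ (True, True)"
    by (metis (full_types) surj_pair)
  then show ?thesis by (simp only: Finite_Cartesian_Product.vec_eq_iff)
qed

lemma sw_mul_nth:
  "sw_mul x y $ (False, False) = x $ (False, False) * y $ (False, False) + x $ (True, False) * y $ (True, False)"
  "sw_mul x y $ (True, False) = x $ (False, False) * y $ (True, False) + x $ (True, False) * y $ (False, False)"
  "sw_mul x y $ (False, True) = x $ (False, False) * y $ (False, True) + x $ (False, True) * y $ (False, False)
     + x $ (True, False) * y $ (True, True) - x $ (True, True) * y $ (True, False)"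
  "sw_mul x y $ (True, True) = x $ (False, False) * y $ (True, True) + x $ (True, True) * y $ (False, False)
     + x $ (True, False) * y $ (False, True) - x $ (False, True) * y $ (True, False)"
  by (simp_all add: sw_mul_def sum_sw_index axis_def)

lemma sw_unit_nth: "sw_unit $ p = (if p = (False, False) then 1 else 0)"
  and sw_s_nth: "sw_s $ p = (if p = (True, False) then 1 else 0)"
  and sw_w_nth: "sw_w $ p = (if p = (False, True) then 1 else 0)"
  by (simp_all add: sw_unit_def sw_s_def sw_w_def axis_def)

text \<open>The functional that vanishes on J and takes the value \<sigma> at s. For \<sigma> = 1
  and \<sigma> = -1 it is multiplicative, and these are the only characters because s s = 1 and w w
  = 0.\<close>

definition sw_char :: "complex \<Rightarrow> complex^sw_index \<Rightarrow> complex" where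
  "sw_char \<sigma> x = x $ (False, False) + \<sigma> * x $ (True, False)"

definition sw_rad :: "(complex^sw_index) set" where
  "sw_rad = {x. x $ (False, False) = 0 \<and> x $ (True, False) = 0}"

text \<open>A description of the radical by characters instead of coordinates, suited to maps such
  as the antipode of which only the effect on characters is known.\<close>

lemma sw_rad_iff_char: "\<sigma> \<noteq> 0 \<Longrightarrow> x \<in> sw_rad \<longleftrightarrow> sw_char \<sigma> x = 0 \<and> sw_char (- \<sigma>) x = 0"
  by (auto simp: sw_rad_def sw_char_def)

lemma sw_rad_mul:
  "x \<in> sw_rad \<Longrightarrow> sw_mul x y \<in> sw_rad" "y \<in> sw_rad \<Longrightarrow> sw_mul x y \<in> sw_rad"
  by (auto simp: sw_rad_def sw_mul_nth)

lemma sw_rad_square: "x \<in> sw_rad \<Longrightarrow> y \<in> sw_rad \<Longrightarrow> sw_mul x y = 0"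
  by (auto simp: sw_rad_def sw_mul_nth sw_eq_iff)

lemma clinear_sw_char: "clinear_form (sw_char \<sigma>)"
  by (simp add: clinear_form_iff sw_char_def algebra_simps)

lemma sw_char_mul: "\<sigma> * \<sigma> = 1 \<Longrightarrow> sw_char \<sigma> (sw_mul x y) = sw_char \<sigma> x * sw_char \<sigma> y"
  by (simp add: sw_char_def sw_mul_nth algebra_simps)

lemma sw_char_unit: "sw_char \<sigma> sw_unit = 1"
  by (simp add: sw_char_def sw_unit_nth)

lemma sw_character_cases:
  assumes "character H \<phi>" "alg_mul H = sw_mul" "alg_unit H = sw_unit"
  obtains "\<phi> = sw_char 1" | "\<phi> = sw_char (- 1)"
proof -
  have f: "clinear_form \<phi>" "\<And>x y. \<phi> (sw_mul x y) = \<phi> x * \<phi> y" "\<phi> sw_unit = 1"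
    using assms by (auto simp: character_def)
  have "\<phi> sw_s * \<phi> sw_s = 1" "\<phi> sw_w * \<phi> sw_w = 0"
    using f(2)[of sw_s sw_s] f(2)[of sw_w sw_w] clinear_form_zero[OF f(1)]
    by (simp_all add: sw_relations f(3))
  then have s: "\<phi> sw_s = 1 \<or> \<phi> sw_s = - 1" and w: "\<phi> sw_w = 0"
    by (simp_all add: square_eq_1_iff)
  have "\<phi> x = sw_char (\<phi> sw_s) x" for x
  proof -
    have "x = x $ (False, False) *s sw_unit + x $ (False, True) *s sw_w
        + x $ (True, False) *s sw_s + x $ (True, True) *s sw_mul sw_s sw_w"
      by (simp add: sw_eq_iff sw_unit_nth sw_s_nth sw_w_nth sw_mul_nth)
    then have "\<phi> x = \<phi> (x $ (False, False) *s sw_unit + x $ (False, True) *s sw_w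
        + x $ (True, False) *s sw_s + x $ (True, True) *s sw_mul sw_s sw_w)"
      by metis
    then show ?thesis
      by (simp add: clinear_form_add[OF f(1)] clinear_form_scale[OF f(1)] f w sw_char_def)
  qed
  then have "\<phi> = sw_char (\<phi> sw_s)" by (rule ext)
  with s that show thesis by metis
qed

text \<open>Commuting with s kills the coefficients of w and sw; commuting with w kills that of
  s.\<close>

lemma sw_central:
  assumes "\<And>h. sw_mul x h = sw_mul h x"
  shows "x = x $ (False, False) *s sw_unit"
  using assms[of sw_s] assms[of sw_w]
  by (auto simp: sw_eq_iff sw_mul_nth sw_unit_nth sw_s_nth sw_w_nth)

lemma clinear_map_plus: "clinear_map f \<Longrightarrow> clinear_map g \<Longrightarrow> clinear_map (\<lambda>x. f x + g x)"
  by (simp add: clinear_map_iff vec.scale_right_distrib)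

text \<open>
  If the contractions of t with the two characters are 1 and the involution g, on both sides, then
  t agrees with (1 \<otimes> 1 + g \<otimes> 1 + 1 \<otimes> g - g \<otimes> g) / 2 up to a tensor in the square of the radical.
\<close>

definition sw_involutive :: "complex \<Rightarrow> complex^sw_index \<Rightarrow> complex^(sw_index \<times> sw_index) \<Rightarrow> bool" where
  "sw_involutive \<sigma> g t \<longleftrightarrow>
     rslice (sw_char \<sigma>) t = sw_unit \<and> rslice (sw_char (- \<sigma>)) t = g \<and>
     lslice (sw_char \<sigma>) t = sw_unit \<and> lslice (sw_char (- \<sigma>)) t = g"

text \<open>A bilinear map that vanishes on J \<times> J cannot see the unknown J \<otimes> J part
  of \<open>t\<close>, and modulo that part \<open>t\<close> is fixed by its contractions with the
  two characters.\<close>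

lemma tlift_sw_involutive:
  assumes t: "sw_involutive \<sigma> g t" and \<sigma>: "\<sigma> * \<sigma> = 1" and g: "sw_mul g g = sw_unit" "sw_char \<sigma> g = 1"
    and f: "bilin f" "\<And>x y. x \<in> sw_rad \<Longrightarrow> y \<in> sw_rad \<Longrightarrow> f x y = 0"
  shows "tlift f t = (1/2) *s (f sw_unit sw_unit + f g sw_unit + f sw_unit g - f g g)"
proof -
  define e where "e = sw_unit"
  define h where "h = \<sigma> *s sw_s"
  \<comment> \<open>\<open>p\<close> and \<open>q\<close> are the idempotents dual to the two
    characters, so \<open>\<pi>\<close> projects onto the span of 1 and s along J.\<close>
  define p where "p = (1/2) *s (e + h)"
  define q where "q = (1/2) *s (e - h)"
  define \<pi> where "\<pi> x = sw_char \<sigma> x *s p + sw_char (- \<sigma>) x *s q" for x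
  have \<pi>: "clinear_map \<pi>"
    using clinear_sw_char unfolding \<pi>_def clinear_map_iff clinear_form_iff
    by (simp add: vec.scale_left_distrib vec.scale_right_distrib)
  have rad: "x - \<pi> x \<in> sw_rad" for x
    using \<sigma> by (simp add: sw_rad_def \<pi>_def sw_char_def p_def q_def e_def h_def sw_unit_nth sw_s_nth
        field_simps)
  note lin = clinear_map_add[OF bilin_left[OF f(1)]] clinear_map_scale[OF bilin_left[OF f(1)]]
    clinear_map_diff[OF bilin_left[OF f(1)]] clinear_map_add[OF bilin_right[OF f(1)]]
    clinear_map_scale[OF bilin_right[OF f(1)]] clinear_map_diff[OF bilin_right[OF f(1)]]
  \<comment> \<open>Expand f (x - \<pi> x) (y - \<pi> y) = 0: every term besides f x y has a
    projected argument and can be computed from the contractions.\<close>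
  have split: "f = (\<lambda>x y. f (\<pi> x) y + f x (\<pi> y) - f (\<pi> x) (\<pi> y))"
  proof (intro ext)
    fix x y
    have "f (x - \<pi> x) (y - \<pi> y) = 0" by (intro f rad)
    then show "f x y = f (\<pi> x) y + f x (\<pi> y) - f (\<pi> x) (\<pi> y)"
      by (simp add: lin) (simp add: algebra_simps)
  qed
  have l: "tlift (\<lambda>x y. k (\<pi> x) y) t = k p (lslice (sw_char \<sigma>) t) + k q (lslice (sw_char (- \<sigma>)) t)"
    if k: "bilin k" for k :: "complex^sw_index \<Rightarrow> complex^sw_index \<Rightarrow> complex^'a"
  proof -
    have b: "bilin (\<lambda>x y. k (\<pi> x) y)"
      by (intro bilinI bilin_right[OF k] clinear_map_compose[OF bilin_left[OF k] \<pi>])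
    have 1: "clinear_map (\<lambda>t. k p (lslice (sw_char \<sigma>) t) + k q (lslice (sw_char (- \<sigma>)) t))"
      by (intro clinear_map_plus clinear_map_compose[OF bilin_right[OF k]] clinear_slice_intros)
    show ?thesis
      by (rule tensor_eqI[OF clinear_tlift 1])
        (subst tlift_tensor[OF b], simp add: lslice_tensor clinear_sw_char \<pi>_def
          clinear_map_add[OF bilin_left[OF k]] clinear_map_scale[OF bilin_left[OF k]]
          clinear_map_scale[OF bilin_right[OF k]])
  qed
  have r: "tlift (\<lambda>x y. f x (\<pi> y)) t = f (rslice (sw_char \<sigma>) t) p + f (rslice (sw_char (- \<sigma>)) t) q"
  proof -
    have b: "bilin (\<lambda>x y. f x (\<pi> y))"
      by (intro bilinI bilin_left[OF f(1)] clinear_map_compose[OF bilin_right[OF f(1)] \<pi>])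
    have 1: "clinear_map (\<lambda>t. f (rslice (sw_char \<sigma>) t) p + f (rslice (sw_char (- \<sigma>)) t) q)"
      by (intro clinear_map_plus clinear_map_compose[OF bilin_left[OF f(1)]] clinear_slice_intros)
    show ?thesis
      by (rule tensor_eqI[OF clinear_tlift 1])
        (subst tlift_tensor[OF b], simp add: rslice_tensor clinear_sw_char \<pi>_def lin)
  qed
  have b: "bilin (\<lambda>x y. f x (\<pi> y))"
    by (intro bilinI bilin_left[OF f(1)] clinear_map_compose[OF bilin_right[OF f(1)] \<pi>])
  have "tlift f t = f p e + f q g + (f e p + f g q) - (f p (\<pi> e) + f q (\<pi> g))"
    by (subst split, subst tlift_diff, subst tlift_add, subst l[OF f(1)], subst r, subst l[OF b])
      (use t in \<open>simp add: sw_involutive_def e_def\<close>)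
  moreover have "\<pi> e = p + q" by (simp add: \<pi>_def e_def sw_char_unit)
  moreover have pq: "p + q = e" "p - q = h"
    by (simp_all add: p_def q_def Finite_Cartesian_Product.vec_eq_iff field_simps)
  moreover have "sw_char (- \<sigma>) g * sw_char (- \<sigma>) g = 1"
    using sw_char_mul[of "- \<sigma>" g g] \<sigma> by (simp add: g sw_char_unit)
  then consider "sw_char (- \<sigma>) g = 1" | "sw_char (- \<sigma>) g = - 1" by (auto simp: square_eq_1_iff)
  then have "f p e + f q g + (f e p + f g q) - (f p e + f q (\<pi> g)) =
      (1/2) *s (f e e + f g e + f e g - f g g)"
  proof cases
    \<comment> \<open>Both characters are 1 at g, so g = 1 + j with j in J, and g g = 1 + 2 j forces
      j = 0.\<close>
    case 1
    then have "g $ (False, False) = 1 \<and> g $ (True, False) = 0"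
      using g(2) \<sigma> by (auto simp: sw_char_def algebra_simps)
    moreover have "g $ (False, True) = 0 \<and> g $ (True, True) = 0"
      using calculation g(1) by (simp add: sw_eq_iff sw_mul_nth sw_unit_nth)
    ultimately have "g = e" by (simp add: sw_eq_iff e_def sw_unit_nth)
    have "\<pi> e = e" using \<open>\<pi> e = p + q\<close> pq by simp
    have "f e p + f e q = f e e" using pq by (metis lin(4))
    moreover have "f p e + f q e = f e e" using pq by (metis lin(1))
    ultimately show ?thesis
      unfolding \<open>g = e\<close> \<open>\<pi> e = e\<close>
      by (simp only:) (simp add: Finite_Cartesian_Product.vec_eq_iff)
  next
    case 2
    \<comment> \<open>Now g agrees with h modulo J; the only term quadratic in the difference is f j
      j = 0.\<close>
    define j where "j = g - h"
    have "\<pi> g = h" using 2 g(2) pq by (simp add: \<pi>_def)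
    then have "j \<in> sw_rad" using rad[of g] by (simp add: j_def)
    then have "f j j = 0" by (intro f)
    moreover have "g = h + j" by (simp add: j_def)
    ultimately show ?thesis
      unfolding \<open>\<pi> g = h\<close> unfolding p_def q_def \<open>g = h + j\<close>
      by (simp add: lin) (simp add: Finite_Cartesian_Product.vec_eq_iff field_simps)
  qed
  ultimately show ?thesis by (simp add: e_def)
qed

section \<open>Contractions of the R-matrix, Drinfeld element and balancing element\<close>

lemma tflip_tmul:
  assumes "bilin m1" "bilin m2"
  shows "tflip (tmul m1 m2 s t) = tmul m2 m1 (tflip s) (tflip t)"
proof -
  note T = bilin_tmul[OF assms] and U = bilin_tmul[OF assms(2,1)]
  have F: "clinear_map g \<Longrightarrow> clinear_map (\<lambda>x. tflip (g x))" 
    for g :: "complex^'z::finite \<Rightarrow> complex^('x::finite \<times> 'y::finite)"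
    by (rule clinear_map_compose[OF clinear_tflip])
  have 1: "tflip (tmul m1 m2 (x \<otimes>\<^sub>c y) t) = tmul m2 m1 (tflip (x \<otimes>\<^sub>c y)) (tflip t)" for x y t
    by (rule tensor_eqI[where t = t])
      (intro F bilin_right[OF T] clinear_map_compose[OF bilin_right[OF U]] clinear_map_ident
       | simp add: tmul_tensor assms tflip_tensor)+
  show ?thesis
    by (rule tensor_eqI[where t = s])
      (intro F bilin_left[OF T] clinear_map_compose[OF bilin_left[OF U]] clinear_map_ident 1)+
qed

lemma sw_ribbon_structure:
  fixes H :: "sw_index ribbon_data"
  assumes H: "ribbon_hopf_algebra H" and mul: "alg_mul H = sw_mul" and unit: "alg_unit H = sw_unit"
  obtains \<sigma> g where "\<sigma> * \<sigma> = 1" "sw_mul g g = sw_unit" "sw_char \<sigma> g = 1"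
    "sw_involutive \<sigma> g (rmatrix H)" "sw_involutive \<sigma> g (rmatrix_inv H)"
    "balancing H = g" "balancing_inv H = g"
proof -
  let ?R = "rmatrix H" and ?e = "sw_unit" and ?E = "sw_unit \<otimes>\<^sub>c sw_unit" and ?S = "antipode H"
  have q: "quasitriangular H" and ha: "hopf_algebra H" and ba: "bialgebra H" and ca: "coalgebra H"
    and ua: "unital_algebra H"
    using H by (auto simp: ribbon_hopf_algebra_def quasitriangular_def hopf_algebra_def bialgebra_def)
  have m: "bilin sw_mul" using bilin_alg_mul[OF ua] mul by simp
  have assoc: "\<And>x y z. sw_mul (sw_mul x y) z = sw_mul x (sw_mul y z)"
    and e: "\<And>x. sw_mul ?e x = x" "\<And>x. sw_mul x ?e = x"
    using ua mul unit by (auto simp: unital_algebra_def)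
  note inv_eqI = alg_inverse_eqI[of sw_mul, OF assoc e]
  have mul2: "mul2 H = tmul sw_mul sw_mul" by (simp add: mul2_def mul)
  have assoc2: "\<And>r s t. mul2 H (mul2 H r s) t = mul2 H r (mul2 H s t)"
    unfolding mul2 by (intro tmul_assoc m assoc)
  have E: "\<And>t. mul2 H ?E t = t" "\<And>t. mul2 H t ?E = t"
    unfolding mul2 by (intro tmul_unit m e)+
  note inv2_eqI = alg_inverse_eqI[of "mul2 H", OF assoc2 E]
  have char: "character H (sw_char s)" if "s * s = 1" for s
    using that by (simp add: character_def clinear_sw_char mul unit sw_char_mul sw_char_unit)
  \<comment> \<open>The counit may send s to 1 or to -1, since s \<mapsto> -s, w \<mapsto> w is an
    automorphism of the algebra; \<open>\<sigma>\<close> records which. The other character is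
    \<open>\<eta>\<close>.\<close>
  obtain \<sigma> where \<epsilon>: "counit H = sw_char \<sigma>" and \<sigma>: "\<sigma> = 1 \<or> \<sigma> = - 1"
    using sw_character_cases[OF character_counit[OF ba] mul unit] by metis
  define \<eta> where "\<eta> = sw_char (- \<sigma>)"
  have \<sigma>2: "\<sigma> * \<sigma> = 1" "(- \<sigma>) * (- \<sigma>) = 1" using \<sigma> by auto
  have c\<epsilon>: "character H (sw_char \<sigma>)" and c\<eta>: "character H \<eta>"
    using char \<sigma>2 by (simp_all add: \<eta>_def)
  have l: "clinear_form \<eta>" by (simp add: \<eta>_def clinear_sw_char)
  have ne: "\<eta> \<noteq> sw_char \<sigma>"
  proof
    assume "\<eta> = sw_char \<sigma>"
    then have "\<eta> sw_s = sw_char \<sigma> sw_s" by simp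
    with \<sigma> show False by (auto simp: \<eta>_def sw_char_def sw_s_nth)
  qed
  \<comment> \<open>The convolution square is again a character, hence \<eta> or \<epsilon>, and an
    idempotent \<eta> would equal \<epsilon>.\<close>
  have \<eta>\<eta>: "conv H \<eta> \<eta> = sw_char \<sigma>"
  proof -
    have "conv H \<eta> \<eta> = \<eta> \<or> conv H \<eta> \<eta> = sw_char \<sigma>"
      using sw_character_cases[OF character_conv[OF ba c\<eta> c\<eta>] mul unit] \<sigma> unfolding \<eta>_def by force
    then show ?thesis using conv_idempotent_character[OF ha c\<eta>] ne \<epsilon> by auto
  qed
  have \<epsilon>\<epsilon>: "conv H (sw_char \<sigma>) (sw_char \<sigma>) = sw_char \<sigma>"
    using conv_counit(1)[OF ca clinear_sw_char] \<epsilon> by simp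
  define Q where "Q = rmatrix_inv H"
  obtain y where y: "mul2 H ?R y = ?E" "mul2 H y ?R = ?E"
    using q by (auto simp: quasitriangular_def alg_invertible_def unit)
  then have Q: "mul2 H ?R Q = ?E" "mul2 H Q ?R = ?E"
    using inv2_eqI[OF y] by (simp_all add: Q_def rmatrix_inv_def unit)
  have rQ: "sw_mul (rslice \<phi> ?R) (rslice \<phi> Q) = ?e" and lQ: "sw_mul (lslice \<phi> ?R) (lslice \<phi> Q) = ?e"
    if "character H \<phi>" for \<phi>
  proof -
    have \<phi>: "clinear_form \<phi>" "\<And>x y. \<phi> (sw_mul x y) = \<phi> x * \<phi> y" "\<phi> ?e = 1"
      using that by (auto simp: character_def mul unit)
    show "sw_mul (rslice \<phi> ?R) (rslice \<phi> Q) = ?e" "sw_mul (lslice \<phi> ?R) (lslice \<phi> Q) = ?e"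
      using arg_cong[OF Q(1), of "rslice \<phi>"] arg_cong[OF Q(1), of "lslice \<phi>"] \<phi>
      by (simp_all add: mul2 rslice_tmul lslice_tmul m rslice_tensor lslice_tensor)
  qed
  \<comment> \<open>An idempotent with a right inverse is 1. The contractions of R with \<epsilon>
    are idempotent because \<epsilon> is its own convolution square.\<close>
  have idem: "a = ?e" if "sw_mul a b = ?e" "a = sw_mul a a" for a b
    using that assoc e by metis
  have r\<epsilon>: "rslice (sw_char \<sigma>) ?R = ?e" and l\<epsilon>: "lslice (sw_char \<sigma>) ?R = ?e"
    using idem[OF rQ[OF c\<epsilon>]] idem[OF lQ[OF c\<epsilon>]]
      rslice_conv_rmatrix[OF q c\<epsilon> c\<epsilon>] lslice_conv_rmatrix[OF q c\<epsilon> c\<epsilon>] by (simp_all add: \<epsilon>\<epsilon> mul)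
  define g where "g = rslice \<eta> ?R"
  have gg: "sw_mul g g = ?e"
    using rslice_conv_rmatrix[OF q c\<eta> c\<eta>] r\<epsilon> by (simp add: \<eta>\<eta> mul g_def)
  have \<sigma>g: "sw_char \<sigma> g = 1"
    using form_slices[OF clinear_sw_char l, of \<sigma> ?R] by (simp add: g_def l\<epsilon> \<eta>_def sw_char_unit)
  have v: "ribbon H = ?e"
  proof -
    have "ribbon H = ribbon H $ (False, False) *s ?e"
      by (rule sw_central) (use H in \<open>simp add: ribbon_hopf_algebra_def mul\<close>)
    moreover have "sw_char \<sigma> (ribbon H) = 1" using H by (simp add: ribbon_hopf_algebra_def \<epsilon>)
    ultimately show ?thesis
      by (metis clinear_form_scale[OF clinear_sw_char] sw_char_unit mult.right_neutral vec.scale_one)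
  qed
  have lg: "lslice \<eta> ?R = g"
  proof -
    \<comment> \<open>\<open>?M\<close> is R21 R. Its inverse \<open>?N\<close> is exhibited because
      \<open>alg_inverse\<close> is a definite description, evaluated by naming an inverse.\<close>
    let ?M = "mul2 H (tflip ?R) ?R" and ?N = "mul2 H Q (tflip Q)"
    have F: "mul2 H (tflip s) (tflip t) = tflip (mul2 H s t)" for s t
      by (simp add: mul2 tflip_tmul m)
    have MN: "mul2 H ?M ?N = ?E" "mul2 H ?N ?M = ?E"
      using Q assoc2 E F by (metis tflip_tensor)+
    \<comment> \<open>For v = 1 the ribbon axiom on \<Delta>(v) says that the inverse of R21 R is
      \<Delta>(1) = 1 \<otimes> 1.\<close>
    have "comul H ?e = mul2 H (alg_inverse (mul2 H) ?E ?M) (mul2 H ?E ?E)"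
      using H by (simp add: ribbon_hopf_algebra_def v unit E)
    then have "?N = ?E"
      using ba by (simp add: inv2_eqI[OF MN] E bialgebra_def unit)
    then have M: "?M = ?E" using MN E by metis
    \<comment> \<open>Contracting R21 R = 1 \<otimes> 1 shows that the left contraction of R with
      \<eta> is inverse to the right one, which is the involution g.\<close>
    have "rslice \<eta> ?M = sw_mul (lslice \<eta> ?R) g"
      unfolding mul2 \<eta>_def g_def
      by (subst rslice_tmul[OF m m clinear_sw_char sw_char_mul[OF \<sigma>2(2)]])
        (simp add: rslice_tflip clinear_sw_char)
    then have "sw_mul (lslice \<eta> ?R) g = ?e"
      unfolding M by (simp add: rslice_tensor l) (simp add: \<eta>_def sw_char_unit)
    then show ?thesis using gg assoc e by metis
  qed
  have iR: "sw_involutive \<sigma> g ?R"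
    using r\<epsilon> l\<epsilon> lg by (simp add: sw_involutive_def g_def \<eta>_def)
  \<comment> \<open>Contractions of the inverse R-matrix are inverse to those of R, and 1 and g are
    their own inverses.\<close>
  have iQ: "sw_involutive \<sigma> g Q"
    using rQ[OF c\<epsilon>] lQ[OF c\<epsilon>] rQ[OF c\<eta>] lQ[OF c\<eta>] gg assoc e r\<epsilon> l\<epsilon> lg g_def
    unfolding sw_involutive_def \<eta>_def by metis
  have S: "clinear_map ?S" and S1: "\<And>h. tlift (\<lambda>x y. sw_mul (?S x) y) (comul H h) = sw_char \<sigma> h *s ?e"
    using ha by (auto simp: hopf_algebra_def mul unit \<epsilon>)
  have Sb: "bilin (\<lambda>x y. sw_mul (?S x) y)" and Sb': "bilin (\<lambda>x y. sw_mul (?S y) x)"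
    by (intro bilinI clinear_map_compose[OF bilin_left[OF m] S] bilin_right[OF m])+
  have Sgl: "sw_mul (?S h) h = ?e" if "comul H h = h \<otimes>\<^sub>c h" "sw_char \<sigma> h = 1" for h
    using S1[of h] that by (simp add: tlift_tensor[OF Sb])
  have Se: "?S ?e = ?e"
    using Sgl[of ?e] ba by (simp add: bialgebra_def unit sw_char_unit e)
  have "sw_mul (?S g) g = ?e"
    using Sgl[of g] comul_rslice_rmatrix[OF q c\<eta>] \<sigma>g by (simp add: g_def)
  then have Sg: "?S g = g" using gg assoc e by metis
  have Srad: "?S x \<in> sw_rad" if "x \<in> sw_rad" for x
  proof -
    have "sw_char \<sigma> (?S x) = sw_char \<sigma> x" "\<eta> (?S x) = \<eta> x"
      using conv_involutive_character_antipode[OF ha c\<epsilon>] \<epsilon>\<epsilon> \<epsilon>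
        conv_involutive_character_antipode[OF ha c\<eta>] \<eta>\<eta> by simp_all
    then show ?thesis using that \<sigma> sw_rad_iff_char[of \<sigma>] by (auto simp: \<eta>_def)
  qed
  \<comment> \<open>The map x, y \<mapsto> S(y) x vanishes on J \<times> J because S preserves J;
    its values at (1, 1), (g, 1), (1, g), (g, g) are 1, g, g, 1.\<close>
  have "drinfeld H = (1/2) *s (?e + g + g - ?e)"
    unfolding drinfeld_def mul
    by (subst tlift_sw_involutive[OF iR \<sigma>2(1) gg \<sigma>g Sb'])
      (simp_all add: Srad sw_rad_square Se Sg e gg)
  then have u: "drinfeld H = g" by (simp add: Finite_Cartesian_Product.vec_eq_iff)
  have bal: "balancing H = g"
    unfolding balancing_def mul unit v u using inv_eqI[of ?e ?e] e by simp
  have "balancing_inv H = g"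
    unfolding balancing_inv_def bal mul unit by (rule inv_eqI[OF gg gg])
  with that \<sigma>2(1) gg \<sigma>g iR iQ bal show thesis by (simp add: Q_def)
qed

section \<open>Words in the Sweedler algebra\<close>

lemma sum_PiE_insert:
  assumes "k \<notin> K"
  shows "sum G (Pi\<^sub>E (insert k K) B) = (\<Sum>c\<in>Pi\<^sub>E K B. \<Sum>y\<in>B k. G (c(k := y)))"
proof -
  have "sum G (Pi\<^sub>E (insert k K) B) = (\<Sum>(y, c)\<in>B k \<times> Pi\<^sub>E K B. G (c(k := y)))"
    unfolding PiE_insert_eq
    by (subst sum.reindex[OF inj_combinator[OF assms]]) (simp add: case_prod_unfold)
  also have "\<dots> = (\<Sum>y\<in>B k. \<Sum>c\<in>Pi\<^sub>E K B. G (c(k := y)))"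
    by (simp add: sum.cartesian_product)
  also have "\<dots> = (\<Sum>c\<in>Pi\<^sub>E K B. \<Sum>y\<in>B k. G (c(k := y)))"
    by (rule sum.swap)
  finally show ?thesis .
qed

lemma sw_assoc: "sw_mul (sw_mul x y) z = sw_mul x (sw_mul y z)"
  by (simp add: sw_eq_iff sw_mul_nth algebra_simps)

lemma sw_one: "sw_mul sw_unit x = x" "sw_mul x sw_unit = x"
  by (simp_all add: sw_eq_iff sw_mul_nth sw_unit_nth)

lemma bilin_sw_mul: "bilin sw_mul"
  by (simp add: bilin_def clinear_map_iff sw_eq_iff sw_mul_nth algebra_simps)

definition sw_word :: "('e \<Rightarrow> complex^sw_index) \<Rightarrow> 'e list \<Rightarrow> complex^sw_index" where
  "sw_word v es = fold sw_mul (map v es) sw_unit"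

lemma fold_sw_mul: "fold sw_mul xs u = sw_mul (fold sw_mul xs sw_unit) u"
proof (induction xs arbitrary: u)
  case (Cons x xs)
  show ?case by (subst (1 2) fold.simps) (metis Cons.IH comp_apply sw_assoc sw_one(2))
qed (simp add: sw_one)

lemma sw_word_Nil: "sw_word v [] = sw_unit"
  by (simp add: sw_word_def)

lemma sw_word_append: "sw_word v (as @ bs) = sw_mul (sw_word v bs) (sw_word v as)"
  unfolding sw_word_def map_append fold_append comp_apply by (rule fold_sw_mul)

lemma sw_word_Cons: "sw_word v (x # bs) = sw_mul (sw_word v bs) (v x)"
  using sw_word_append[of v "[x]" bs] by (simp add: sw_word_def sw_one)

lemma sw_word_cong: "(\<And>x. x \<in> set es \<Longrightarrow> v x = v' x) \<Longrightarrow> sw_word v es = sw_word v' es"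
  unfolding sw_word_def by (metis map_eq_conv)

lemma sw_word_rad: "x \<in> set es \<Longrightarrow> v x \<in> sw_rad \<Longrightarrow> sw_word v es \<in> sw_rad"
  by (induction es) (auto simp: sw_word_Cons intro: sw_rad_mul)

text \<open>This is J B J = 0: J is an ideal of square zero. The condition
  \<open>x \<noteq> y\<close> ensures that the two letters from J occupy different
  positions.\<close>

lemma sw_word_rad2:
  "x \<in> set es \<Longrightarrow> y \<in> set es \<Longrightarrow> x \<noteq> y \<Longrightarrow> v x \<in> sw_rad \<Longrightarrow> v y \<in> sw_rad \<Longrightarrow> sw_word v es = 0"
  by (induction es)
    (auto simp: sw_word_Cons sw_rad_square sw_word_rad
      clinear_map_zero[OF bilin_left[OF bilin_sw_mul]])

lemma clinear_sw_word:
  assumes "count_list es a = 1"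
  shows "clinear_map (\<lambda>x. sw_word (v(a := x)) es)"
proof -
  obtain as bs where es: "es = as @ a # bs" using assms by (metis count_notin split_list zero_neq_one)
  then have n: "a \<notin> set as" "a \<notin> set bs"
    using assms by (simp_all add: count_list_0_iff)
  have "sw_word (v(a := x)) cs = sw_word v cs" if "a \<notin> set cs" for x cs
    by (rule sw_word_cong) (use that in auto)
  with n have "sw_word (v(a := x)) es = sw_mul (sw_mul (sw_word v bs) x) (sw_word v as)" for x
    unfolding es sw_word_append sw_word_Cons by simp
  then show ?thesis
    using clinear_map_compose[OF bilin_left[OF bilin_sw_mul] bilin_right[OF bilin_sw_mul]] by simp
qed

definition sw_pow :: "complex^sw_index \<Rightarrow> nat \<Rightarrow> complex^sw_index" where
  "sw_pow g n = (if even n then sw_unit else g)"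

lemma sw_pow_add: "sw_mul g g = sw_unit \<Longrightarrow> sw_mul (sw_pow g m) (sw_pow g n) = sw_pow g (m + n)"
  by (auto simp: sw_pow_def sw_one)

lemma sw_word_pow:
  "sw_mul g g = sw_unit \<Longrightarrow> sw_word (\<lambda>x. sw_pow g (F x)) es = sw_pow g (\<Sum>x\<leftarrow>es. F x)"
  by (induction es) (simp_all add: sw_word_Nil sw_word_Cons sw_pow_add add.commute, simp add: sw_pow_def)

text \<open>Only the crossings in \<open>K\<close> still carry basis vectors; all other events take
  their bead from \<open>v\<close>. In this form the crossings can be summed out one by one.\<close>

definition crossing_beads ::
    "nat set \<Rightarrow> (event \<Rightarrow> complex^sw_index) \<Rightarrow> (nat \<Rightarrow> sw_index \<times> sw_index) \<Rightarrow> event \<Rightarrow> complex^sw_index" where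
  "crossing_beads K v c x =
     (case x of Over k \<Rightarrow> if k \<in> K then basis (fst (c k)) else v x
      | Under k \<Rightarrow> if k \<in> K then basis (snd (c k)) else v x
      | Turn P \<Rightarrow> v x)"

lemma sum_list_update:
  fixes F :: "'a \<Rightarrow> nat"
  assumes "count_list es a = 1" "F a = 0"
  shows "(\<Sum>x\<leftarrow>es. (F(a := n)) x) = (\<Sum>x\<leftarrow>es. F x) + n"
proof -
  obtain as bs where es: "es = as @ a # bs" using assms by (metis count_notin split_list zero_neq_one)
  then have n: "a \<notin> set as" "a \<notin> set bs"
    using assms by (simp_all add: count_list_0_iff)
  then have F: "map (F(a := n)) as = map F as" "map (F(a := n)) bs = map F bs" by auto
  show ?thesis
    unfolding es map_append list.map sum_list_append sum_list.Cons F using assms(2) by simp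
qed

text \<open>
  As the square of the radical vanishes, the sum over the beads of one crossing only involves
  the beads 1 and g, and once all beads are of this kind each crossing contributes a factor g.
\<close>

lemma sw_word_crossing_sum:
  assumes "finite K" "\<And>k. k \<in> K \<Longrightarrow> sw_involutive \<sigma> g (t k)"
    and \<sigma>: "\<sigma> * \<sigma> = 1" and g: "sw_mul g g = sw_unit" "sw_char \<sigma> g = 1"
    and "\<And>k. k \<in> K \<Longrightarrow> count_list es (Over k) = 1" "\<And>k. k \<in> K \<Longrightarrow> count_list es (Under k) = 1"
    and "\<And>k. k \<in> K \<Longrightarrow> F (Over k) = 0" "\<And>k. k \<in> K \<Longrightarrow> F (Under k) = 0"
  shows "(\<Sum>c\<in>K \<rightarrow>\<^sub>E UNIV. (\<Prod>k\<in>K. t k $ c k) *s sw_word (crossing_beads K (\<lambda>x. sw_pow g (F x)) c) es) =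
    sw_pow g (card K + (\<Sum>x\<leftarrow>es. F x))"
  using assms(1,2,6-9)
proof (induction K arbitrary: F rule: finite_induct)
  case empty
  have "crossing_beads {} v c = v" for v c
    by (auto simp: crossing_beads_def fun_eq_iff split: event.split)
  then show ?case by (simp add: sw_word_pow g)
next
  case (insert k K)
  let ?v = "\<lambda>c. crossing_beads K (\<lambda>x. sw_pow g (F x)) c"
  let ?f = "\<lambda>c x y. sw_word ((?v c)(Over k := x, Under k := y)) es"
  let ?F = "\<lambda>a b. F(Over k := a, Under k := b)"
  have n: "count_list es (Over k) = 1" "count_list es (Under k) = 1"
    using insert.prems by simp_all
  have f: "bilin (?f c)" for c
  proof (rule bilinI)
    show "clinear_map (?f c x)" for x by (rule clinear_sw_word[OF n(2)])
    show "clinear_map (\<lambda>x. ?f c x y)" for y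
      by (subst fun_upd_twist) (use clinear_sw_word[OF n(1)] in simp_all)
  qed
  have mem: "Over k \<in> set es" "Under k \<in> set es"
    using n by (metis count_notin zero_neq_one)+
  have rad: "?f c x y = 0" if "x \<in> sw_rad" "y \<in> sw_rad" for c x y
    by (rule sw_word_rad2[OF mem]) (use that in auto)
  have upd: "(?v c)(Over k := sw_pow g a, Under k := sw_pow g b) =
      crossing_beads K (\<lambda>x. sw_pow g (?F a b x)) c" for c a b
    using insert.hyps by (auto simp: crossing_beads_def fun_eq_iff split: event.split)
  have v: "crossing_beads (insert k K) (\<lambda>x. sw_pow g (F x)) (c(k := p)) =
      (?v c)(Over k := basis (fst p), Under k := basis (snd p))" for c p
    using insert.hyps by (auto simp: crossing_beads_def fun_eq_iff split: event.split)
  \<comment> \<open>Giving crossing k the beads g^a and g^b only changes exponents, so the induction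
    hypothesis applies with a modified \<open>F\<close>; hence \<open>F\<close> is arbitrary in the
    induction.\<close>
  have IH: "(\<Sum>c\<in>K \<rightarrow>\<^sub>E UNIV. (\<Prod>k\<in>K. t k $ c k) *s ?f c (sw_pow g a) (sw_pow g b)) =
      sw_pow g (card K + (\<Sum>x\<leftarrow>es. F x) + a + b)" for a b
  proof -
    have sum: "(\<Sum>x\<leftarrow>es. ?F a b x) = (\<Sum>x\<leftarrow>es. F x) + a + b"
      using sum_list_update[OF n(2), of "F(Over k := a)" b] sum_list_update[OF n(1), of F a]
        insert.prems by simp
    have "?F a b (Over i) = 0" "?F a b (Under i) = 0" if "i \<in> K" for i
      using that insert.prems insert.hyps by auto
    then have "(\<Sum>c\<in>K \<rightarrow>\<^sub>E UNIV. (\<Prod>k\<in>K. t k $ c k) *s ?f c (sw_pow g a) (sw_pow g b)) =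
        sw_pow g (card K + (\<Sum>x\<leftarrow>es. ?F a b x))"
      unfolding upd using insert.prems by (intro insert.IH[of "?F a b"]) simp_all
    then show ?thesis unfolding sum by (simp only: add.assoc)
  qed
  have t: "sw_involutive \<sigma> g (t k)" using insert.prems by simp
  have unit: "sw_pow g 0 = sw_unit" and one: "sw_pow g 1 = g" by (simp_all add: sw_pow_def)
  have dist: "c *s ((1/2) *s (A + B + C - D)) = (1/2) *s (c *s A + c *s B + c *s C - c *s D)"
    for c and A B C D :: "complex^sw_index"
    by (simp add: Finite_Cartesian_Product.vec_eq_iff algebra_simps)
  let ?N = "card K + (\<Sum>x\<leftarrow>es. F x)"
  have "(\<Sum>c\<in>insert k K \<rightarrow>\<^sub>E UNIV. (\<Prod>k\<in>insert k K. t k $ c k) *s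
        sw_word (crossing_beads (insert k K) (\<lambda>x. sw_pow g (F x)) c) es) =
      (\<Sum>c\<in>K \<rightarrow>\<^sub>E UNIV. \<Sum>p\<in>UNIV. (\<Prod>k\<in>K. t k $ c k) *s (t k $ p *s ?f c (basis (fst p)) (basis (snd p))))"
  proof -
    have "(\<Prod>i\<in>K. t i $ (c(k := p)) i) = (\<Prod>i\<in>K. t i $ c i)" for c p
      using insert.hyps by (intro prod.cong) auto
    then have "(\<Prod>i\<in>insert k K. t i $ (c(k := p)) i) = (\<Prod>i\<in>K. t i $ c i) * t k $ p" for c p
      by (simp only: prod.insert[OF insert.hyps(1,2)] fun_upd_same mult.commute)
    then show ?thesis
      by (simp only: sum_PiE_insert[OF insert.hyps(2)] v vec.scale_scale)
  qed
  also have "\<dots> = (\<Sum>c\<in>K \<rightarrow>\<^sub>E UNIV. (\<Prod>k\<in>K. t k $ c k) *s tlift (?f c) (t k))"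
    unfolding tlift_def vec.scale_sum_right ..
  also have "\<dots> = (\<Sum>c\<in>K \<rightarrow>\<^sub>E UNIV. (\<Prod>k\<in>K. t k $ c k) *s
      ((1/2) *s (?f c sw_unit sw_unit + ?f c g sw_unit + ?f c sw_unit g - ?f c g g)))"
    by (intro sum.cong refl arg_cong[where f = "\<lambda>z. _ *s z"]
        tlift_sw_involutive[OF t \<sigma> g f] rad)
  also have "\<dots> = (1/2) *s ((\<Sum>c\<in>K \<rightarrow>\<^sub>E UNIV. (\<Prod>k\<in>K. t k $ c k) *s ?f c sw_unit sw_unit)
      + (\<Sum>c\<in>K \<rightarrow>\<^sub>E UNIV. (\<Prod>k\<in>K. t k $ c k) *s ?f c g sw_unit)
      + (\<Sum>c\<in>K \<rightarrow>\<^sub>E UNIV. (\<Prod>k\<in>K. t k $ c k) *s ?f c sw_unit g)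
      - (\<Sum>c\<in>K \<rightarrow>\<^sub>E UNIV. (\<Prod>k\<in>K. t k $ c k) *s ?f c g g))"
    unfolding sum.distrib[symmetric] sum_subtractf[symmetric] vec.scale_sum_right
    by (intro sum.cong refl dist)
  also have "\<dots> = (1/2) *s (sw_pow g (?N + 0 + 0) + sw_pow g (?N + 1 + 0) + sw_pow g (?N + 0 + 1)
      - sw_pow g (?N + 1 + 1))"
    unfolding IH[of 0 0, unfolded unit] IH[of 1 0, unfolded unit one] IH[of 0 1, unfolded unit one]
      IH[of 1 1, unfolded one] ..
  \<comment> \<open>As g^(N+2) = g^N, the outer two of the four terms cancel and the inner two
    average to g^(N+1): the crossing contributes one factor g.\<close>
  also have "\<dots> = sw_pow g (card (insert k K) + (\<Sum>x\<leftarrow>es. F x))"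
    using insert.hyps by (simp add: sw_pow_def Finite_Cartesian_Product.vec_eq_iff)
  finally show ?case .
qed

section \<open>Traversing a long knot diagram\<close>

lemma points_eq: "points D = concat (map (\<lambda>k. map (Pair k) [0..<length (line D k)]) [0..<Suc (length D)])"
  by (simp add: points_def)

lemma set_points: "set (points D) = {(k, j). k \<le> length D \<and> j < length (line D k)}"
  by (force simp: points_eq simp del: upt_Suc)

lemma distinct_points: "distinct (points D)"
proof -
  have "distinct (concat (map (\<lambda>k. map (Pair k) [0..<f k]) xs))" if "distinct xs"
    for xs :: "nat list" and f :: "nat \<Rightarrow> nat"
    using that by (induction xs) (auto simp: distinct_map inj_on_def)
  then show ?thesis unfolding points_eq by (metis distinct_upt)
qed

lemma tangle_diagram_lower_0: "tangle_diagram a D b \<Longrightarrow> D \<noteq> [] \<Longrightarrow> lower (D ! 0) = a"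
  by (cases D) auto

lemma tangle_diagram_last: "tangle_diagram a D b \<Longrightarrow> D \<noteq> [] \<Longrightarrow> upper (last D) = b"
  by (induction D arbitrary: a) auto

lemma tangle_diagram_step:
  "tangle_diagram a D b \<Longrightarrow> Suc k < length D \<Longrightarrow> lower (D ! Suc k) = upper (D ! k)"
proof (induction D arbitrary: a k)
  case (Cons L D)
  show ?case
  proof (cases k)
    case 0
    then show ?thesis using Cons.prems tangle_diagram_lower_0[of "upper L" D b] by auto
  next
    case (Suc i)
    then show ?thesis using Cons.prems Cons.IH[of "upper L" i] by auto
  qed
qed simp

locale long_knot =
  fixes D :: diagram
  assumes knot: "long_knot_diagram D"
begin

lemma tangle: "tangle_diagram [Up] D [Up]"
  using knot by (simp add: long_knot_diagram_def)

lemma line_lower: "k < length D \<Longrightarrow> line D k = lower (D ! k)"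
  by (simp add: line_def)

lemma line_upper:
  assumes "k < length D"
  shows "line D (Suc k) = upper (D ! k)"
proof (cases "Suc k < length D")
  case True
  then show ?thesis using tangle_diagram_step[OF tangle] by (simp add: line_def)
next
  case False
  then have "k = length D - 1" "D \<noteq> []" using assms by auto
  then show ?thesis
    using tangle_diagram_last[OF tangle] by (simp add: line_def last_conv_nth)
qed

lemma line_first: "line D 0 = [Up]"
  using tangle tangle_diagram_lower_0[OF tangle] by (cases "D = []") (auto simp: line_def)

lemma line_last: "line D (length D) = [Up]"
  by (simp add: line_def)

lemma set_walk: "set (walk D) = set (points D)"
  using knot by (simp add: long_knot_diagram_def)

lemma length_walk: "length (walk D) = length (points D)"
  by (simp add: walk_def)

text \<open>The walk has exactly as many entries as there are points and reaches all of them, so it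
  cannot repeat any.\<close>

lemma distinct_walk: "distinct (walk D)"
  by (metis card_distinct distinct_card distinct_points length_walk set_walk)

lemma walk_nth: "t < length (walk D) \<Longrightarrow> walk D ! t = (next_point D ^^ t) (0, 0)"
  by (simp add: walk_def)

lemma walk_Suc: "Suc t < length (walk D) \<Longrightarrow> walk D ! Suc t = next_point D (walk D ! t)"
  by (simp add: walk_nth)

lemma walk_nonempty: "walk D \<noteq> []"
  using set_walk line_first by (force simp: set_points)

lemma walk_0: "walk D ! 0 = (0, 0)"
  using walk_nonempty by (simp add: walk_nth)

text \<open>The upper end is a fixed point of \<open>next_point\<close>; reached any earlier, it
  would be repeated.\<close>

lemma walk_last: "walk D ! (length (walk D) - 1) = (length D, 0)"
proof -
  have "(length D, 0) \<in> set (walk D)" unfolding set_walk by (simp add: set_points line_last)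
  then obtain t where t: "t < length (walk D)" "walk D ! t = (length D, 0)"
    by (auto simp: in_set_conv_nth)
  have "t = length (walk D) - 1"
  proof (rule ccontr)
    assume "t \<noteq> length (walk D) - 1"
    then have "Suc t < length (walk D)" using t(1) by simp
    moreover from this have "walk D ! Suc t = walk D ! t"
      by (simp add: walk_Suc t(2) next_point_def line_last)
    ultimately show False using t(1) distinct_walk by (simp add: nth_eq_iff_index_eq)
  qed
  with t(2) show ?thesis by simp
qed

subsection \<open>Next points, layer by layer\<close>

context
  fixes k l P r
  assumes k: "k < length D" and layer: "D ! k = (l, P, r)"
begin

lemma layer_line_lower: "line D k = l @ source P @ r"
  and layer_line_upper: "line D (Suc k) = l @ target P @ r"
  using line_lower[OF k] line_upper[OF k] by (simp_all add: layer)

lemma next_point_up: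
  "line D k ! j = Up \<Longrightarrow> next_point D (k, j) = pass_up (l, P, r) k (k, j)"
  using k by (simp add: next_point_def layer)

lemma next_point_down:
  "line D (Suc k) ! j = Down \<Longrightarrow> next_point D (Suc k, j) = pass_down (l, P, r) k (Suc k, j)"
  using layer by (simp add: next_point_def)

lemma next_point_left:
  assumes "j < length l"
  shows "l ! j = Up \<Longrightarrow> next_point D (k, j) = (Suc k, j)"
    and "l ! j = Down \<Longrightarrow> next_point D (Suc k, j) = (k, j)"
  using assms next_point_up[of j] next_point_down[of j]
  by (simp_all add: layer_line_lower layer_line_upper nth_append)

lemma next_point_right:
  assumes "j < length r"
  shows "r ! j = Up \<Longrightarrow> next_point D (k, length l + length (source P) + j) =
      (Suc k, length l + length (target P) + j)"
    and "r ! j = Down \<Longrightarrow> next_point D (Suc k, length l + length (target P) + j) =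
      (k, length l + length (source P) + j)"
  using assms next_point_up[of "length l + length (source P) + j"]
    next_point_down[of "length l + length (target P) + j"]
  by (simp_all add: layer_line_lower layer_line_upper nth_append)

lemma next_point_piece:
  "P = PosX \<or> P = NegX \<Longrightarrow> next_point D (k, length l) = (Suc k, Suc (length l))"
  "P = PosX \<or> P = NegX \<Longrightarrow> next_point D (k, Suc (length l)) = (Suc k, length l)"
  "P = MaxCCW \<Longrightarrow> next_point D (k, Suc (length l)) = (k, length l)"
  "P = MaxCW \<Longrightarrow> next_point D (k, length l) = (k, Suc (length l))"
  "P = MinCCW \<Longrightarrow> next_point D (Suc k, length l) = (Suc k, Suc (length l))"
  "P = MinCW \<Longrightarrow> next_point D (Suc k, Suc (length l)) = (Suc k, length l)"
  using next_point_up[of "length l"] next_point_up[of "Suc (length l)"]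
    next_point_down[of "length l"] next_point_down[of "Suc (length l)"]
  by (auto simp: layer_line_lower layer_line_upper nth_append)

end

end

subsection \<open>Sums and products over the points of a diagram\<close>

text \<open>The points from which the arcs through a piece start, \<open>j\<close> being the
  position of its left strand. The summation over tails is carried out in any commutative monoid:
  sums will count events, products will give state sums.\<close>

fun piece_tails :: "piece \<Rightarrow> nat \<Rightarrow> nat \<Rightarrow> point set" where
  "piece_tails PosX k j = {(k, j), (k, Suc j)}"
| "piece_tails NegX k j = {(k, j), (k, Suc j)}"
| "piece_tails MaxCCW k j = {(k, Suc j)}"
| "piece_tails MaxCW k j = {(k, j)}"
| "piece_tails MinCCW k j = {(Suc k, j)}"
| "piece_tails MinCW k j = {(Suc k, Suc j)}"

context comm_monoid_set
begin

lemma lessThan_add: "F h {..<a + b :: nat} = F h {..<a} \<^bold>* F (\<lambda>j. h (a + j)) {..<b}"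
  by (induction b) (simp_all add: lessThan_Suc commute left_commute)

text \<open>
  Every point but the last one is the tail of an arc through exactly one layer: points on
  upward strands through the layer above them, points on downward strands through the one below.
\<close>

lemma points_layers:
  assumes "long_knot_diagram D"
  shows "F h (set (points D) - {(length D, 0)}) =
    F (\<lambda>k. case D ! k of (l, P, r) \<Rightarrow>
        F (\<lambda>j. h (if l ! j = Up then k else Suc k, j)) {..<length l} \<^bold>*
        F h (piece_tails P k (length l)) \<^bold>*
        F (\<lambda>j. h (if r ! j = Up then (k, length l + length (source P) + j)
              else (Suc k, length l + length (target P) + j))) {..<length r}) {..<length D}"
    (is "_ = F ?layer _")
proof -
  interpret long_knot D by (unfold_locales) (rule assms)
  let ?m = "length D" and ?w = "\<lambda>k. length (line D k)"
  let ?up = "\<lambda>k j. if line D k ! j = Up then h (k, j) else \<^bold>1"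
  let ?dn = "\<lambda>k j. if line D k ! j = Up then \<^bold>1 else h (k, j)"
  have pts: "set (points D) = (SIGMA k:{..<Suc ?m}. {..<?w k})"
    by (auto simp: set_points)
  have last: "(?m, 0) \<in> set (points D)" by (simp add: set_points line_last)
  have "F h (set (points D) - {(?m, 0)}) =
      F (\<lambda>p. if p = (?m, 0) then \<^bold>1 else h p) (set (points D))"
    using last by (subst (2) remove[of _ "(?m, 0)"]) (auto intro!: cong)
  also have "\<dots> = F (\<lambda>k. F (\<lambda>j. if (k, j) = (?m, 0) then \<^bold>1 else h (k, j)) {..<?w k}) {..<Suc ?m}"
    unfolding pts by (rule trans[OF _ Sigma[symmetric]]) (auto intro!: cong)
  also have "\<dots> = F (\<lambda>k. F (\<lambda>j. h (k, j)) {..<?w k}) {..<?m}"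
    by (auto simp: lessThan_Suc line_last intro!: cong)
  also have "\<dots> = F (\<lambda>k. F (?up k) {..<?w k} \<^bold>* F (?dn k) {..<?w k}) {..<?m}"
    by (intro cong refl) (auto simp: distrib[symmetric] intro!: cong)
  also have "\<dots> = F (\<lambda>k. F (?up k) {..<?w k}) {..<?m} \<^bold>* F (\<lambda>k. F (?dn k) {..<?w k}) {..<?m}"
    by (rule distrib)
  \<comment> \<open>The bottom and top lines are single upward strands and have no downward points,
    so the downward part can be shifted by one line and attached to the layer below.\<close>
  also have "F (\<lambda>k. F (?dn k) {..<?w k}) {..<?m} = F (\<lambda>k. F (?dn k) {..<?w k}) {..<Suc ?m}"
    by (simp add: lessThan_Suc line_last)
  also have "\<dots> = F (\<lambda>k. F (?dn (Suc k)) {..<?w (Suc k)}) {..<?m}"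
    by (subst lessThan_Suc_eq_insert_0) (simp add: line_first reindex)
  also have "F (\<lambda>k. F (?up k) {..<?w k}) {..<?m} \<^bold>* \<dots> =
      F (\<lambda>k. F (?up k) {..<?w k} \<^bold>* F (?dn (Suc k)) {..<?w (Suc k)}) {..<?m}"
    by (rule distrib[symmetric])
  also have "\<dots> = F ?layer {..<?m}"
  proof (intro cong refl)
    fix k assume "k \<in> {..<?m}"
    then have k: "k < ?m" by simp
    obtain l P r where L: "D ! k = (l, P, r)" by (metis prod_cases3)
    note lines = layer_line_lower[OF k L] layer_line_upper[OF k L]
    have U: "F (?up k) {..<?w k} =
        F (\<lambda>j. if l ! j = Up then h (k, j) else \<^bold>1) {..<length l} \<^bold>*
        F (\<lambda>j. if source P ! j = Up then h (k, length l + j) else \<^bold>1) {..<length (source P)} \<^bold>*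
        F (\<lambda>j. if r ! j = Up then h (k, length l + length (source P) + j) else \<^bold>1) {..<length r}"
      by (auto simp: lines(1) lessThan_add nth_append assoc add.assoc
          intro!: arg_cong2[where f = "(\<^bold>*)"] cong)
    have V: "F (?dn (Suc k)) {..<?w (Suc k)} =
        F (\<lambda>j. if l ! j = Up then \<^bold>1 else h (Suc k, j)) {..<length l} \<^bold>*
        F (\<lambda>j. if target P ! j = Up then \<^bold>1 else h (Suc k, length l + j)) {..<length (target P)} \<^bold>*
        F (\<lambda>j. if r ! j = Up then \<^bold>1 else h (Suc k, length l + length (target P) + j)) {..<length r}"
      by (auto simp: lines(2) lessThan_add nth_append assoc add.assoc
          intro!: arg_cong2[where f = "(\<^bold>*)"] cong)
    have P: "F (\<lambda>j. if source P ! j = Up then h (k, length l + j) else \<^bold>1) {..<length (source P)} \<^bold>*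
        F (\<lambda>j. if target P ! j = Up then \<^bold>1 else h (Suc k, length l + j)) {..<length (target P)} =
        F h (piece_tails P k (length l))"
      by (cases P) (simp_all add: numeral_2_eq_2 lessThan_Suc commute)
    have X: "F (\<lambda>j. if l ! j = Up then h (k, j) else \<^bold>1) {..<length l} \<^bold>*
        F (\<lambda>j. if l ! j = Up then \<^bold>1 else h (Suc k, j)) {..<length l} =
        F (\<lambda>j. h (if l ! j = Up then k else Suc k, j)) {..<length l}"
      by (auto simp: distrib[symmetric] intro!: cong)
    have Y: "F (\<lambda>j. if r ! j = Up then h (k, length l + length (source P) + j) else \<^bold>1) {..<length r} \<^bold>*
        F (\<lambda>j. if r ! j = Up then \<^bold>1 else h (Suc k, length l + length (target P) + j)) {..<length r} =
        F (\<lambda>j. h (if r ! j = Up then (k, length l + length (source P) + j)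
              else (Suc k, length l + length (target P) + j))) {..<length r}"
      by (auto simp: distrib[symmetric] intro!: cong)
    have r: "(a \<^bold>* b \<^bold>* c) \<^bold>* (a' \<^bold>* b' \<^bold>* c') = (a \<^bold>* a') \<^bold>* (b \<^bold>* b') \<^bold>* (c \<^bold>* c')" for a b c a' b' c'
      by (simp only: assoc commute left_commute)
    show "F (?up k) {..<?w k} \<^bold>* F (?dn (Suc k)) {..<?w (Suc k)} = ?layer k"
      unfolding U V r P X Y L by simp
  qed
  finally show ?thesis .
qed

end

subsection \<open>Events along a long knot\<close>

fun piece_events :: "piece \<Rightarrow> nat \<Rightarrow> event set" where
  "piece_events PosX k = {Over k, Under k}"
| "piece_events NegX k = {Over k, Under k}"
| "piece_events P k = {Turn P}"

lemma count_list_concat: "count_list (concat xss) e = (\<Sum>xs\<leftarrow>xss. count_list xs e)"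
  by (induction xss) auto

context long_knot
begin

lemma pieces_nth: "k < length D \<Longrightarrow> D ! k = (l, P, r) \<Longrightarrow> pieces D ! k = P"
  by (simp add: pieces_def)

context
  fixes k l P r
  assumes k: "k < length D" and layer: "D ! k = (l, P, r)"
begin

lemma events_at_left:
  assumes "j < length l"
  shows "events_at D (if l ! j = Up then k else Suc k, j) = []"
  using assms k layer layer_line_lower[OF k layer] layer_line_upper[OF k layer]
  by (cases "l ! j") (auto simp: events_at_def nth_append)

lemma events_at_right:
  assumes "j < length r"
  shows "events_at D (if r ! j = Up then (k, length l + length (source P) + j)
      else (Suc k, length l + length (target P) + j)) = []"
  using assms k layer layer_line_lower[OF k layer] layer_line_upper[OF k layer]
  by (cases "r ! j") (auto simp: events_at_def nth_append)

lemma events_at_piece: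
  "P = PosX \<Longrightarrow> events_at D (k, length l) = [Over k]"
  "P = PosX \<Longrightarrow> events_at D (k, Suc (length l)) = [Under k]"
  "P = NegX \<Longrightarrow> events_at D (k, length l) = [Under k]"
  "P = NegX \<Longrightarrow> events_at D (k, Suc (length l)) = [Over k]"
  "P = MaxCCW \<Longrightarrow> events_at D (k, Suc (length l)) = [Turn P]"
  "P = MaxCW \<Longrightarrow> events_at D (k, length l) = [Turn P]"
  "P = MinCCW \<Longrightarrow> events_at D (Suc k, length l) = [Turn P]"
  "P = MinCW \<Longrightarrow> events_at D (Suc k, Suc (length l)) = [Turn P]"
  using k layer layer_line_lower[OF k layer] layer_line_upper[OF k layer]
  by (auto simp: events_at_def nth_append)

lemma count_events_piece:
  "(\<Sum>p\<in>piece_tails P k (length l). count_list (events_at D p) e) = (if e \<in> piece_events P k then 1 else 0)"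
  by (cases P) (auto simp: events_at_piece)

end

text \<open>The walk visits every point once, so events may be counted over the set of points and
  regrouped by layers.\<close>

lemma count_events:
  "count_list (events D) e = card {k. k < length D \<and> e \<in> piece_events (pieces D ! k) k}"
proof -
  let ?c = "\<lambda>p. count_list (events_at D p) e"
  have "count_list (events D) e = sum ?c (set (walk D))"
    by (simp add: events_def count_list_concat comp_def sum_list_distinct_conv_sum_set distinct_walk)
  also have "\<dots> = sum ?c (set (points D))" by (simp only: set_walk)
  also have "\<dots> = sum ?c (set (points D) - {(length D, 0)})"
    by (rule sum.mono_neutral_right) (auto simp: events_at_def line_last)
  also have "\<dots> = (\<Sum>k<length D. if e \<in> piece_events (pieces D ! k) k then 1 else 0)"
    unfolding sum.points_layers[OF knot]
    by (intro sum.cong refl)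
      (auto simp: events_at_left events_at_right count_events_piece pieces_nth split: prod.split)
  also have "\<dots> = card {k. k < length D \<and> e \<in> piece_events (pieces D ! k) k}"
    by (simp add: sum.If_cases) (rule arg_cong[where f = card], auto)
  finally show ?thesis .
qed

lemma count_events_crossing:
  assumes "k \<in> crossings D"
  shows "count_list (events D) (Over k) = 1" and "count_list (events D) (Under k) = 1"
proof -
  have "e \<in> piece_events P i \<longleftrightarrow> (P = PosX \<or> P = NegX) \<and> i = k" if "e = Over k \<or> e = Under k" for e P i
    using that by (cases P) auto
  moreover have "{i. i < length D \<and> (pieces D ! i = PosX \<or> pieces D ! i = NegX) \<and> i = k} = {k}"
    using assms by (auto simp: crossings_def)
  ultimately show "count_list (events D) (Over k) = 1" "count_list (events D) (Under k) = 1"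
    by (simp_all add: count_events)
qed

lemma count_events_turn:
  "P \<noteq> PosX \<Longrightarrow> P \<noteq> NegX \<Longrightarrow>
    count_list (events D) (Turn P) = card {k. k < length D \<and> pieces D ! k = P}"
proof -
  assume P: "P \<noteq> PosX" "P \<noteq> NegX"
  have "Turn P \<in> piece_events Q k \<longleftrightarrow> Q = P" for Q k using P by (cases Q) auto
  then show ?thesis by (simp add: count_events)
qed

end

subsection \<open>Parity of the number of crossings and extrema\<close>

fun inversions :: "nat list \<Rightarrow> nat" where
  "inversions [] = 0"
| "inversions (x # xs) = length (filter (\<lambda>y. y < x) xs) + inversions xs"

definition cross_inversions :: "nat list \<Rightarrow> nat list \<Rightarrow> nat" where
  "cross_inversions xs ys = (\<Sum>x\<leftarrow>xs. length (filter (\<lambda>y. y < x) ys))"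

lemma inversions_append:
  "inversions (xs @ ys) = inversions xs + inversions ys + cross_inversions xs ys"
  by (induction xs) (auto simp: cross_inversions_def)

lemma cross_inversions_append:
  "cross_inversions xs (ys @ zs) = cross_inversions xs ys + cross_inversions xs zs"
  "cross_inversions (xs @ ys) zs = cross_inversions xs zs + cross_inversions ys zs"
  by (simp_all add: cross_inversions_def sum_list_addf)

text \<open>Only the pair itself changes its relative order. A change of parity is expressed by an
  odd sum, as subtraction of natural numbers truncates.\<close>

lemma inversions_swap:
  assumes "a \<noteq> b"
  shows "odd (inversions (xs @ [a, b] @ ys) + inversions (xs @ [b, a] @ ys))"
proof -
  have c: "cross_inversions zs [a, b] = cross_inversions zs [b, a]"
    "cross_inversions [a, b] zs = cross_inversions [b, a] zs" for zs
    by (induction zs) (simp_all add: cross_inversions_def)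
  have "inversions (xs @ [a, b] @ ys) + inversions (xs @ [b, a] @ ys) =
      2 * (inversions xs + inversions ys + cross_inversions xs ys + cross_inversions xs [b, a]
        + cross_inversions [b, a] ys) + (inversions [a, b] + inversions [b, a])"
    by (simp only: inversions_append cross_inversions_append c mult_2 ac_simps)
  moreover have "inversions [a, b] + inversions [b, a] = 1" using assms by simp
  ultimately show ?thesis by simp
qed

text \<open>No other entry lies between two consecutive numbers, so each one forms inversions with
  both of them or with neither. Modulo 2 only the inversion within the pair remains.\<close>

lemma inversions_remove_consecutive:
  assumes "b = Suc a \<or> a = Suc b" "{a, b} \<inter> set (xs @ ys) = {}"
  shows "even (inversions (xs @ [a, b] @ ys) + inversions (xs @ ys) + (if b < a then 1 else 0))"
proof -
  have e1: "even (cross_inversions xs [a, b])"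
    unfolding cross_inversions_def using assms by (induction xs) auto
  have e2: "even (cross_inversions [a, b] ys)"
  proof -
    have "filter (\<lambda>y. y < a) ys = filter (\<lambda>y. y < b) ys"
      using assms by (intro filter_cong) (auto simp: less_Suc_eq)
    then show ?thesis by (simp add: cross_inversions_def)
  qed
  have "inversions (xs @ [a, b] @ ys) + inversions (xs @ ys) + inversions [a, b] =
      2 * (inversions xs + inversions ys + cross_inversions xs ys + inversions [a, b])
      + (cross_inversions xs [a, b] + cross_inversions [a, b] ys)"
    by (simp only: inversions_append cross_inversions_append mult_2 ac_simps)
  moreover have "even \<dots>" using e1 e2 by (simp only: even_add dvd_triv_left simp_thms)
  moreover have "inversions [a, b] = (if b < a then 1 else 0)" by simp
  ultimately show ?thesis by metis
qed

lemma inversions_order_iso: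
  assumes "length xs = length ys"
    and "\<And>i j. i < j \<Longrightarrow> j < length xs \<Longrightarrow> xs ! j < xs ! i \<longleftrightarrow> ys ! j < ys ! i"
  shows "inversions xs = inversions ys"
  using assms
proof (induction xs ys rule: list_induct2)
  case (Cons x xs y ys)
  have "length (filter (\<lambda>z. z < x) xs) = length (filter (\<lambda>z. z < y) ys)"
  proof -
    have "xs ! i < x \<longleftrightarrow> ys ! i < y" if "i < length xs" for i
      using Cons.prems[of 0 "Suc i"] that by simp
    then have "{i. i < length xs \<and> xs ! i < x} = {i. i < length ys \<and> ys ! i < y}"
      using Cons.hyps by auto
    then show ?thesis by (simp only: length_filter_conv_card)
  qed
  moreover have "inversions xs = inversions ys"
  proof (rule Cons.IH)
    fix i j assume "i < j" "j < length xs"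
    then show "xs ! j < xs ! i \<longleftrightarrow> ys ! j < ys ! i"
      using Cons.prems[of "Suc i" "Suc j"] by simp
  qed
  ultimately show ?case by simp
qed simp

text \<open>
  The list ys arises from xs by moving one step forwards or backwards in time on each of
  several disjoint strands; this does not change the order.
\<close>

lemma inversions_shift:
  assumes "length xs = length ys" "distinct xs" "distinct ys"
    and "\<And>i. i < length xs \<Longrightarrow> ys ! i = Suc (xs ! i) \<or> xs ! i = Suc (ys ! i)"
    and "\<And>i j. i < length xs \<Longrightarrow> j < length xs \<Longrightarrow> i \<noteq> j \<Longrightarrow> xs ! i \<noteq> ys ! j"
  shows "inversions xs = inversions ys"
proof (rule inversions_order_iso[OF assms(1)])
  fix i j assume "i < j" "j < length xs"
  then have "i < length xs" "j < length xs" "i \<noteq> j" by auto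
  moreover from this have "xs ! i \<noteq> xs ! j" "ys ! i \<noteq> ys ! j"
    using assms(1-3) by (auto simp: nth_eq_iff_index_eq)
  \<comment> \<open>Two entries that move by one step each could change their order only if the new
    value of one were the old value of the other, which disjointness excludes.\<close>
  ultimately show "xs ! j < xs ! i \<longleftrightarrow> ys ! j < ys ! i"
    using assms(4)[of i] assms(4)[of j] assms(5)[of i j] assms(5)[of j i] by linarith
qed

text \<open>The value is 1 if the piece exchanges two strands, or if it is an extremum whose right
  point is passed before its left one, so that the pair is an inversion.\<close>

fun piece_flips :: "piece \<Rightarrow> nat" where
  "piece_flips MaxCW = 0"
| "piece_flips MinCCW = 0"
| "piece_flips P = 1"

lemma map_upt_add:
  "map f [0..<a + b + c] = map f [0..<a] @ map (\<lambda>j. f (a + j)) [0..<b] @ map (\<lambda>j. f (a + b + j)) [0..<c]"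
  by (rule nth_equalityI) (auto simp: nth_append)

section \<open>Passage times and the parity change at one layer\<close>

context long_knot
begin

definition time :: "point \<Rightarrow> nat" where
  "time p = (THE t. t < length (walk D) \<and> walk D ! t = p)"

lemma time_walk: "t < length (walk D) \<Longrightarrow> time (walk D ! t) = t"
  unfolding time_def using distinct_walk by (intro the_equality) (auto simp: nth_eq_iff_index_eq)

lemma time_eqD: "p \<in> set (points D) \<Longrightarrow> q \<in> set (points D) \<Longrightarrow> time p = time q \<Longrightarrow> p = q"
  unfolding set_walk[symmetric] by (metis in_set_conv_nth time_walk)

lemma time_next:
  assumes "p \<in> set (points D)" "p \<noteq> (length D, 0)"
  shows "time (next_point D p) = Suc (time p)"
proof -
  obtain t where t: "t < length (walk D)" "p = walk D ! t"
    using assms(1) unfolding set_walk[symmetric] by (metis in_set_conv_nth)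
  then have "t \<noteq> length (walk D) - 1" using assms(2) walk_last by metis
  then have "Suc t < length (walk D)" using t(1) by simp
  then have "time (walk D ! Suc t) = Suc t" by (rule time_walk)
  then show ?thesis
    using t time_walk[OF t(1)] walk_Suc[OF \<open>Suc t < length (walk D)\<close>] by simp
qed

definition times :: "nat \<Rightarrow> nat list" where
  "times k = map (\<lambda>j. time (k, j)) [0..<length (line D k)]"

text \<open>Strands beside the piece move by one unit of time, forwards or backwards according to
  their direction, which creates no inversions. Only the two points at the piece matter: they are
  exchanged at a crossing, and appear or disappear as consecutive times at an extremum.\<close>

lemma layer_parity:
  assumes k: "k < length D"
  shows "even (inversions (times k) + inversions (times (Suc k)) + piece_flips (pieces D ! k))"
proof -
  obtain l P r where layer: "D ! k = (l, P, r)" by (metis prod_cases3)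
  note lo = layer_line_lower[OF k layer] and up = layer_line_upper[OF k layer]
  let ?s = "length (source P)" and ?t = "length (target P)" and ?l = "length l"
  let ?L = "map (\<lambda>j. time (k, j)) [0..<?l]" and ?L' = "map (\<lambda>j. time (Suc k, j)) [0..<?l]"
  let ?R = "map (\<lambda>j. time (k, ?l + ?s + j)) [0..<length r]"
    and ?R' = "map (\<lambda>j. time (Suc k, ?l + ?t + j)) [0..<length r]"
  let ?M = "map (\<lambda>j. time (k, ?l + j)) [0..<?s]" and ?M' = "map (\<lambda>j. time (Suc k, ?l + j)) [0..<?t]"
  have T: "times k = ?L @ ?M @ ?R" "times (Suc k) = ?L' @ ?M' @ ?R'"
    using map_upt_add[of "\<lambda>j. time (k, j)" ?l ?s "length r"]
      map_upt_add[of "\<lambda>j. time (Suc k, j)" ?l ?t "length r"]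
    by (simp_all add: times_def lo up add.assoc)
  have pts: "j < ?l + ?s + length r \<Longrightarrow> (k, j) \<in> set (points D)"
    "j < ?l + ?t + length r \<Longrightarrow> (Suc k, j) \<in> set (points D)" for j
    using k by (auto simp: set_points lo up)
  have P: "pieces D ! k = P" by (rule pieces_nth[OF k layer])
  \<comment> \<open>\<open>time_next\<close> excludes the upper end of the knot, which is on an
    upward strand.\<close>
  have neq: "(Suc k, j) \<noteq> (length D, 0)" if "line D (Suc k) ! j = Down" for j
    using that line_last by (cases j) auto
  have stepL: "?L' ! j = Suc (?L ! j) \<or> ?L ! j = Suc (?L' ! j)" if "j < ?l" for j
  proof (cases "l ! j")
    case Up
    then show ?thesis
      using next_point_left(1)[OF k layer that] time_next[of "(k, j)"] pts(1)[of j] that k by auto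
  next
    case Down
    then show ?thesis
      using next_point_left(2)[OF k layer that] time_next[of "(Suc k, j)"] pts(2)[of j] that
        neq[of j] by (auto simp: up nth_append)
  qed
  have stepR: "?R' ! j = Suc (?R ! j) \<or> ?R ! j = Suc (?R' ! j)" if "j < length r" for j
  proof (cases "r ! j")
    case Up
    then show ?thesis
      using next_point_right(1)[OF k layer that] time_next[of "(k, ?l + ?s + j)"]
        pts(1)[of "?l + ?s + j"] that k by auto
  next
    case Down
    then show ?thesis
      using next_point_right(2)[OF k layer that] time_next[of "(Suc k, ?l + ?t + j)"]
        pts(2)[of "?l + ?t + j"] that neq[of "?l + ?t + j"] by (auto simp: up nth_append)
  qed
  have inj: "time (i, j) = time (i', j') \<longleftrightarrow> i = i' \<and> j = j'"
    if "(i, j) \<in> set (points D)" "(i', j') \<in> set (points D)" for i j i' j'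
    using time_eqD[OF that] by auto
  have dist: "distinct (times k)" "distinct (times (Suc k))"
    using k by (auto simp: times_def distinct_map inj_on_def inj set_points)
  have disj: "set (times k) \<inter> set (times (Suc k)) = {}"
    using k by (auto simp: times_def inj set_points)
  have X: "inversions (?L @ ?R) = inversions (?L' @ ?R')"
  proof (rule inversions_shift)
    show "distinct (?L @ ?R)" "distinct (?L' @ ?R')" using dist unfolding T by auto
    show "(?L' @ ?R') ! i = Suc ((?L @ ?R) ! i) \<or> (?L @ ?R) ! i = Suc ((?L' @ ?R') ! i)"
      if "i < length (?L @ ?R)" for i
      using that stepL[of i] stepR[of "i - ?l"] by (cases "i < ?l") (auto simp: nth_append)
    show "(?L @ ?R) ! i \<noteq> (?L' @ ?R') ! j" if "i < length (?L @ ?R)" "j < length (?L @ ?R)" for i j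
    proof -
      have "(?L @ ?R) ! i \<in> set (times k)" "(?L' @ ?R') ! j \<in> set (times (Suc k))"
        using nth_mem[of i "?L @ ?R"] nth_mem[of j "?L' @ ?R'"] that unfolding T by auto
      with disj show ?thesis by auto
    qed
  qed simp
  note np = next_point_piece[OF k layer]
  consider (cross) "P = PosX \<or> P = NegX" | "P = MaxCCW" | "P = MaxCW" | "P = MinCCW" | "P = MinCW"
    by (cases P) auto
  then show ?thesis
  proof cases
    case cross
    have st: "?s = 2" "?t = 2" using cross by auto
    let ?a = "time (k, ?l)" and ?b = "time (k, Suc ?l)"
    have M: "?M = [?a, ?b]" "?M' = [time (Suc k, ?l), time (Suc k, Suc ?l)]"
      using cross by (auto simp: numeral_2_eq_2)
    have ab: "time (Suc k, Suc ?l) = Suc ?a" "time (Suc k, ?l) = Suc ?b"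
      using np(1,2)[OF cross] time_next[of "(k, ?l)"] time_next[of "(k, Suc ?l)"] pts(1) st k by auto
    have M': "?M' = [Suc ?b, Suc ?a]" using M ab by simp
    have "?a \<noteq> ?b" using dist(1) unfolding T M by simp
    \<comment> \<open>A crossing is split into two moves: first every strand advances in time while
      keeping its place in the list, then the two crossing entries are transposed.\<close>
    let ?Y = "?L' @ [Suc ?a, Suc ?b] @ ?R'"
    have "inversions (times k) = inversions ?Y"
    proof (rule inversions_shift)
      show "length (times k) = length ?Y" unfolding T M by simp
      show "distinct (times k)" by (rule dist)
      show "distinct ?Y" using dist(2) unfolding T M' by auto
      show "?Y ! i = Suc (times k ! i) \<or>
          times k ! i = Suc (?Y ! i)" if "i < length (times k)" for i
      proof -
        consider "i < ?l" | "i = ?l" | "i = Suc ?l" | "i \<ge> ?l + 2" by linarith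
        then show ?thesis
        proof cases
          case 4
          then have "i - ?l - 2 < length r" using that unfolding T M by simp
          moreover obtain j where "i = ?l + 2 + j" using 4 le_Suc_ex by blast
          ultimately show ?thesis using stepR[of j] st unfolding T M by (simp add: nth_append)
        qed (use stepL[of i] in \<open>auto simp: T M nth_append\<close>)
      qed
      show "times k ! i \<noteq> (?L' @ [Suc ?a, Suc ?b] @ ?R') ! j"
        if "i < length (times k)" "j < length (times k)" for i j
      proof -
        have "set ?Y = set (times (Suc k))" unfolding T M' by auto
        moreover have "?Y ! j \<in> set ?Y"
          by (rule nth_mem) (use that in \<open>simp add: T M\<close>)
        ultimately show ?thesis using disj nth_mem[OF that(1)] by auto
      qed
    qed
    then show ?thesis
      using inversions_swap[of "Suc ?a" "Suc ?b" ?L' ?R'] \<open>?a \<noteq> ?b\<close> cross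
      unfolding P T(2) M' by auto
  next
    case 2
    let ?a = "time (k, ?l)" and ?b = "time (k, Suc ?l)"
    have M: "?M = [?a, ?b]" "?M' = []" using 2 by (auto simp: numeral_2_eq_2)
    have ab: "?a = Suc ?b"
      using np(3)[OF 2] time_next[of "(k, Suc ?l)"] pts(1) 2 k by auto
    have "{?a, ?b} \<inter> set (?L @ ?R) = {}" using dist(1) unfolding T M by auto
    with inversions_remove_consecutive[of ?b ?a ?L ?R] X ab show ?thesis
      unfolding T M P by (simp add: 2)
  next
    case 3
    let ?a = "time (k, ?l)" and ?b = "time (k, Suc ?l)"
    have M: "?M = [?a, ?b]" "?M' = []" using 3 by (auto simp: numeral_2_eq_2)
    have ab: "?b = Suc ?a"
      using np(4)[OF 3] time_next[of "(k, ?l)"] pts(1) 3 k by auto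
    have "{?a, ?b} \<inter> set (?L @ ?R) = {}" using dist(1) unfolding T M by auto
    with inversions_remove_consecutive[of ?b ?a ?L ?R] X ab show ?thesis
      unfolding T M P by (simp add: 3)
  next
    case 4
    let ?a = "time (Suc k, ?l)" and ?b = "time (Suc k, Suc ?l)"
    have M: "?M = []" "?M' = [?a, ?b]" using 4 by (auto simp: numeral_2_eq_2)
    have "line D (Suc k) ! ?l = Down" using 4 by (simp add: up nth_append)
    then have ab: "?b = Suc ?a"
      using np(5)[OF 4] time_next[of "(Suc k, ?l)"] pts(2) 4 neq[of ?l] by auto
    have "{?a, ?b} \<inter> set (?L' @ ?R') = {}" using dist(2) unfolding T M by auto
    with inversions_remove_consecutive[of ?b ?a ?L' ?R'] X ab show ?thesis
      unfolding T M P by (simp add: 4)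
  next
    case 5
    let ?a = "time (Suc k, ?l)" and ?b = "time (Suc k, Suc ?l)"
    have M: "?M = []" "?M' = [?a, ?b]" using 5 by (auto simp: numeral_2_eq_2)
    have "line D (Suc k) ! Suc ?l = Down" using 5 by (simp add: up nth_append)
    then have ab: "?a = Suc ?b"
      using np(6)[OF 5] time_next[of "(Suc k, Suc ?l)"] pts(2) 5 neq[of "Suc ?l"] by auto
    have "{?a, ?b} \<inter> set (?L' @ ?R') = {}" using dist(2) unfolding T M by auto
    with inversions_remove_consecutive[of ?b ?a ?L' ?R'] X ab show ?thesis
      unfolding T M P by (simp add: 5)
  qed
qed

text \<open>The bottom and top lines have one point each and thus no inversions, so the parity
  changes of all layers add up to zero.\<close>

lemma diagram_parity:
  "even (card (crossings D) + count_list (events D) (Turn MaxCCW) + count_list (events D) (Turn MinCW))"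
proof -
  have "even (inversions (times 0) + inversions (times n) + (\<Sum>k<n. piece_flips (pieces D ! k)))"
    if "n \<le> length D" for n
    using that
  proof (induction n)
    case (Suc n)
    then show ?case using layer_parity[of n] by auto
  qed simp
  from this[of "length D"] have "even (\<Sum>k<length D. piece_flips (pieces D ! k))"
    by (simp add: times_def line_first line_last)
  moreover have "(\<Sum>k<length D. piece_flips (pieces D ! k)) =
      (\<Sum>k<length D. (if k \<in> crossings D then 1 else 0) + (if pieces D ! k = MaxCCW then 1 else 0)
        + (if pieces D ! k = MinCW then 1 else 0))"
  proof (intro sum.cong refl)
    fix k assume "k \<in> {..<length D}"
    then show "piece_flips (pieces D ! k) = (if k \<in> crossings D then 1 else 0)
        + (if pieces D ! k = MaxCCW then 1 else 0) + (if pieces D ! k = MinCW then 1 else 0)"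
      by (cases "pieces D ! k") (auto simp: crossings_def)
  qed
  moreover have card: "card {k. k < length D \<and> p k} = (\<Sum>k<length D. if p k then 1 else 0)" for p
    by (simp add: sum.If_cases) (rule arg_cong[where f = card], auto)
  moreover have "{k. k < length D \<and> k \<in> crossings D} = crossings D"
    by (auto simp: crossings_def)
  then have "card (crossings D) = (\<Sum>k<length D. if k \<in> crossings D then 1 else 0)"
    using card[of "\<lambda>k. k \<in> crossings D"] by simp
  moreover have "count_list (events D) (Turn MaxCCW) = (\<Sum>k<length D. if pieces D ! k = MaxCCW then 1 else 0)"
    "count_list (events D) (Turn MinCW) = (\<Sum>k<length D. if pieces D ! k = MinCW then 1 else 0)"
    by (simp_all only: count_events_turn card piece.distinct not_False_eq_True)
  ultimately show ?thesis by (simp only: sum.distrib)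
qed

end

section \<open>The universal invariant\<close>

text \<open>This relates the extrema that change the parity to those that carry beads.\<close>

lemma count_full_rotations:
  "full_rotations Ps \<Longrightarrow> count_list Ps MaxCCW = count_list Ps MinCCW \<and> count_list Ps MaxCW = count_list Ps MinCW"
  by (induction Ps rule: full_rotations.induct) auto

lemma count_turns: "count_list (turns es) P = count_list es (Turn P)"
  unfolding turns_def by (induction es) (auto split: event.split)

lemma sum_list_indicator:
  "a \<noteq> b \<Longrightarrow> (\<Sum>x\<leftarrow>es. if x = a \<or> x = b then 1 else 0) = count_list es a + count_list es b"
  by (induction es) auto

lemma (in long_knot) events_crossing:
  assumes "Over k \<in> set (events D) \<or> Under k \<in> set (events D)"
  shows "k \<in> crossings D"
proof -
  obtain e where e: "e \<in> set (events D)" "e = Over k \<or> e = Under k" using assms by auto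
  then have "card {i. i < length D \<and> e \<in> piece_events (pieces D ! i) i} \<noteq> 0"
    unfolding count_events[symmetric] by (simp add: count_list_0_iff)
  then obtain i where i: "i < length D" "e \<in> piece_events (pieces D ! i) i"
    by (metis (mono_tags, lifting) card.empty empty_Collect_eq)
  with e(2) show ?thesis by (cases "pieces D ! i") (auto simp: crossings_def)
qed

lemma finite_crossings: "finite (crossings D)"
  by (simp add: crossings_def)

definition crossing_matrix :: "sw_index ribbon_data \<Rightarrow> diagram \<Rightarrow> nat \<Rightarrow> complex^(sw_index \<times> sw_index)" where
  "crossing_matrix H D k = (if pieces D ! k = PosX then rmatrix H else rmatrix_inv H)"

text \<open>
  The exponent of g in the evaluated word is the number of crossings plus the number of the two
  kinds of extrema that carry a bead; for a rotational diagram it is even.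
\<close>

lemma crossing_sum_eq_unit:
  assumes D: "rotational_diagram D"
    and R: "sw_involutive \<sigma> g (rmatrix H)" "sw_involutive \<sigma> g (rmatrix_inv H)"
    and \<sigma>: "\<sigma> * \<sigma> = 1" and g: "sw_mul g g = sw_unit" "sw_char \<sigma> g = 1"
    and PQ: "P = MaxCCW \<and> Q = MaxCW \<or> P = MinCCW \<and> Q = MaxCW"
    and v: "\<And>x. x \<in> set (events D) \<Longrightarrow>
      v x = (if x = Turn P \<or> x = Turn Q then g else sw_unit)"
  shows "(\<Sum>c\<in>crossings D \<rightarrow>\<^sub>E UNIV. (\<Prod>k\<in>crossings D. crossing_matrix H D k $ c k) *s
      sw_word (crossing_beads (crossings D) v c) (events D)) = sw_unit"
proof -
  interpret long_knot D using D by unfold_locales (simp add: rotational_diagram_def)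
  let ?F = "\<lambda>x. if x = Turn P \<or> x = Turn Q then 1 else 0 :: nat"
  have w: "sw_word (crossing_beads (crossings D) v c) (events D) =
      sw_word (crossing_beads (crossings D) (\<lambda>x. sw_pow g (?F x)) c) (events D)" for c
    by (rule sw_word_cong) (auto simp: crossing_beads_def sw_pow_def v split: event.split)
  have "(\<Sum>c\<in>crossings D \<rightarrow>\<^sub>E UNIV. (\<Prod>k\<in>crossings D. crossing_matrix H D k $ c k) *s
      sw_word (crossing_beads (crossings D) (\<lambda>x. sw_pow g (?F x)) c) (events D)) =
      sw_pow g (card (crossings D) + (\<Sum>x\<leftarrow>events D. ?F x))"
    by (rule sw_word_crossing_sum[OF finite_crossings _ \<sigma> g])
      (auto simp: crossing_matrix_def R count_events_crossing)
  moreover have "(\<Sum>x\<leftarrow>events D. ?F x) = count_list (events D) (Turn P) + count_list (events D) (Turn Q)"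
    using PQ by (intro sum_list_indicator) auto
  \<comment> \<open>\<open>diagram_parity\<close> involves \<open>MaxCCW\<close> and
    \<open>MinCW\<close>. Full rotations allow replacing \<open>MinCW\<close> by
    \<open>MaxCW\<close>, and \<open>MaxCCW\<close> by \<open>MinCCW\<close>; this covers the bead
    placement of the universal invariant and that of the Reshetikhin--Turaev functor.\<close>
  moreover have "even (card (crossings D) + (count_list (events D) (Turn P) + count_list (events D) (Turn Q)))"
    using diagram_parity count_full_rotations[of "turns (events D)"] D PQ
    by (auto simp: rotational_diagram_def count_turns)
  ultimately show ?thesis unfolding w by (simp add: sw_pow_def)
qed

lemma universal_invariant_sw:
  assumes H: "ribbon_hopf_algebra H" "alg_mul H = sw_mul" "alg_unit H = sw_unit"
    and D: "rotational_diagram D"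
  shows "universal_invariant H D = sw_unit"
proof -
  interpret long_knot D using D by unfold_locales (simp add: rotational_diagram_def)
  obtain \<sigma> g where \<sigma>: "\<sigma> * \<sigma> = 1" and g: "sw_mul g g = sw_unit" "sw_char \<sigma> g = 1"
    and R: "sw_involutive \<sigma> g (rmatrix H)" "sw_involutive \<sigma> g (rmatrix_inv H)"
    and bal: "balancing H = g" "balancing_inv H = g"
    by (rule sw_ribbon_structure[OF H])
  let ?v = "\<lambda>x. if x = Turn MaxCCW \<or> x = Turn MaxCW then g else sw_unit"
  have "fold (alg_mul H) (map (bead H c) (events D)) (alg_unit H) =
      sw_word (crossing_beads (crossings D) ?v c) (events D)" for c
  proof -
    have eq: "map (bead H c) (events D) = map (crossing_beads (crossings D) ?v c) (events D)"
      using events_crossing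
      by (intro map_cong refl) (auto simp: crossing_beads_def bal H split: event.split)
    show ?thesis unfolding sw_word_def H eq ..
  qed
  moreover have "crossing_weight H D c k = crossing_matrix H D k $ c k" for c k
    by (simp add: crossing_weight_def crossing_matrix_def)
  ultimately show ?thesis
    unfolding universal_invariant_def
    using crossing_sum_eq_unit[OF D R \<sigma> g, of MaxCCW MaxCW ?v] by simp
qed

section \<open>State sums\<close>

lemma prod_indicator:
  "finite A \<Longrightarrow> (\<Prod>j\<in>A. if P j then 1 else 0) = (if \<forall>j\<in>A. P j then 1 else 0 :: complex)"
  by (induction A rule: finite_induct) auto

fun mat_prod :: "nat \<Rightarrow> (nat \<Rightarrow> complex mat) \<Rightarrow> nat \<Rightarrow> complex mat" where
  "mat_prod n A 0 = 1\<^sub>m n"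
| "mat_prod n A (Suc T) = A T * mat_prod n A T"

lemma mat_prod_carrier: "(\<And>t. A t \<in> carrier_mat n n) \<Longrightarrow> mat_prod n A T \<in> carrier_mat n n"
  by (induction T) (auto intro: mult_carrier_mat)

text \<open>Expansion over index paths: \<open>x t\<close> is the index reached after
  \<open>t\<close> factors. The end conditions stay inside the summand so that the paths can be
  matched with colourings of all points.\<close>

lemma mat_prod_entry:
  assumes A: "\<And>t. A t \<in> carrier_mat n n" and "i < n" "j < n"
  shows "mat_prod n A T $$ (i, j) =
    (\<Sum>x\<in>{..T} \<rightarrow>\<^sub>E {..<n}. if x 0 = j \<and> x T = i then \<Prod>t<T. A t $$ (x (Suc t), x t) else 0)"
  using assms(2)
proof (induction T arbitrary: i)
  case 0
  have "{..0::nat} = insert 0 {}" by auto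
  then show ?case
    using 0 assms(3) by (simp add: sum_PiE_insert) (auto intro!: sum.neutral)
next
  case (Suc T)
  let ?w = "\<lambda>x. \<Prod>t<T. A t $$ (x (Suc t), x t)"
  have "mat_prod n A (Suc T) $$ (i, j) = (\<Sum>k<n. A T $$ (i, k) * mat_prod n A T $$ (k, j))"
    using carrier_matD[OF A[of T]] carrier_matD[OF mat_prod_carrier[OF A, where T = T]] Suc.prems assms(3)
    by (simp add: scalar_prod_def lessThan_atLeast0)
  also have "\<dots> = (\<Sum>k<n. \<Sum>x\<in>{..T} \<rightarrow>\<^sub>E {..<n}.
      if x 0 = j \<and> x T = k then A T $$ (i, k) * ?w x else 0)"
    by (intro sum.cong refl) (simp add: Suc.IH sum_distrib_left if_distrib cong: if_cong)
  also have "\<dots> = (\<Sum>x\<in>{..T} \<rightarrow>\<^sub>E {..<n}. \<Sum>k<n.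
      if x 0 = j \<and> x T = k then A T $$ (i, k) * ?w x else 0)"
    by (rule sum.swap)
  also have "\<dots> = (\<Sum>x\<in>{..T} \<rightarrow>\<^sub>E {..<n}. if x 0 = j then A T $$ (i, x T) * ?w x else 0)"
  proof (intro sum.cong refl)
    fix x assume "x \<in> {..T} \<rightarrow>\<^sub>E {..<n}"
    then have xT: "x T < n" by (auto simp: PiE_def Pi_def)
    have "(\<Sum>k<n. if x 0 = j \<and> x T = k then A T $$ (i, k) * ?w x else 0) =
        (\<Sum>k<n. if x T = k then (if x 0 = j then A T $$ (i, k) * ?w x else 0) else 0)"
      by (intro sum.cong) auto
    also have "\<dots> = (if x 0 = j then A T $$ (i, x T) * ?w x else 0)"
      using xT by simp
    finally show "(\<Sum>k<n. if x 0 = j \<and> x T = k then A T $$ (i, k) * ?w x else 0) =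
        (if x 0 = j then A T $$ (i, x T) * ?w x else 0)" .
  qed
  also have "\<dots> = (\<Sum>x\<in>{..T} \<rightarrow>\<^sub>E {..<n}. \<Sum>y<n. if y = i then
      (if x 0 = j then A T $$ (y, x T) * ?w x else 0) else 0)"
    using Suc.prems by simp
  also have "\<dots> = (\<Sum>x\<in>{..T} \<rightarrow>\<^sub>E {..<n}. \<Sum>y<n.
      if (x(Suc T := y)) 0 = j \<and> (x(Suc T := y)) (Suc T) = i
      then \<Prod>t<Suc T. A t $$ ((x(Suc T := y)) (Suc t), (x(Suc T := y)) t) else 0)"
  proof (intro sum.cong refl)
    fix x y
    have "(\<Prod>t<T. A t $$ ((x(Suc T := y)) (Suc t), (x(Suc T := y)) t)) = ?w x"
      by (intro prod.cong) auto
    then have "(\<Prod>t<Suc T. A t $$ ((x(Suc T := y)) (Suc t), (x(Suc T := y)) t)) = A T $$ (y, x T) * ?w x"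
      by (simp only: prod.lessThan_Suc) (simp add: mult.commute)
    then show "(if y = i then (if x 0 = j then A T $$ (y, x T) * ?w x else 0) else 0) =
        (if (x(Suc T := y)) 0 = j \<and> (x(Suc T := y)) (Suc T) = i
         then \<Prod>t<Suc T. A t $$ ((x(Suc T := y)) (Suc t), (x(Suc T := y)) t) else 0)"
      by (simp only: fun_upd_same) simp
  qed
  also have "\<dots> = (\<Sum>x\<in>insert (Suc T) {..T} \<rightarrow>\<^sub>E {..<n}. if x 0 = j \<and> x (Suc T) = i
      then \<Prod>t<Suc T. A t $$ (x (Suc t), x t) else 0)"
    by (rule sum_PiE_insert[symmetric]) simp
  finally show ?case by (simp only: atMost_Suc)
qed

definition colourings :: "nat \<Rightarrow> diagram \<Rightarrow> nat \<Rightarrow> nat list set" where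
  "colourings n D k = {zs. length zs = length (line D k) \<and> set zs \<subseteq> {..<n}}"

lemma finite_colourings: "finite (colourings n D k)"
  using finite_lists_length_eq[of "{..<n}" "length (line D k)"]
  by (auto simp: colourings_def conj_commute)

text \<open>Since \<open>rt_diagram\<close> splits off the lowest layer, suffixes of the diagram are
  treated from the top downwards; all intermediate sums merge into one over families
  \<open>F\<close> of colourings, one for each line.\<close>

lemma (in long_knot) rt_diagram_drop:
  assumes "k \<le> length D" "xs \<in> colourings n D k"
  shows "rt_diagram H n \<rho> (drop k D) ys xs =
    (\<Sum>F\<in>Pi\<^sub>E {k..length D} (colourings n D). if F k = xs \<and> F (length D) = ys
       then \<Prod>i\<in>{k..<length D}. rt_layer H \<rho> (D ! i) (F (Suc i)) (F i) else 0)"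
  using assms
proof (induction k arbitrary: xs rule: inc_induct)
  case base
  let ?m = "length D"
  have "(\<Sum>F\<in>Pi\<^sub>E (insert ?m {}) (colourings n D). if F ?m = xs \<and> F ?m = ys then 1 else 0 :: complex) =
      (\<Sum>y\<in>colourings n D ?m. if y = xs then (if xs = ys then 1 else 0) else 0)"
    by (subst sum_PiE_insert, simp, cases "xs = ys") (auto intro!: sum.cong sum.neutral)
  also have "\<dots> = (if ys = xs then 1 else 0)"
    using base finite_colourings by auto
  finally have "(\<Sum>F\<in>Pi\<^sub>E {?m..?m} (colourings n D). if F ?m = xs \<and> F ?m = ys
      then \<Prod>i\<in>{?m..<?m}. rt_layer H \<rho> (D ! i) (F (Suc i)) (F i) else 0) = (if ys = xs then 1 else 0)"
    by (simp only: atLeastAtMost_singleton atLeastLessThan_empty[OF order_refl] prod.empty)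
  then show ?case by (simp only: drop_all[OF order_refl] rt_diagram.simps)
next
  case (step k)
  let ?m = "length D"
  let ?W = "\<lambda>k F. \<Prod>i\<in>{k..<?m}. rt_layer H \<rho> (D ! i) (F (Suc i)) (F i)"
  have k: "k < ?m" using step by simp
  have "rt_diagram H n \<rho> (drop k D) ys xs =
      (\<Sum>zs\<in>colourings n D (Suc k). rt_diagram H n \<rho> (drop (Suc k) D) ys zs * rt_layer H \<rho> (D ! k) zs xs)"
    using k by (simp add: Cons_nth_drop_Suc[symmetric] colourings_def line_upper)
  also have "\<dots> = (\<Sum>zs\<in>colourings n D (Suc k). \<Sum>F\<in>Pi\<^sub>E {Suc k..?m} (colourings n D).
      if F (Suc k) = zs \<and> F ?m = ys then ?W (Suc k) F * rt_layer H \<rho> (D ! k) zs xs else 0)"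
    by (intro sum.cong refl) (simp add: step.IH sum_distrib_right if_distrib[of "\<lambda>z. z * _"] cong: if_cong)
  also have "\<dots> = (\<Sum>F\<in>Pi\<^sub>E {Suc k..?m} (colourings n D). \<Sum>zs\<in>colourings n D (Suc k).
      if F (Suc k) = zs \<and> F ?m = ys then ?W (Suc k) F * rt_layer H \<rho> (D ! k) zs xs else 0)"
    by (rule sum.swap)
  \<comment> \<open>The sum over the line above layer k collapses to the value prescribed by
    \<open>F\<close>, and a trivial sum over colourings of line k is inserted, which extends
    \<open>F\<close> to that line.\<close>
  also have "\<dots> = (\<Sum>F\<in>Pi\<^sub>E {Suc k..?m} (colourings n D). \<Sum>zs\<in>colourings n D k.
      if (F(k := zs)) k = xs \<and> (F(k := zs)) ?m = ys then ?W k (F(k := zs)) else 0)"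
  proof (rule sum.cong[OF refl])
    fix F assume "F \<in> Pi\<^sub>E {Suc k..?m} (colourings n D)"
    then have F: "F (Suc k) \<in> colourings n D (Suc k)" using k by (auto simp: PiE_def Pi_def)
    have W: "?W k (F(k := zs)) = rt_layer H \<rho> (D ! k) (F (Suc k)) zs * ?W (Suc k) F" for zs
    proof -
      have "?W (Suc k) (F(k := zs)) = ?W (Suc k) F" by (intro prod.cong) auto
      then show ?thesis
        using k by (subst prod.atLeast_Suc_lessThan) (simp_all del: fun_upd_apply, simp)
    qed
    have "(\<Sum>zs\<in>colourings n D (Suc k).
        if F (Suc k) = zs \<and> F ?m = ys then ?W (Suc k) F * rt_layer H \<rho> (D ! k) zs xs else 0) =
      (\<Sum>zs\<in>colourings n D (Suc k). if F (Suc k) = zs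
        then (if F ?m = ys then ?W (Suc k) F * rt_layer H \<rho> (D ! k) zs xs else 0) else 0)"
      by (intro sum.cong) auto
    also have "\<dots> = (if F ?m = ys then ?W (Suc k) F * rt_layer H \<rho> (D ! k) (F (Suc k)) xs else 0)"
      using F finite_colourings by simp
    also have "\<dots> = (\<Sum>zs\<in>colourings n D k. if zs = xs
        then (if F ?m = ys then ?W (Suc k) F * rt_layer H \<rho> (D ! k) (F (Suc k)) zs else 0) else 0)"
      using step.prems finite_colourings by simp
    also have "\<dots> = (\<Sum>zs\<in>colourings n D k.
      if (F(k := zs)) k = xs \<and> (F(k := zs)) ?m = ys then ?W k (F(k := zs)) else 0)"
      unfolding W using k by (intro sum.cong refl) (auto simp: mult.commute)
    finally show "(\<Sum>zs\<in>colourings n D (Suc k).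
        if F (Suc k) = zs \<and> F ?m = ys then ?W (Suc k) F * rt_layer H \<rho> (D ! k) zs xs else 0) =
      (\<Sum>zs\<in>colourings n D k.
        if (F(k := zs)) k = xs \<and> (F(k := zs)) ?m = ys then ?W k (F(k := zs)) else 0)" .
  qed
  also have "\<dots> = (\<Sum>F\<in>Pi\<^sub>E (insert k {Suc k..?m}) (colourings n D). if F k = xs \<and> F ?m = ys then ?W k F else 0)"
    by (rule sum_PiE_insert[symmetric]) simp
  finally have "rt_diagram H n \<rho> (drop k D) ys xs =
    (\<Sum>F\<in>Pi\<^sub>E (insert k {Suc k..?m}) (colourings n D). if F k = xs \<and> F ?m = ys then ?W k F else 0)" .
  moreover have "insert k {Suc k..?m} = {k..?m}" using k by auto
  ultimately show ?case by (simp only:)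
qed

section \<open>The Reshetikhin--Turaev invariant\<close>

lemma (in long_knot) walk_time:
  assumes "p \<in> set (points D)"
  shows "time p < length (walk D)" and "walk D ! time p = p"
  using assms unfolding set_walk[symmetric] by (metis in_set_conv_nth time_walk)+

lemma take_drop_two: "Suc i < length xs \<Longrightarrow> take (Suc (Suc 0)) (drop i xs) = [xs ! i, xs ! Suc i]"
  by (simp add: take_Suc_conv_app_nth)

lemma take_eq_iff: "a \<le> length xs \<Longrightarrow> a \<le> length ys \<Longrightarrow>
    take a xs = take a ys \<longleftrightarrow> (\<forall>j<a. xs ! j = ys ! j)"
  by (auto simp: list_eq_iff_nth_eq)

lemma drop_eq_iff: "length xs = a + c \<Longrightarrow> length ys = b + c \<Longrightarrow>
    drop a xs = drop b ys \<longleftrightarrow> (\<forall>j<c. xs ! (a + j) = ys ! (b + j))"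
  by (auto simp: list_eq_iff_nth_eq)

lemma colourings_bound: "zs \<in> colourings n D k \<Longrightarrow> j < length zs \<Longrightarrow> zs ! j < n"
  unfolding colourings_def using nth_mem by blast

section \<open>Weights of arcs, pieces and layers\<close>

locale sw_state_sum = long_knot +
  fixes H :: "sw_index ribbon_data" and n :: nat and \<rho> :: "complex^sw_index \<Rightarrow> complex mat"
  assumes mul: "alg_mul H = sw_mul" and unit: "alg_unit H = sw_unit"
    and module: "hopf_module H n \<rho>"
begin

lemma rho_carrier: "\<rho> x \<in> carrier_mat n n"
  and rho_mult: "\<rho> (sw_mul x y) = \<rho> x * \<rho> y"
  and rho_unit: "\<rho> sw_unit = 1\<^sub>m n"
  using module by (auto simp: hopf_module_def mul unit)

lemma clinear_rho_entry: "i < n \<Longrightarrow> j < n \<Longrightarrow> clinear_form (\<lambda>x. \<rho> x $$ (i, j))"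
  using module carrier_matD[OF rho_carrier] by (simp add: clinear_form_iff hopf_module_def)

text \<open>In contrast to the universal invariant, the inverse balancing element sits at the
  minimum of C, because the functor assigns it to the counterclockwise coevaluation.\<close>

definition rt_bead :: "event \<Rightarrow> complex^sw_index" where
  "rt_bead x = (if x = Turn MaxCW then balancing H
     else if x = Turn MinCCW then balancing_inv H else sw_unit)"

abbreviation beads :: "(nat \<Rightarrow> sw_index \<times> sw_index) \<Rightarrow> event \<Rightarrow> complex^sw_index" where
  "beads \<equiv> crossing_beads (crossings D) rt_bead"

definition arc :: "(nat \<Rightarrow> sw_index \<times> sw_index) \<Rightarrow> point \<Rightarrow> complex mat" where
  "arc c p = \<rho> (sw_word (beads c) (events_at D p))"

text \<open>The column index is the colour at the start of the arc and the row index the colour at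
  its end, as composition along the orientation requires.\<close>

definition entry :: "(nat \<Rightarrow> nat list) \<Rightarrow> (nat \<Rightarrow> sw_index \<times> sw_index) \<Rightarrow> point \<Rightarrow> complex" where
  "entry F c p = (case next_point D p of (k', j') \<Rightarrow> case p of (k, j) \<Rightarrow> arc c p $$ (F k' ! j', F k ! j))"

definition layer_weight :: "(nat \<Rightarrow> nat list) \<Rightarrow> nat \<Rightarrow> (nat \<Rightarrow> sw_index \<times> sw_index) \<Rightarrow> complex" where
  "layer_weight F k c = (case D ! k of (l, P, r) \<Rightarrow>
     (\<Prod>j<length l. entry F c (if l ! j = Up then k else Suc k, j)) *
     (\<Prod>p\<in>piece_tails P k (length l). entry F c p) *
     (\<Prod>j<length r. entry F c (if r ! j = Up then (k, length l + length (source P) + j)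
        else (Suc k, length l + length (target P) + j))))"

text \<open>The structure coefficients of \<open>rt_piece\<close> with the indices of a crossing
  fixed, written as products of matrix entries with rows at the ends and columns at the starts of
  the arcs; \<open>a\<close> is the position of the left strand.\<close>

fun piece_weight :: "piece \<Rightarrow> sw_index \<times> sw_index \<Rightarrow> nat list \<Rightarrow> nat list \<Rightarrow> nat \<Rightarrow> complex" where
  "piece_weight PosX q ys xs a =
     \<rho> (basis (fst q)) $$ (ys ! Suc a, xs ! a) * \<rho> (basis (snd q)) $$ (ys ! a, xs ! Suc a)"
| "piece_weight NegX q ys xs a =
     \<rho> (basis (snd q)) $$ (ys ! Suc a, xs ! a) * \<rho> (basis (fst q)) $$ (ys ! a, xs ! Suc a)"
| "piece_weight MaxCCW q ys xs a = 1\<^sub>m n $$ (xs ! a, xs ! Suc a)"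
| "piece_weight MaxCW q ys xs a = \<rho> (balancing H) $$ (xs ! Suc a, xs ! a)"
| "piece_weight MinCCW q ys xs a = \<rho> (balancing_inv H) $$ (ys ! Suc a, ys ! a)"
| "piece_weight MinCW q ys xs a = 1\<^sub>m n $$ (ys ! a, ys ! Suc a)"

context
  fixes k l P r F
  assumes k: "k < length D" and layer: "D ! k = (l, P, r)"
    and F: "F k \<in> colourings n D k" "F (Suc k) \<in> colourings n D (Suc k)"
begin

lemma lengths: "length (F k) = length l + length (source P) + length r"
    "length (F (Suc k)) = length l + length (target P) + length r"
  using F by (simp_all add: colourings_def layer_line_lower[OF k layer] layer_line_upper[OF k layer])

lemma colour_bound: "j < length (F k) \<Longrightarrow> F k ! j < n" "j < length (F (Suc k)) \<Longrightarrow> F (Suc k) ! j < n"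
  using F colourings_bound by blast+

lemma crossing_iff: "k \<in> crossings D \<longleftrightarrow> P = PosX \<or> P = NegX"
  using k by (auto simp: crossings_def pieces_nth[OF k layer])

lemma entry_left:
  assumes "j < length l"
  shows "entry F c (if l ! j = Up then k else Suc k, j) = (if F (Suc k) ! j = F k ! j then 1 else 0)"
  using assms next_point_left[OF k layer assms] events_at_left[OF k layer assms]
    colour_bound[of j] lengths
  by (cases "l ! j") (auto simp: entry_def arc_def sw_word_Nil rho_unit)

lemma entry_right:
  assumes "j < length r"
  shows "entry F c (if r ! j = Up then (k, length l + length (source P) + j)
      else (Suc k, length l + length (target P) + j)) =
    (if F (Suc k) ! (length l + length (target P) + j) = F k ! (length l + length (source P) + j)
     then 1 else 0)"
  using assms next_point_right[OF k layer assms] events_at_right[OF k layer assms]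
    colour_bound(1)[of "length l + length (source P) + j"]
    colour_bound(2)[of "length l + length (target P) + j"] lengths
  by (cases "r ! j") (auto simp: entry_def arc_def sw_word_Nil rho_unit)

lemma sw_word_singleton: "sw_word v [x] = v x"
  by (simp add: sw_word_Cons sw_word_Nil sw_one)

lemma entry_piece:
  "(\<Prod>p\<in>piece_tails P k (length l). entry F c p) = piece_weight P (c k) (F (Suc k)) (F k) (length l)"
proof -
  note np = next_point_piece[OF k layer] and ev = events_at_piece[OF k layer]
  show ?thesis
    using crossing_iff np ev
    by (cases P) (simp_all add: entry_def arc_def sw_word_singleton crossing_beads_def rt_bead_def
        rho_unit mult.commute)
qed

text \<open>Arcs beside the piece carry identity matrices, whose entries force equal colours at both
  ends; this reproduces the condition in \<open>rt_layer\<close>.\<close>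

lemma layer_weight_eq:
  "layer_weight F k c =
    (if take (length l) (F (Suc k)) = take (length l) (F k) \<and>
        drop (length l + length (target P)) (F (Suc k)) = drop (length l + length (source P)) (F k)
     then piece_weight P (c k) (F (Suc k)) (F k) (length l) else 0)"
proof -
  have "layer_weight F k c =
      (\<Prod>j<length l. if F (Suc k) ! j = F k ! j then 1 else 0) *
      piece_weight P (c k) (F (Suc k)) (F k) (length l) *
      (\<Prod>j<length r. if F (Suc k) ! (length l + length (target P) + j) =
         F k ! (length l + length (source P) + j) then 1 else 0)"
    unfolding layer_weight_def layer prod.case entry_piece
    by (intro arg_cong2[where f = "(*)"] prod.cong refl entry_left entry_right) simp_all
  then show ?thesis
    using lengths
    by (auto simp: prod_indicator take_eq_iff drop_eq_iff[where c = "length r"] lessThan_iff)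
qed

lemma layer_weight_local: "layer_weight F k c = layer_weight F k (\<lambda>_. c k)"
  by (simp add: layer_weight_eq)

lemma rt_layer_no_crossing:
  assumes "k \<notin> crossings D"
  shows "rt_layer H \<rho> (D ! k) (F (Suc k)) (F k) = layer_weight F k c"
  using assms lengths colour_bound(1)[of "length l"] colour_bound(1)[of "Suc (length l)"]
    colour_bound(2)[of "length l"] colour_bound(2)[of "Suc (length l)"]
  by (cases P) (auto simp: crossing_iff layer_weight_eq layer take_drop_two)

lemma rt_layer_crossing:
  assumes "k \<in> crossings D"
  shows "rt_layer H \<rho> (D ! k) (F (Suc k)) (F k) =
    (\<Sum>q\<in>UNIV. crossing_matrix H D k $ q * layer_weight F k (\<lambda>_. q))"
  using assms lengths pieces_nth[OF k layer]
  by (cases P) (auto simp: crossing_iff layer_weight_eq layer take_drop_two crossing_matrix_def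
      case_prod_unfold mult_ac)

end

text \<open>Each crossing layer is a sum over its own bead index, so the product of the layers is a
  sum over all choices of indices. For a fixed choice only entries of single arcs remain, and these
  may be multiplied in the order of the walk.\<close>

lemma prod_rt_layer:
  assumes F: "F \<in> Pi\<^sub>E {0..length D} (colourings n D)"
  shows "(\<Prod>k<length D. rt_layer H \<rho> (D ! k) (F (Suc k)) (F k)) =
    (\<Sum>c\<in>crossings D \<rightarrow>\<^sub>E UNIV. (\<Prod>k\<in>crossings D. crossing_matrix H D k $ c k) *
       (\<Prod>t<length (walk D) - 1. entry F c (walk D ! t)))"
proof -
  let ?m = "length D" and ?K = "crossings D" and ?t = "crossing_matrix H D"
  let ?L = "\<lambda>k. rt_layer H \<rho> (D ! k) (F (Suc k)) (F k)"
  have C: "F k \<in> colourings n D k" "F (Suc k) \<in> colourings n D (Suc k)" if "k < ?m" for k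
    using F that by (auto simp: PiE_def Pi_def)
  have K: "?K \<subseteq> {..<?m}" by (auto simp: crossings_def)
  have loc: "layer_weight F k c = layer_weight F k (\<lambda>_. c k)" if "k < ?m" for k c
  proof -
    obtain l P r where "D ! k = (l, P, r)" by (metis prod_cases3)
    from layer_weight_local[of k l P r F, OF that this C[OF that]] show ?thesis .
  qed
  have no: "?L k = layer_weight F k c" if "k < ?m" "k \<notin> ?K" for k c
  proof -
    obtain l P r where "D ! k = (l, P, r)" by (metis prod_cases3)
    from rt_layer_no_crossing[of k l P r F, OF that(1) this C[OF that(1)] that(2)] show ?thesis .
  qed
  have yes: "?L k = (\<Sum>q\<in>UNIV. ?t k $ q * layer_weight F k (\<lambda>_. q))" if "k < ?m" "k \<in> ?K" for k
  proof -
    obtain l P r where "D ! k = (l, P, r)" by (metis prod_cases3)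
    from rt_layer_crossing[of k l P r F, OF that(1) this C[OF that(1)] that(2)] show ?thesis .
  qed
  \<comment> \<open>Every point except the upper end is the tail of exactly one arc, and the walk
    without its last entry lists these points.\<close>
  have walk: "(\<Prod>t<length (walk D) - 1. entry F c (walk D ! t)) = (\<Prod>k<?m. layer_weight F k c)" for c
  proof -
    have "(\<Prod>k<?m. layer_weight F k c) = prod (entry F c) (set (points D) - {(?m, 0)})"
      unfolding prod.points_layers[OF knot] layer_weight_def ..
    also have "set (points D) - {(?m, 0)} = (!) (walk D) ` {..<length (walk D) - 1}"
    proof -
      have "set (walk D) = insert (?m, 0) ((!) (walk D) ` {..<length (walk D) - 1})"
      proof -
        have "{..<length (walk D)} = insert (length (walk D) - 1) {..<length (walk D) - 1}"
          using walk_nonempty by auto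
        moreover have "set (walk D) = (!) (walk D) ` {..<length (walk D)}"
          by (auto simp: set_conv_nth)
        ultimately show ?thesis using walk_last by simp
      qed
      moreover have "(?m, 0) \<notin> (!) (walk D) ` {..<length (walk D) - 1}"
      proof
        assume "(?m, 0) \<in> (!) (walk D) ` {..<length (walk D) - 1}"
        then obtain t where t: "t < length (walk D) - 1" "walk D ! t = walk D ! (length (walk D) - 1)"
          unfolding walk_last by (metis imageE lessThan_iff)
        then have "t < length (walk D)" "length (walk D) - 1 < length (walk D)" by linarith+
        with t show False
          using nth_eq_iff_index_eq[OF distinct_walk, of t "length (walk D) - 1"] by simp
      qed
      ultimately show ?thesis using set_walk by auto
    qed
    also have "prod (entry F c) \<dots> = (\<Prod>t<length (walk D) - 1. entry F c (walk D ! t))"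
      using distinct_walk by (subst prod.reindex) (auto simp: inj_on_def nth_eq_iff_index_eq)
    finally show ?thesis by simp
  qed
  have "(\<Prod>k<?m. ?L k) = (\<Prod>k\<in>{..<?m} - ?K. ?L k) * (\<Prod>k\<in>?K. ?L k)"
    by (rule prod.subset_diff[OF K]) simp
  also have "(\<Prod>k\<in>?K. ?L k) = (\<Prod>k\<in>?K. \<Sum>q\<in>UNIV. ?t k $ q * layer_weight F k (\<lambda>_. q))"
    by (rule prod.cong[OF refl], rule yes) (use K in auto)
  \<comment> \<open>Distributivity: a product of sums over the crossings is a sum over functions on
    the crossings.\<close>
  also have "\<dots> = (\<Sum>c\<in>?K \<rightarrow>\<^sub>E UNIV. \<Prod>k\<in>?K. ?t k $ c k * layer_weight F k (\<lambda>_. c k))"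
    by (rule prod_sum_PiE) (simp_all add: finite_crossings)
  also have "(\<Prod>k\<in>{..<?m} - ?K. ?L k) * \<dots> =
      (\<Sum>c\<in>?K \<rightarrow>\<^sub>E UNIV. (\<Prod>k\<in>?K. ?t k $ c k) * (\<Prod>k<?m. layer_weight F k c))"
    unfolding sum_distrib_left
  proof (rule sum.cong[OF refl])
    fix c
    have "(\<Prod>k\<in>{..<?m} - ?K. ?L k) = (\<Prod>k\<in>{..<?m} - ?K. layer_weight F k c)"
      by (rule prod.cong[OF refl], rule no) simp_all
    moreover have "(\<Prod>k\<in>?K. layer_weight F k (\<lambda>_. c k)) = (\<Prod>k\<in>?K. layer_weight F k c)"
      by (rule prod.cong[OF refl], rule loc[symmetric]) (use K in auto)
    ultimately show "(\<Prod>k\<in>{..<?m} - ?K. ?L k) * (\<Prod>k\<in>?K. ?t k $ c k * layer_weight F k (\<lambda>_. c k)) =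
        (\<Prod>k\<in>?K. ?t k $ c k) * (\<Prod>k<?m. layer_weight F k c)"
      by (simp only: prod.distrib prod.subset_diff[OF K finite_lessThan] mult_ac)
  qed
  finally show ?thesis unfolding walk .
qed

text \<open>The walk enumerates the points bijectively, so a colouring of the points, given line by
  line, is the same as a path of indices in time.\<close>

lemma sum_colourings_walk:
  "(\<Sum>F\<in>Pi\<^sub>E {0..length D} (colourings n D). if F 0 = [j] \<and> F (length D) = [i]
      then \<Prod>t<length (walk D) - 1. entry F c (walk D ! t) else 0) =
   (\<Sum>x\<in>{..length (walk D) - 1} \<rightarrow>\<^sub>E {..<n}. if x 0 = j \<and> x (length (walk D) - 1) = i
      then \<Prod>t<length (walk D) - 1. arc c (walk D ! t) $$ (x (Suc t), x t) else 0)"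
proof -
  let ?N = "length (walk D) - 1" and ?m = "length D"
  \<comment> \<open>\<open>\<phi>\<close> reads the colours in the order of passage and
    \<open>\<psi>\<close> writes them back to the lines. Both are restricted to their domains
    because the sums run over extensional functions.\<close>
  define \<phi> where "\<phi> F = (\<lambda>t\<in>{..?N}. case walk D ! t of (k, j) \<Rightarrow> F k ! j)" for F :: "nat \<Rightarrow> nat list"
  define \<psi> where "\<psi> x = (\<lambda>k\<in>{0..?m}. map (\<lambda>j. x (time (k, j))) [0..<length (line D k)])" for x :: "nat \<Rightarrow> nat"
  have N: "t \<le> ?N \<longleftrightarrow> t < length (walk D)" "t \<le> length (walk D) - Suc 0 \<longleftrightarrow> t < length (walk D)" for t
    using walk_nonempty by (cases "walk D"; auto)+
  have pt: "walk D ! t \<in> set (points D)" if "t \<le> ?N" for t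
    using that nth_mem[of t "walk D"] unfolding N set_walk by simp
  show ?thesis
  proof (rule sum.reindex_bij_witness[where i = \<psi> and j = \<phi>])
    fix F assume F: "F \<in> Pi\<^sub>E {0..?m} (colourings n D)"
    then have len: "length (F k) = length (line D k)" if "k \<le> ?m" for k
      using that by (auto simp: PiE_def Pi_def colourings_def)
    show "\<psi> (\<phi> F) = F"
    proof
      fix k
      show "\<psi> (\<phi> F) k = F k"
      proof (cases "k \<le> ?m")
        case True
        have "\<phi> F (time (k, j)) = F k ! j" if "j < length (line D k)" for j
          using walk_time[of "(k, j)"] True that by (simp add: \<phi>_def N set_points)
        then show ?thesis using True len[OF True] by (auto simp: \<psi>_def intro!: nth_equalityI)
      qed (use F in \<open>auto simp: \<psi>_def PiE_def extensional_def\<close>)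
    qed
    show "\<phi> F \<in> {..?N} \<rightarrow>\<^sub>E {..<n}"
    proof (rule PiE_I)
      fix t assume t: "t \<in> {..?N}"
      obtain k j where kj: "walk D ! t = (k, j)" by fastforce
      then have "k \<le> ?m" "j < length (line D k)" using pt[of t] t by (auto simp: set_points)
      moreover from this have "F k ! j < n"
        using F len colourings_bound[of "F k" n D k j] by (auto simp: PiE_def Pi_def)
      ultimately show "\<phi> F t \<in> {..<n}" using t kj by (auto simp: \<phi>_def)
    qed (simp add: \<phi>_def)
    have ends: "\<phi> F 0 = F 0 ! 0" "\<phi> F ?N = F ?m ! 0"
      by (simp_all add: \<phi>_def walk_0 walk_last[unfolded One_nat_def])
    have "F 0 = [F 0 ! 0]" "F ?m = [F ?m ! 0]"
      using len[of 0] len[of ?m] line_first line_last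
      by (auto simp: list_eq_iff_nth_eq)
    then have e: "F 0 = [j] \<longleftrightarrow> \<phi> F 0 = j" "F ?m = [i] \<longleftrightarrow> \<phi> F ?N = i"
      unfolding ends by (metis nth_Cons_0)+
    have "arc c (walk D ! t) $$ (\<phi> F (Suc t), \<phi> F t) = entry F c (walk D ! t)" if "t < ?N" for t
      using that walk_Suc[of t] by (simp add: entry_def \<phi>_def split: prod.split)
    then show "(if \<phi> F 0 = j \<and> \<phi> F ?N = i then \<Prod>t<?N. arc c (walk D ! t) $$ (\<phi> F (Suc t), \<phi> F t) else 0) =
        (if F 0 = [j] \<and> F ?m = [i] then \<Prod>t<?N. entry F c (walk D ! t) else 0)"
      unfolding e by simp
  next
    fix x assume x: "x \<in> {..?N} \<rightarrow>\<^sub>E {..<n}"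
    show "\<phi> (\<psi> x) = x"
    proof
      fix t
      show "\<phi> (\<psi> x) t = x t"
      proof (cases "t \<le> ?N")
        case True
        obtain k j where kj: "walk D ! t = (k, j)" by fastforce
        then have "k \<le> ?m" "j < length (line D k)" using pt[OF True] by (auto simp: set_points)
        moreover have "time (k, j) = t" using time_walk[of t] True kj by (simp add: N)
        ultimately show ?thesis using True kj by (simp add: \<phi>_def \<psi>_def)
      qed (use x in \<open>auto simp: \<phi>_def PiE_def extensional_def\<close>)
    qed
    have "x (time (k, j)) < n" if "k \<le> ?m" "j < length (line D k)" for k j
      using walk_time(1)[of "(k, j)"] x that by (auto simp: N(2)[symmetric] set_points PiE_def Pi_def)
    then show "\<psi> x \<in> Pi\<^sub>E {0..?m} (colourings n D)"
      by (auto simp: \<psi>_def colourings_def)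
  qed
qed

lemma mat_prod_walk:
  assumes "T \<le> length (walk D)"
  shows "mat_prod n (\<lambda>t. arc c (walk D ! t)) T =
    \<rho> (sw_word (beads c) (concat (map (events_at D) (take T (walk D)))))"
  using assms
proof (induction T)
  case (Suc T)
  then show ?case
    by (simp add: take_Suc_conv_app_nth sw_word_append rho_mult arc_def)
qed (simp add: sw_word_Nil rho_unit)

text \<open>There is one arc fewer than there are points, and no event occurs at the upper
  end.\<close>

lemma events_butlast:
  "concat (map (events_at D) (take (length (walk D) - 1) (walk D))) = events D"
proof -
  have "walk D = take (length (walk D) - 1) (walk D) @ [(length D, 0)]"
    using walk_nonempty walk_last by (metis append_butlast_last_id butlast_conv_take last_conv_nth)
  then have "events D = concat (map (events_at D) (take (length (walk D) - 1) (walk D) @ [(length D, 0)]))"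
    unfolding events_def by metis
  then show ?thesis by (simp add: events_at_def line_last)
qed

text \<open>After exchanging the sums over colourings and over bead indices, the inner sum is an
  entry of a matrix product along the knot. The representation turns this product into the matrix of
  one word.\<close>

lemma rt_diagram_eq:
  assumes ij: "i < n" "j < n"
  shows "rt_diagram H n \<rho> D [i] [j] =
    \<rho> (\<Sum>c\<in>crossings D \<rightarrow>\<^sub>E UNIV. (\<Prod>k\<in>crossings D. crossing_matrix H D k $ c k) *s
      sw_word (beads c) (events D)) $$ (i, j)"
proof -
  let ?m = "length D" and ?K = "crossings D" and ?N = "length (walk D) - 1"
  let ?W = "\<lambda>c. \<Prod>k\<in>?K. crossing_matrix H D k $ c k"
  let ?E = "\<lambda>F c. \<Prod>t<?N. entry F c (walk D ! t)"
  have "[j] \<in> colourings n D 0" using ij by (simp add: colourings_def line_first)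
  from rt_diagram_drop[OF le0 this, of H \<rho> "[i]", unfolded drop_0 atLeast0LessThan]
  have "rt_diagram H n \<rho> D [i] [j] = (\<Sum>F\<in>Pi\<^sub>E {0..?m} (colourings n D). if F 0 = [j] \<and> F ?m = [i]
       then \<Prod>k<?m. rt_layer H \<rho> (D ! k) (F (Suc k)) (F k) else 0)"
    .
  also have "\<dots> = (\<Sum>F\<in>Pi\<^sub>E {0..?m} (colourings n D). \<Sum>c\<in>?K \<rightarrow>\<^sub>E UNIV.
      ?W c * (if F 0 = [j] \<and> F ?m = [i] then ?E F c else 0))"
  proof (rule sum.cong[OF refl])
    fix F assume "F \<in> Pi\<^sub>E {0..?m} (colourings n D)"
    then show "(if F 0 = [j] \<and> F ?m = [i] then \<Prod>k<?m. rt_layer H \<rho> (D ! k) (F (Suc k)) (F k) else 0) =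
        (\<Sum>c\<in>?K \<rightarrow>\<^sub>E UNIV. ?W c * (if F 0 = [j] \<and> F ?m = [i] then ?E F c else 0))"
      by (cases "F 0 = [j]"; cases "F ?m = [i]") (simp_all add: prod_rt_layer)
  qed
  also have "\<dots> = (\<Sum>c\<in>?K \<rightarrow>\<^sub>E UNIV. ?W c * (\<Sum>F\<in>Pi\<^sub>E {0..?m} (colourings n D).
      if F 0 = [j] \<and> F ?m = [i] then ?E F c else 0))"
    unfolding sum_distrib_left by (rule sum.swap)
  also have "\<dots> = (\<Sum>c\<in>?K \<rightarrow>\<^sub>E UNIV. ?W c * mat_prod n (\<lambda>t. arc c (walk D ! t)) ?N $$ (i, j))"
    unfolding sum_colourings_walk
    by (subst mat_prod_entry) (simp_all add: ij arc_def rho_carrier)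
  also have "\<dots> = (\<Sum>c\<in>?K \<rightarrow>\<^sub>E UNIV. ?W c * \<rho> (sw_word (beads c) (events D)) $$ (i, j))"
    by (simp only: mat_prod_walk[OF diff_le_self] events_butlast)
  also have "\<dots> = \<rho> (\<Sum>c\<in>?K \<rightarrow>\<^sub>E UNIV. ?W c *s sw_word (beads c) (events D)) $$ (i, j)"
    by (simp only: clinear_form_sum[OF clinear_rho_entry[OF ij]]
        clinear_form_scale[OF clinear_rho_entry[OF ij]])
  finally show ?thesis .
qed

end

lemma rt_invariant_sw:
  assumes H: "ribbon_hopf_algebra H" "alg_mul H = sw_mul" "alg_unit H = sw_unit"
    and \<rho>: "hopf_module H n \<rho>" and D: "rotational_diagram D"
  shows "rt_invariant H n \<rho> D = 1\<^sub>m n"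
proof -
  interpret sw_state_sum D H n \<rho>
    using D H \<rho> by unfold_locales (simp_all add: rotational_diagram_def)
  obtain \<sigma> g where \<sigma>: "\<sigma> * \<sigma> = 1" and g: "sw_mul g g = sw_unit" "sw_char \<sigma> g = 1"
    and R: "sw_involutive \<sigma> g (rmatrix H)" "sw_involutive \<sigma> g (rmatrix_inv H)"
    and bal: "balancing H = g" "balancing_inv H = g"
    by (rule sw_ribbon_structure[OF H])
  have "rt_diagram H n \<rho> D [i] [j] = 1\<^sub>m n $$ (i, j)" if "i < n" "j < n" for i j
    using rt_diagram_eq[OF that] crossing_sum_eq_unit[OF D R \<sigma> g, of MinCCW MaxCW rt_bead]
    by (simp add: rt_bead_def bal rho_unit)
  then show ?thesis unfolding rt_invariant_def by (intro eq_matI) auto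
qed

theorem corollary3p7:
  fixes H :: "sw_index ribbon_data"
  assumes "ribbon_hopf_algebra H"
    and "alg_mul H = sw_mul" and "alg_unit H = sw_unit"
  shows "(\<forall>D D'. rotational_diagram D \<and> rotational_diagram D' \<and> framing D = framing D' \<longrightarrow>
            universal_invariant H D = universal_invariant H D') \<and>
         (\<forall>n \<rho>. hopf_module H n \<rho> \<longrightarrow>
            (\<forall>D D'. rotational_diagram D \<and> rotational_diagram D' \<and> framing D = framing D' \<longrightarrow>
               rt_invariant H n \<rho> D = rt_invariant H n \<rho> D'))"
  using universal_invariant_sw[OF assms] rt_invariant_sw[OF assms] by simp

end
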